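(* Assume that $K_0$ has cardinality $n+1$ and that its points are affinely independent. Then for any Lipschitz function $f:K\to\mathbb R$, any probability measure $\mu$ on $K$ and any $t>0$, $$\mathbb{E}_{\mu}\big(f(X_t^{\gamma})\big)\ \underset{\gamma\to+\infty}{\longrightarrow}\ \mathbb{E}_{\overline{\mu}}\big(\overline{f}(\overline{X}_t)\big),$$ where $\overline f$ is the restriction of $f$ to $K_0$ and $(\overline X_t)_{t\ge 0}$ is the pure jump continuous-time Markov process on the finite state space $K_0$ with initial distribution $\overline\mu$ and generator $\overline{\mathcal L}$ given by $$\overline{\mathcal L}=\big(b(x)\cdot\nabla_x H_z(x)\big)_{x,z\in K_0},\qquad \overline\mu(z)=\int_K H_z(x)\,\mathrm d\mu(x)\quad\text{for } z\in K_0 .$$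
   Context: Setting. $n\ge 1$ and $K\subset\mathbb R^n$ is a simplex (the convex hull of $n+1$ affinely independent points). The maps $\sigma,\sigma_0:K\to\mathcal M_n(\mathbb R)$ and $b:K\to\mathbb R^n$ are Lipschitz, and $(W_t)_{t\ge0}$, $(B_t)_{t\ge0}$ are two independent standard Brownian motions in $\mathbb R^n$. For $\gamma>0$, $(X^\gamma_t)_{t\ge 0}$ is the solution of $$dX_t^{\gamma}=\sqrt{\gamma}\,\sigma(X_t^{\gamma})\,dW_t+b(X_t^{\gamma})\,dt+\sigma_0(X_t^{\gamma})\,dB_t,$$ and $(X_t(x))_{t\ge0}$ is the solution of $dX_t=\sigma(X_t)\,dW_t$, $X_0(x)=x\in K$. It is assumed that $\sigma,\sigma_0,b$ are such that, for every initial condition in $K$ and every $\gamma$, the processes $X^\gamma$ and $X$ stay in $K$ for all times. It is also assumed that $K_0=\{x\in K:\ \sigma(x)=0\}$ is finite. $\mathbb E_\mu$ denotes expectation when the initial condition has law $\mu$ (independent of the Brownian motions). For each $x\in K$, $X_t(x)$ (a bounded martingale) converges almost surely as $t\to+\infty$ to a random variable $X_\infty(x)$ with values in $K_0$. For $z\in K_0$, $H_z:K\to[0,1]$ is $H_z(x)=\mathbb P(X_\infty(x)=z)$. When $K_0$ consists of $n+1$ affinely independent points, $H_z$ is the (restriction to $K$ of the) unique affine function with $H_z(z)=1$ and $H_z(y)=0$ for $y\in K_0\setminus\{z\}$, so $\nabla_x H_z$ is well defined. The matrix $\overline{\mathcal L}$ has rows indexed by $x$ and columns by $z$; it acts on functions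 $g:K_0\to\mathbb R$ by $(\overline{\mathcal L}g)(x)=\sum_{z\in K_0}\big(b(x)\cdot\nabla_xH_z(x)\big)g(z)$. *)

theory Defs
  imports "HOL-Probability.Probability"
begin

section \<open>Brownian motion relative to a filtration\<close>

text \<open>
  Time is a real number; only nonnegative times matter, and a filtration may be taken constant
  on negative times.
\<close>

definition filtered_prob_space :: "'a measure \<Rightarrow> (real \<Rightarrow> 'a measure) \<Rightarrow> bool" where
  "filtered_prob_space M F \<longleftrightarrow>
     prob_space M \<and> filtration (space M) F \<and> (\<forall>t. subalgebra M (F t))"

definition brownian_motion ::
    "'a measure \<Rightarrow> (real \<Rightarrow> 'a measure) \<Rightarrow> (real \<Rightarrow> 'a \<Rightarrow> real^'n) \<Rightarrow> bool" where
  "brownian_motion M F W \<longleftrightarrow>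
     (\<forall>t\<ge>0. W t \<in> borel_measurable (F t)) \<and>
     (AE \<omega> in M. W 0 \<omega> = 0) \<and>
     (AE \<omega> in M. continuous_on {0..} (\<lambda>t. W t \<omega>)) \<and>
     (\<forall>s t. 0 \<le> s \<and> s < t \<longrightarrow>
        distributed M lborel (\<lambda>\<omega>. W t \<omega> - W s \<omega>)
          (\<lambda>x. ennreal (\<Prod>i\<in>UNIV. normal_density 0 (sqrt (t - s)) (x $ i))) \<and>
        prob_space.indep_set M (sets (F s))
          {(\<lambda>\<omega>. W t \<omega> - W s \<omega>) -` A \<inter> space M | A. A \<in> sets borel})"

definition independent_processes ::
    "'a measure \<Rightarrow> (real \<Rightarrow> 'a \<Rightarrow> real^'n) \<Rightarrow> (real \<Rightarrow> 'a \<Rightarrow> real^'n) \<Rightarrow> bool" where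
  "independent_processes M W B \<longleftrightarrow>
     prob_space.indep_var M
       (\<Pi>\<^sub>M t\<in>{0::real..}. borel) (\<lambda>\<omega>. \<lambda>t\<in>{0..}. W t \<omega>)
       (\<Pi>\<^sub>M t\<in>{0::real..}. borel) (\<lambda>\<omega>. \<lambda>t\<in>{0..}. B t \<omega>)"


section \<open>The Ito integral\<close>

text \<open>
  A simple integrand is given by a partition \<open>0 \<le> p 0 \<le> \<dots> \<le> p k \<le> t\<close> and bounded
  \<open>F (p i)\<close>-measurable matrices \<open>\<xi> i\<close>; its value on \<open>(p i, p (i + 1)]\<close> is \<open>\<xi> i\<close>.
\<close>

definition simple_integrand ::
    "'a measure \<Rightarrow> (real \<Rightarrow> 'a measure) \<Rightarrow> real \<Rightarrow> (nat \<Rightarrow> real) \<Rightarrow> nat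
      \<Rightarrow> (nat \<Rightarrow> 'a \<Rightarrow> real^'n^'m) \<Rightarrow> bool" where
  "simple_integrand M F t p k \<xi> \<longleftrightarrow>
     0 \<le> p 0 \<and> (\<forall>i<k. p i \<le> p (Suc i)) \<and> p k \<le> t \<and>
     (\<forall>i<k. \<xi> i \<in> borel_measurable (F (p i)) \<and> (\<exists>C. \<forall>\<omega>\<in>space M. norm (\<xi> i \<omega>) \<le> C))"

definition simple_process ::
    "(nat \<Rightarrow> real) \<Rightarrow> nat \<Rightarrow> (nat \<Rightarrow> 'a \<Rightarrow> real^'n^'m) \<Rightarrow> real \<Rightarrow> 'a \<Rightarrow> real^'n^'m" where
  "simple_process p k \<xi> s \<omega> = (\<Sum>i<k. indicat_real {p i<..p (Suc i)} s *\<^sub>R \<xi> i \<omega>)"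

definition simple_integral ::
    "(nat \<Rightarrow> real) \<Rightarrow> nat \<Rightarrow> (nat \<Rightarrow> 'a \<Rightarrow> real^'n^'m) \<Rightarrow> (real \<Rightarrow> 'a \<Rightarrow> real^'n) \<Rightarrow> 'a \<Rightarrow> real^'m" where
  "simple_integral p k \<xi> W \<omega> = (\<Sum>i<k. \<xi> i \<omega> *v (W (p (Suc i)) \<omega> - W (p i) \<omega>))"

text \<open>
  \<open>ito_integral M F W H t I\<close>: the random vector \<open>I\<close> is (a version of) the Ito integral of the
  square-integrable matrix-valued process \<open>H\<close> against \<open>W\<close> over \<open>[0, t]\<close>, i.e. the mean-square
  limit of the integrals of simple integrands that converge to \<open>H\<close> in \<open>L\<^sup>2([0, t] \<times> \<Omega>)\<close>.
\<close>

definition ito_integral ::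
    "'a measure \<Rightarrow> (real \<Rightarrow> 'a measure) \<Rightarrow> (real \<Rightarrow> 'a \<Rightarrow> real^'n) \<Rightarrow> (real \<Rightarrow> 'a \<Rightarrow> real^'n^'m)
      \<Rightarrow> real \<Rightarrow> ('a \<Rightarrow> real^'m) \<Rightarrow> bool" where
  "ito_integral M F W H t I \<longleftrightarrow>
     I \<in> borel_measurable M \<and>
     (\<lambda>(s, \<omega>). H s \<omega>) \<in> borel_measurable (restrict_space borel {0..t} \<Otimes>\<^sub>M M) \<and>
     (\<exists>p k \<xi>. (\<forall>m. simple_integrand M F t (p m) (k m) (\<xi> m)) \<and>
        ((\<lambda>m::nat. \<integral>\<^sup>+\<omega>. (\<integral>\<^sup>+s\<in>{0..t}.
            ennreal ((norm (H s \<omega> - simple_process (p m) (k m) (\<xi> m) s \<omega>))\<^sup>2) \<partial>lborel) \<partial>M)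
          \<longlonglongrightarrow> 0) \<and>
        ((\<lambda>m. \<integral>\<^sup>+\<omega>. ennreal ((norm (I \<omega> - simple_integral (p m) (k m) (\<xi> m) W \<omega>))\<^sup>2) \<partial>M)
          \<longlonglongrightarrow> 0))"


section \<open>Stochastic differential equations\<close>

text \<open>
  \<open>sde_solution M F W B \<alpha> \<beta> \<kappa> Z\<close>: the continuous adapted process \<open>Z\<close> satisfies
  \<open>dZ = \<alpha>(Z) dW + \<beta>(Z) dt + \<kappa>(Z) dB\<close>. The initial value \<open>Z 0\<close> is \<open>F 0\<close>-measurable, hence
  independent of the Brownian motions \<open>W\<close> and \<open>B\<close> relative to \<open>F\<close>.
\<close>

definition sde_solution ::
    "'a measure \<Rightarrow> (real \<Rightarrow> 'a measure) \<Rightarrow> (real \<Rightarrow> 'a \<Rightarrow> real^'n) \<Rightarrow> (real \<Rightarrow> 'a \<Rightarrow> real^'n)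
      \<Rightarrow> (real^'n \<Rightarrow> real^'n^'n) \<Rightarrow> (real^'n \<Rightarrow> real^'n) \<Rightarrow> (real^'n \<Rightarrow> real^'n^'n)
      \<Rightarrow> (real \<Rightarrow> 'a \<Rightarrow> real^'n) \<Rightarrow> bool" where
  "sde_solution M F W B \<alpha> \<beta> \<kappa> Z \<longleftrightarrow>
     (\<forall>t\<ge>0. Z t \<in> borel_measurable (F t)) \<and>
     (\<forall>\<omega>\<in>space M. continuous_on {0..} (\<lambda>t. Z t \<omega>)) \<and>
     (\<forall>t\<ge>0. \<exists>I J.
        ito_integral M F W (\<lambda>s \<omega>. \<alpha> (Z s \<omega>)) t I \<and>
        ito_integral M F B (\<lambda>s \<omega>. \<kappa> (Z s \<omega>)) t J \<and>
        (AE \<omega> in M. Z t \<omega> = Z 0 \<omega> + I \<omega> + (LINT s:{0..t}|lborel. \<beta> (Z s \<omega>)) + J \<omega>))"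

definition stays_in :: "'a measure \<Rightarrow> (real^'n) set \<Rightarrow> (real \<Rightarrow> 'a \<Rightarrow> real^'n) \<Rightarrow> bool" where
  "stays_in M K Z \<longleftrightarrow> (\<forall>\<omega>\<in>space M. \<forall>t\<ge>0. Z t \<omega> \<in> K)"


section \<open>Limiting hitting probabilities and the averaged generator\<close>

definition zero_set :: "(real^'n) set \<Rightarrow> (real^'n \<Rightarrow> real^'n^'n) \<Rightarrow> (real^'n) set" where
  "zero_set K \<sigma> = {x\<in>K. \<sigma> x = 0}"

text \<open>
  The event that the limit of \<open>X x t\<close> as \<open>t\<close> tends to infinity is \<open>z\<close> is written as convergence
  of the path to \<open>z\<close>, which makes sense for every path.
\<close>

definition limit_prob ::
    "'a measure \<Rightarrow> (real^'n \<Rightarrow> real \<Rightarrow> 'a \<Rightarrow> real^'n) \<Rightarrow> real^'n \<Rightarrow> real^'n \<Rightarrow> real" where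
  "limit_prob M X z x = measure M {\<omega>\<in>space M. ((\<lambda>t. X x t \<omega>) \<longlongrightarrow> z) at_top}"

text \<open>
  The gradient is taken within the domain \<open>K\<close>, since it is needed at boundary points of \<open>K\<close>;
  it is unique there when \<open>K\<close> is convex with nonempty interior.
\<close>

definition gradient_within :: "(real^'n) set \<Rightarrow> (real^'n \<Rightarrow> real) \<Rightarrow> real^'n \<Rightarrow> real^'n" where
  "gradient_within K h x = (THE g. (h has_derivative (\<lambda>v. g \<bullet> v)) (at x within K))"

definition averaged_generator ::
    "(real^'n) set \<Rightarrow> (real^'n \<Rightarrow> real^'n) \<Rightarrow> (real^'n \<Rightarrow> real^'n \<Rightarrow> real)
      \<Rightarrow> real^'n \<Rightarrow> real^'n \<Rightarrow> real" where
  "averaged_generator K b H x z = b x \<bullet> gradient_within K (H z) x"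

definition averaged_initial ::
    "(real^'n) set \<Rightarrow> (real^'n) measure \<Rightarrow> (real^'n \<Rightarrow> real^'n \<Rightarrow> real) \<Rightarrow> real^'n \<Rightarrow> real" where
  "averaged_initial K \<mu> H z = (LINT x:K|\<mu>. H z x)"


section \<open>Continuous-time Markov jump processes on a finite set\<close>

definition generator_matrix :: "'s set \<Rightarrow> ('s \<Rightarrow> 's \<Rightarrow> real) \<Rightarrow> bool" where
  "generator_matrix S L \<longleftrightarrow>
     (\<forall>x\<in>S. \<forall>z\<in>S. x \<noteq> z \<longrightarrow> 0 \<le> L x z) \<and> (\<forall>x\<in>S. (\<Sum>z\<in>S. L x z) = 0)"

definition probability_vector :: "'s set \<Rightarrow> ('s \<Rightarrow> real) \<Rightarrow> bool" where
  "probability_vector S \<nu> \<longleftrightarrow> (\<forall>z\<in>S. 0 \<le> \<nu> z) \<and> (\<Sum>z\<in>S. \<nu> z) = 1"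

text \<open>A Markov transition semigroup on \<open>S\<close> whose derivative at time zero is \<open>L\<close>.\<close>

definition markov_semigroup ::
    "'s set \<Rightarrow> ('s \<Rightarrow> 's \<Rightarrow> real) \<Rightarrow> (real \<Rightarrow> 's \<Rightarrow> 's \<Rightarrow> real) \<Rightarrow> bool" where
  "markov_semigroup S L P \<longleftrightarrow>
     (\<forall>t\<ge>0. \<forall>x\<in>S. probability_vector S (P t x)) \<and>
     (\<forall>x\<in>S. \<forall>z\<in>S. P 0 x z = (if x = z then 1 else 0)) \<and>
     (\<forall>s\<ge>0. \<forall>t\<ge>0. \<forall>x\<in>S. \<forall>z\<in>S. P (s + t) x z = (\<Sum>y\<in>S. P s x y * P t y z)) \<and>
     (\<forall>x\<in>S. \<forall>z\<in>S. ((\<lambda>t. (P t x z - P 0 x z) / t) \<longlongrightarrow> L x z) (at_right 0))"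

text \<open>
  The conditions on the paths say that they are right-continuous with left limits for the discrete
  topology on \<open>S\<close>, i.e. piecewise constant with finitely many jumps on bounded time intervals. The
  last condition is the Markov property in elementary form, multiplied by the probability of the
  conditioning event.
\<close>

definition markov_jump_process ::
    "'b measure \<Rightarrow> 's set \<Rightarrow> ('s \<Rightarrow> 's \<Rightarrow> real) \<Rightarrow> ('s \<Rightarrow> real) \<Rightarrow> (real \<Rightarrow> 'b \<Rightarrow> 's) \<Rightarrow> bool" where
  "markov_jump_process N S L \<nu> Y \<longleftrightarrow>
     prob_space N \<and>
     (\<forall>t\<ge>0. Y t \<in> N \<rightarrow>\<^sub>M count_space S) \<and>
     (\<forall>\<omega>\<in>space N.
        (\<forall>t\<ge>0. \<forall>\<^sub>F s in at_right t. Y s \<omega> = Y t \<omega>) \<and>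
        (\<forall>t>0. \<exists>z. \<forall>\<^sub>F s in at_left t. Y s \<omega> = z)) \<and>
     (\<forall>z\<in>S. measure N {\<omega>\<in>space N. Y 0 \<omega> = z} = \<nu> z) \<and>
     (\<exists>P. markov_semigroup S L P \<and>
        (\<forall>(k::nat) (t::nat \<Rightarrow> real) (x::nat \<Rightarrow> 's).
           0 \<le> t 0 \<and> (\<forall>i\<le>k. t i \<le> t (Suc i)) \<and> (\<forall>i\<le>Suc k. x i \<in> S) \<longrightarrow>
           measure N {\<omega>\<in>space N. \<forall>i\<le>Suc k. Y (t i) \<omega> = x i} =
           measure N {\<omega>\<in>space N. \<forall>i\<le>k. Y (t i) \<omega> = x i}
             * P (t (Suc k) - t k) (x k) (x (Suc k))))"

end

theory Submission
  imports Defs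
begin

text \<open>
  Large multiples of \<open>\<sigma>\<close> drive the solution to the zeros of \<open>\<sigma>\<close> at once, and the drift
  then makes it jump between them. The proof follows the barycentric coordinates of the solution.

  \<^bold>\<open>The hitting probabilities are barycentric coordinates.\<close> A solution of \<open>dX = \<sigma>(X) dW\<close> in the compact set
  \<open>K\<close> is a bounded martingale, hence converges almost surely. Its energy \<open>E \<integral> |\<sigma>(X)|\<^sup>2 ds\<close> over
  \<open>[0, \<infinity>)\<close> is finite, so that its limit is a zero of \<open>\<sigma>\<close>. Therefore \<open>\<Sum>z. H z x = 1\<close> and
  \<open>\<Sum>z. H z x *\<^sub>R z = x\<close> (\<open>limit_distribution\<close>). As the points of \<open>K\<^sub>0\<close> are affinely independent, \<open>H z\<close> is
  the restriction of the affine function \<open>\<lambda>x. g z \<bullet> x + c z\<close> that is 1 at \<open>z\<close> and 0 at the other points of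
  \<open>K\<^sub>0\<close>. Its gradient is the constant \<open>g z\<close>, and the generator has the entries \<open>b x \<bullet> g z\<close>.

  \<^bold>\<open>Concentration.\<close> The distance of \<open>x\<close> to \<open>K\<^sub>0\<close> is measured by \<open>spread x = \<Sum>z. H z x * |z - x|\<^sup>2\<close>, the
  variance of the barycentric distribution of \<open>x\<close>, which equals an affine function of \<open>x\<close> minus
  \<open>|x|\<^sup>2\<close>. The martingale parts can only increase the second moment of the solution, so the mean spread
  grows at most at a rate that does not depend on \<open>\<gamma>\<close> (\<open>mean_spread_increment\<close>). On the other hand
  \<open>\<gamma> * E \<integral> |\<sigma>|\<^sup>2 ds\<close> is bounded (\<open>diffusion_energy\<close>), so the time integral of the mean spread tends to
  0. A quantity whose integral is small and which cannot grow fast is small at the end of the time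
  interval (\<open>mean_spread_le_average\<close>).

  \<^bold>\<open>Averaging.\<close> Let \<open>q z s\<close> be the mean of the coordinate \<open>z\<close> at time \<open>s\<close>. Its derivative is the mean of
  \<open>b \<bullet> g z\<close>. A Lipschitz function differs from the affine interpolation of its values on \<open>K\<^sub>0\<close> by at
  most a multiple of \<open>\<epsilon> + spread / \<epsilon>\<close> (\<open>lipschitz_interpolation_error\<close>), so \<open>q\<close> solves the forward equation
  of the averaged generator up to a small error. Pairing \<open>q z s\<close> with \<open>P (t - s)\<close> and integrating the derivative in
  \<open>s\<close> compares \<open>q t\<close> with the law of the jump process (\<open>averaged_semigroup_error\<close>).

  \<^bold>\<open>Stochastic integration.\<close> Two properties of the Ito integral suffice for all of this: its increments are
  orthogonal to the past (\<open>ito_integral_increment_orthogonal\<close>), and its mean square is comparable to that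
  of the integrand. Both come from the bilinear isometry for elementary processes
  (\<open>elementary_integral_inner\<close>).
\<close>

section \<open>Moments of Gaussian vectors\<close>

lemma has_bochner_integral_lborel_prod:
  fixes h :: "'n::finite \<Rightarrow> real \<Rightarrow> real"
  assumes h: "\<And>i. integrable lborel (h i)"
  shows "has_bochner_integral lborel (\<lambda>x::real^'n. \<Prod>i\<in>UNIV. h i (x $ i))
           (\<Prod>i\<in>UNIV. integral\<^sup>L lborel (h i))"
proof -
  interpret product_sigma_finite "\<lambda>b::real^'n. lborel :: real measure" ..
  define a where "a = (\<lambda>i::'n. axis i (1::real))"
  define h' where "h' = (\<lambda>b. h (inv a b))"
  have inj: "inj a" by (auto simp: a_def inj_on_def axis_eq_axis)
  have Basis: "Basis = range a" by (auto simp: a_def Basis_vec_def)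
  have inv: "inv a (a i) = i" for i using inj by simp
  have [measurable]: "h' b \<in> borel_measurable borel" if "b \<in> Basis" for b
    using borel_measurable_integrable[OF h] by (simp add: h'_def)
  have int: "integrable lborel (h' b)" for b by (simp add: h'_def h)
  have prod: "(\<Prod>i\<in>UNIV. h i (x $ i)) = (\<Prod>b\<in>Basis. h' b (x \<bullet> b))" for x :: "real^'n"
    unfolding Basis by (subst prod.reindex[OF inj]) (simp add: h'_def inv, simp add: a_def inner_axis)
  have prod': "(\<Prod>i\<in>UNIV. integral\<^sup>L lborel (h i)) = (\<Prod>b\<in>Basis. integral\<^sup>L lborel (h' b))"
    unfolding Basis by (subst prod.reindex[OF inj]) (simp add: h'_def inv)
  have comp: "(\<Sum>b\<in>Basis. g b *\<^sub>R b) \<bullet> c = g c" if "c \<in> Basis" for g :: "real^'n \<Rightarrow> real" and c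
    using that by simp
  have eq: "(\<Prod>b\<in>Basis. h' b ((\<Sum>b\<in>Basis. g b *\<^sub>R b) \<bullet> b)) = (\<Prod>b\<in>Basis. h' b (g b))"
    for g :: "real^'n \<Rightarrow> real"
    by (rule prod.cong) (simp_all add: comp)
  show ?thesis
    unfolding prod prod' has_bochner_integral_iff
  proof
    show "integrable lborel (\<lambda>x::real^'n. \<Prod>b\<in>Basis. h' b (x \<bullet> b))"
      by (subst lborel_eq, subst integrable_distr_eq)
         (auto simp: eq intro!: product_integrable_prod int)
    show "(LINT x::real^'n|lborel. (\<Prod>b\<in>Basis. h' b (x \<bullet> b))) = (\<Prod>b\<in>Basis. integral\<^sup>L lborel (h' b))"
      by (subst lborel_eq, subst integral_distr)
         (auto simp: eq product_integral_prod int)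
  qed
qed

text \<open>
  Multiplying the density by a monomial keeps the product form, so that every mixed moment of the
  vector is a product of one-dimensional moments.
\<close>

lemma has_bochner_integral_normal_monomial:
  fixes e :: "'n::finite \<Rightarrow> nat"
  assumes "d > 0"
  shows "has_bochner_integral lborel
      (\<lambda>x::real^'n. (\<Prod>i\<in>UNIV. normal_density 0 d (x $ i)) * (\<Prod>i\<in>UNIV. (x $ i) ^ e i))
      (\<Prod>i\<in>UNIV. LINT x|lborel. normal_density 0 d x * x ^ e i)"
proof -
  have "integrable lborel (\<lambda>x. normal_density 0 d x * x ^ e i)" for i
    using integrable_normal_moment[OF assms, of 0] by simp
  from has_bochner_integral_lborel_prod[OF this] show ?thesis
    by (simp add: prod.distrib)
qed

lemma
  fixes j k :: "'n::finite"
  assumes d: "d > 0"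
  defines "\<phi> \<equiv> \<lambda>x::real^'n. \<Prod>i\<in>UNIV. normal_density 0 d (x $ i)"
  shows has_bochner_integral_normal_coord: "has_bochner_integral lborel (\<lambda>x. \<phi> x * x $ j) 0"
    and has_bochner_integral_normal_coord_mult:
      "has_bochner_integral lborel (\<lambda>x. \<phi> x * (x $ j * x $ k)) (if j = k then d\<^sup>2 else 0)"
proof -
  have m0: "(LINT x|lborel. normal_density 0 d x) = 1" using d by simp
  have m1: "(LINT x|lborel. normal_density 0 d x * x) = 0"
    using integral_normal_moment_nz_1[OF d, of 0] by simp
  have m2: "(LINT x|lborel. normal_density 0 d x * x\<^sup>2) = d\<^sup>2"
    using integral_normal_moment_even[OF d, of 0 1] by (simp add: power2_eq_square fact_numeral)
  let ?e = "\<lambda>i. if i = j then 1 else 0::nat"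
  let ?e' = "\<lambda>i. (if i = j then 1 else 0) + (if i = k then 1 else 0)::nat"
  have p: "(\<Prod>i\<in>UNIV. (x $ i) ^ (if i = m then 1 else 0)) = x $ m" for x :: "real^'n" and m
    by (simp add: if_distrib[where f="\<lambda>n. _ ^ n"] prod.delta cong: if_cong)
  have "(\<Prod>i\<in>UNIV. LINT x|lborel. normal_density 0 d x * x ^ ?e i) = 0"
    by (rule prod_zero) (auto intro!: bexI[of _ j] simp: m1)
  with has_bochner_integral_normal_monomial[OF d, of ?e]
  show "has_bochner_integral lborel (\<lambda>x. \<phi> x * x $ j) 0"
    unfolding p \<phi>_def by simp
  have "(\<Prod>i\<in>UNIV. LINT x|lborel. normal_density 0 d x * x ^ ?e' i) = (if j = k then d\<^sup>2 else 0)"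
  proof (cases "j = k")
    case True
    have "(\<Prod>i\<in>UNIV. LINT x|lborel. normal_density 0 d x * x ^ ?e' i) = (\<Prod>i\<in>UNIV. if i = k then d\<^sup>2 else 1)"
      using True by (intro prod.cong) (auto simp: m0 m2[unfolded power2_eq_square] power2_eq_square)
    also have "\<dots> = d\<^sup>2" by simp
    finally show ?thesis using True by simp
  next
    case False
    have "(\<Prod>i\<in>UNIV. LINT x|lborel. normal_density 0 d x * x ^ ?e' i) = 0"
    proof (rule prod_zero)
      show "\<exists>i\<in>UNIV. (LINT x|lborel. normal_density 0 d x * x ^ ?e' i) = 0"
        by (rule bexI[of _ j]) (use False m1 in simp_all)
    qed simp
    then show ?thesis using False by simp
  qed
  with has_bochner_integral_normal_monomial[OF d, of ?e']
  show "has_bochner_integral lborel (\<lambda>x. \<phi> x * (x $ j * x $ k)) (if j = k then d\<^sup>2 else 0)"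
    unfolding power_add prod.distrib p \<phi>_def by simp
qed

lemma (in prob_space) indep_set_subsets:
  "indep_set A B \<Longrightarrow> A' \<subseteq> A \<Longrightarrow> B' \<subseteq> B \<Longrightarrow> indep_set A' B'"
  unfolding indep_sets2_eq by (meson order_trans subsetD)

section \<open>Increments of Brownian motion against the past\<close>

locale brownian_space = prob_space M for M :: "'a measure" +
  fixes F :: "real \<Rightarrow> 'a measure" and W :: "real \<Rightarrow> 'a \<Rightarrow> real^'n"
  assumes filtered: "filtered_prob_space M F" and brownian: "brownian_motion M F W"
begin

lemma space_filtration [simp]: "space (F t) = space M"
  and sets_filtration_mono: "s \<le> t \<Longrightarrow> sets (F s) \<subseteq> sets (F t)"
  and sets_filtration_sub: "sets (F t) \<subseteq> sets M"
  using filtered unfolding filtered_prob_space_def filtration_def subalgebra_def by auto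

lemma measurable_filtration_mono: "s \<le> t \<Longrightarrow> f \<in> measurable (F s) N \<Longrightarrow> f \<in> measurable (F t) N"
  using sets_filtration_mono[of s t] unfolding measurable_def by auto

lemma measurable_filtration: "f \<in> measurable (F s) N \<Longrightarrow> f \<in> measurable M N"
  using sets_filtration_sub[of s] unfolding measurable_def by auto

lemma brownian_adapted: "0 \<le> s \<Longrightarrow> s \<le> t \<Longrightarrow> W s \<in> borel_measurable (F t)"
  using brownian measurable_filtration_mono unfolding brownian_motion_def by blast

lemma brownian_measurable: "0 \<le> s \<Longrightarrow> W s \<in> borel_measurable M"
  using brownian_adapted measurable_filtration by blast

lemma increment_moments:
  assumes st: "0 \<le> s" "s < t"
  shows "has_bochner_integral M (\<lambda>\<omega>. (W t \<omega> - W s \<omega>) $ j) 0"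
    and "has_bochner_integral M (\<lambda>\<omega>. (W t \<omega> - W s \<omega>) $ j * (W t \<omega> - W s \<omega>) $ k)
           (if j = k then t - s else 0)"
proof -
  let ?\<phi> = "\<lambda>x::real^'n. \<Prod>i\<in>UNIV. normal_density 0 (sqrt (t - s)) (x $ i)"
  have D: "distributed M lborel (\<lambda>\<omega>. W t \<omega> - W s \<omega>) (\<lambda>x. ennreal (?\<phi> x))"
    using brownian st unfolding brownian_motion_def by blast
  have d: "sqrt (t - s) > 0" using st by simp
  have nn: "0 \<le> ?\<phi> x" for x by (intro prod_nonneg) auto
  note i1 = has_bochner_integral_normal_coord[OF d, of j, unfolded has_bochner_integral_iff]
  note i2 = has_bochner_integral_normal_coord_mult[OF d, of j k, unfolded has_bochner_integral_iff]
  show "has_bochner_integral M (\<lambda>\<omega>. (W t \<omega> - W s \<omega>) $ j) 0"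
    unfolding has_bochner_integral_iff
    using distributed_integrable[OF D, of "\<lambda>x. x $ j"] distributed_integral[OF D, of "\<lambda>x. x $ j"] i1 nn
    by simp
  show "has_bochner_integral M (\<lambda>\<omega>. (W t \<omega> - W s \<omega>) $ j * (W t \<omega> - W s \<omega>) $ k)
           (if j = k then t - s else 0)"
    unfolding has_bochner_integral_iff
    using distributed_integrable[OF D, of "\<lambda>x. x $ j * x $ k"]
      distributed_integral[OF D, of "\<lambda>x. x $ j * x $ k"] i2 nn st
    by (simp add: less_imp_le split: if_splits)
qed

lemma past_indep_increment:
  fixes G :: "'a \<Rightarrow> real" and h :: "real^'n \<Rightarrow> real"
  assumes st: "0 \<le> s" "s < t" and G: "G \<in> borel_measurable (F s)" and h: "h \<in> borel_measurable borel"
  shows "indep_var borel G borel (\<lambda>\<omega>. h (W t \<omega> - W s \<omega>))"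
proof -
  let ?B = "{(\<lambda>\<omega>. W t \<omega> - W s \<omega>) -` A \<inter> space M | A. A \<in> sets borel}"
  have ind: "indep_set (sets (F s)) ?B"
    using brownian st unfolding brownian_motion_def by blast
  have [measurable]: "W t \<in> borel_measurable M" "W s \<in> borel_measurable M"
    using brownian_measurable st by auto
  note [measurable] = h
  have B: "sigma_algebra (space M) ?B"
    using sets.sigma_algebra_axioms[of "vimage_algebra (space M) (\<lambda>\<omega>. W t \<omega> - W s \<omega>) borel"]
    by (simp add: sets_vimage_algebra2)
  have 1: "sigma_sets (space M) {G -` A \<inter> space M | A. A \<in> sets borel} \<subseteq> sets (F s)"
  proof -
    have "{G -` A \<inter> space M | A. A \<in> sets borel} \<subseteq> sets (F s)"
      using measurable_sets[OF G] by auto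
    from sets.sigma_sets_subset[OF this] show ?thesis by simp
  qed
  have 2: "sigma_sets (space M) {(\<lambda>\<omega>. h (W t \<omega> - W s \<omega>)) -` A \<inter> space M | A. A \<in> sets borel} \<subseteq> ?B"
  proof (rule sigma_algebra.sigma_sets_subset[OF B], safe)
    fix A :: "real set" assume "A \<in> sets borel"
    then have "h -` A \<in> sets borel" using measurable_sets[OF h] by simp
    then show "\<exists>A'. (\<lambda>\<omega>. h (W t \<omega> - W s \<omega>)) -` A \<inter> space M
        = (\<lambda>\<omega>. W t \<omega> - W s \<omega>) -` A' \<inter> space M \<and> A' \<in> sets borel"
      by (intro exI[of _ "h -` A"]) auto
  qed
  have "indep_set (sigma_sets (space M) {G -` A \<inter> space M | A. A \<in> sets borel})
     (sigma_sets (space M) {(\<lambda>\<omega>. h (W t \<omega> - W s \<omega>)) -` A \<inter> space M | A. A \<in> sets borel})"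
    by (rule indep_set_subsets[OF ind 1 2])
  then show ?thesis
    unfolding indep_var_eq using measurable_filtration[OF G] by auto
qed

text \<open>
  The increment after \<open>s\<close> is independent of \<open>F s\<close>, so that its moments factor out even against
  unbounded \<open>F s\<close>-measurable weights.
\<close>

lemma past_times_increment:
  assumes st: "0 \<le> s" "s \<le> t" and G: "G \<in> borel_measurable (F s)" "integrable M G"
  shows "has_bochner_integral M (\<lambda>\<omega>. G \<omega> * (W t \<omega> - W s \<omega>) $ j) 0"
    and "has_bochner_integral M (\<lambda>\<omega>. G \<omega> * ((W t \<omega> - W s \<omega>) $ j * (W t \<omega> - W s \<omega>) $ k))
           (if j = k then (t - s) * expectation G else 0)"
proof -
  consider "s = t" | "s < t" using st by linarith
  then have "has_bochner_integral M (\<lambda>\<omega>. G \<omega> * (W t \<omega> - W s \<omega>) $ j) 0 \<and>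
    has_bochner_integral M (\<lambda>\<omega>. G \<omega> * ((W t \<omega> - W s \<omega>) $ j * (W t \<omega> - W s \<omega>) $ k))
           (if j = k then (t - s) * expectation G else 0)"
  proof cases
    case 1 then show ?thesis by (simp add: has_bochner_integral_zero)
  next
    case 2
    note m = increment_moments[OF st(1) 2, unfolded has_bochner_integral_iff]
    have i1: "indep_var borel G borel (\<lambda>\<omega>. (W t \<omega> - W s \<omega>) $ j)"
      by (rule past_indep_increment[OF st(1) 2 G(1), of "\<lambda>x. x $ j"]) simp
    have i2: "indep_var borel G borel (\<lambda>\<omega>. (W t \<omega> - W s \<omega>) $ j * (W t \<omega> - W s \<omega>) $ k)"
      by (rule past_indep_increment[OF st(1) 2 G(1), of "\<lambda>x. x $ j * x $ k"]) simp
    show ?thesis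
      unfolding has_bochner_integral_iff
      using indep_var_integrable[OF i1 G(2)] indep_var_lebesgue_integral[OF i1 G(2)]
        indep_var_integrable[OF i2 G(2)] indep_var_lebesgue_integral[OF i2 G(2)] m(1)[of j] m(2)[of j k]
      by (auto simp: mult.commute)
  qed
  then show "has_bochner_integral M (\<lambda>\<omega>. G \<omega> * (W t \<omega> - W s \<omega>) $ j) 0"
    "has_bochner_integral M (\<lambda>\<omega>. G \<omega> * ((W t \<omega> - W s \<omega>) $ j * (W t \<omega> - W s \<omega>) $ k))
           (if j = k then (t - s) * expectation G else 0)" by auto
qed

end

section \<open>Integrals of elementary processes\<close>

lemma borel_measurable_nth_cart [measurable (raw)]:
  fixes f :: "'a \<Rightarrow> ('b::{second_countable_topology, topological_space})^'n"
  assumes "f \<in> borel_measurable N"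
  shows "(\<lambda>\<omega>. f \<omega> $ i) \<in> borel_measurable N"
  by (rule measurable_compose[OF assms borel_measurable_continuous_onI])
     (intro continuous_intros)

lemma matrix_nth_le_norm: "\<bar>(A :: real^'n^'m) $ i $ j\<bar> \<le> norm A"
  using component_le_norm_cart[of "A $ i" j] Finite_Cartesian_Product.norm_nth_le[of A i] by simp

lemma borel_measurable_matrix_vector_mult [measurable (raw)]:
  fixes f :: "'a \<Rightarrow> real^'n^'m" and g :: "'a \<Rightarrow> real^'n"
  assumes [measurable]: "f \<in> borel_measurable N" "g \<in> borel_measurable N"
  shows "(\<lambda>\<omega>. f \<omega> *v g \<omega>) \<in> borel_measurable N"
  unfolding matrix_vector_mult_def
  by (subst borel_measurable_euclidean_space) (auto simp: Basis_vec_def inner_axis)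

lemma matrix_vector_mult_minus_left: "(- A) *v x = - (A *v x)" for A :: "real^'n^'m"
  by (simp add: matrix_vector_mult_def vec_eq_iff sum_negf)

lemma nn_set_integral_eq_set_integral:
  fixes h :: "real \<Rightarrow> real"
  assumes "set_integrable lborel A h" "\<And>s. 0 \<le> h s"
  shows "(\<integral>\<^sup>+s\<in>A. ennreal (h s) \<partial>lborel) = ennreal (LINT s:A|lborel. h s)"
proof -
  have "(\<integral>\<^sup>+s\<in>A. ennreal (h s) \<partial>lborel) = (\<integral>\<^sup>+s. ennreal (indicat_real A s *\<^sub>R h s) \<partial>lborel)"
    by (intro nn_integral_cong) (auto simp: indicator_def)
  also have "\<dots> = ennreal (LINT s:A|lborel. h s)"
    unfolding set_lebesgue_integral_def
    using assms by (intro nn_integral_eq_integral) (auto simp: set_integrable_def)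
  finally show ?thesis .
qed

lemma emeasure_lborel_Ioc_finite: "emeasure lborel {u<..v::real} < top"
  by (cases "u \<le> v") auto

context brownian_space
begin

lemma integrable_bounded:
  fixes f :: "'a \<Rightarrow> 'b::{banach, second_countable_topology}"
  assumes "f \<in> borel_measurable M" "\<And>\<omega>. \<omega> \<in> space M \<Longrightarrow> norm (f \<omega>) \<le> C"
  shows "integrable M f"
  by (rule integrable_const_bound[of _ C]) (use assms in auto)

text \<open>
  Here the interval of \<open>a\<close> starts first. The increment over \<open>(p, q]\<close> is cut at \<open>p'\<close>: the part
  before \<open>p'\<close> belongs to the past of the other increment and contributes nothing. The rest overlaps with
  \<open>(p', q']\<close>, and of the overlap only the common interval contributes, by its length.
\<close>

lemma increments_product_ordered:
  fixes a c :: "'a \<Rightarrow> real"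
  assumes pq: "0 \<le> p" "p \<le> q" "p \<le> p'" "p' \<le> q'"
    and a: "a \<in> borel_measurable (F p)" "\<And>\<omega>. \<omega> \<in> space M \<Longrightarrow> \<bar>a \<omega>\<bar> \<le> A"
    and c: "c \<in> borel_measurable (F p')" "\<And>\<omega>. \<omega> \<in> space M \<Longrightarrow> \<bar>c \<omega>\<bar> \<le> C"
  shows "has_bochner_integral M
      (\<lambda>\<omega>. (a \<omega> * (W q \<omega> - W p \<omega>) $ j) * (c \<omega> * (W q' \<omega> - W p' \<omega>) $ k))
      (if j = k then max 0 (min q q' - max p p') * expectation (\<lambda>\<omega>. a \<omega> * c \<omega>) else 0)"
proof -
  have ac: "(\<lambda>\<omega>. a \<omega> * c \<omega>) \<in> borel_measurable (F p')"
    using measurable_filtration_mono[OF pq(3) a(1)] c(1) by measurable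
  have bdd: "\<bar>a \<omega> * c \<omega>\<bar> \<le> A * C" if "\<omega> \<in> space M" for \<omega>
    using a(2)[OF that] c(2)[OF that] unfolding abs_mult
    by (intro mult_mono) (auto intro: order_trans[OF abs_ge_zero])
  have aM: "a \<in> borel_measurable M" and cM: "c \<in> borel_measurable M"
    using a(1) c(1) measurable_filtration by auto
  have iac: "integrable M (\<lambda>\<omega>. a \<omega> * c \<omega>)"
    by (rule integrable_bounded[of _ "A * C"]) (use bdd aM cM in auto)
  \<comment> \<open>an increment that ends before \<open>r\<close> is orthogonal to the increment that starts at \<open>r\<close>\<close>
  have past: "has_bochner_integral M (\<lambda>\<omega>. (a \<omega> * c \<omega> * (W v \<omega> - W u \<omega>) $ j) * (W q' \<omega> - W r \<omega>) $ k) 0"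
    if uvr: "0 \<le> u" "u \<le> v" "v \<le> r" "p' \<le> r" "r \<le> q'" "p \<le> u" "p' \<le> u \<or> (v \<le> p')" for u v r
  proof (rule past_times_increment(1)[OF _ uvr(5)])
    show "0 \<le> r" using uvr by simp
    have Wr: "W v \<in> borel_measurable (F r)" "W u \<in> borel_measurable (F r)"
      using uvr by (auto intro!: brownian_adapted)
    have acr: "a \<in> borel_measurable (F r)" "c \<in> borel_measurable (F r)"
      using measurable_filtration_mono a(1) c(1) uvr pq by (meson order_trans)+
    show "(\<lambda>\<omega>. a \<omega> * c \<omega> * (W v \<omega> - W u \<omega>) $ j) \<in> borel_measurable (F r)"
      using Wr acr by measurable
    have WM: "W v \<in> borel_measurable M" "W u \<in> borel_measurable M"
      using uvr by (auto intro!: brownian_measurable)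
    have a_u: "a \<in> borel_measurable (F u)"
      using a(1) uvr measurable_filtration_mono by blast
    have ia: "integrable M a" by (rule integrable_bounded[of _ A]) (use a aM in auto)
    have i: "integrable M (\<lambda>\<omega>. a \<omega> * (W v \<omega> - W u \<omega>) $ j)"
      using past_times_increment(1)[OF uvr(1,2) a_u ia, of j] by (simp add: has_bochner_integral_iff)
    show "integrable M (\<lambda>\<omega>. a \<omega> * c \<omega> * (W v \<omega> - W u \<omega>) $ j)"
    proof (rule Bochner_Integration.integrable_bound[OF integrable_mult_left[OF i, of C]])
      show "AE \<omega> in M. norm (a \<omega> * c \<omega> * (W v \<omega> - W u \<omega>) $ j) \<le> norm (a \<omega> * (W v \<omega> - W u \<omega>) $ j * C)"
      proof (rule AE_I2)
        fix \<omega> assume "\<omega> \<in> space M"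
        then have "\<bar>c \<omega>\<bar> \<le> \<bar>C\<bar>" using c(2)[of \<omega>] by linarith
        then have "\<bar>a \<omega> * (W v \<omega> - W u \<omega>) $ j\<bar> * \<bar>c \<omega>\<bar> \<le> \<bar>a \<omega> * (W v \<omega> - W u \<omega>) $ j\<bar> * \<bar>C\<bar>"
          by (rule mult_left_mono) simp
        then show "norm (a \<omega> * c \<omega> * (W v \<omega> - W u \<omega>) $ j) \<le> norm (a \<omega> * (W v \<omega> - W u \<omega>) $ j * C)"
          by (simp add: abs_mult mult_ac)
      qed
    qed (use aM cM WM in measurable)
  qed
  consider "q \<le> p'" | "p' < q" "q \<le> q'" | "p' < q" "q' < q" by linarith
  then show ?thesis
  proof cases
    case 1
    have "has_bochner_integral M (\<lambda>\<omega>. (a \<omega> * c \<omega> * (W q \<omega> - W p \<omega>) $ j) * (W q' \<omega> - W p' \<omega>) $ k) 0"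
      by (rule past) (use pq 1 in auto)
    moreover have v: "(if j = k then max 0 (min q q' - max p p') * expectation (\<lambda>\<omega>. a \<omega> * c \<omega>) else 0) = 0"
      using 1 pq by auto
    ultimately show ?thesis unfolding v by (simp add: mult_ac)
  next
    case 2
    have 1: "has_bochner_integral M (\<lambda>\<omega>. (a \<omega> * c \<omega> * (W p' \<omega> - W p \<omega>) $ j) * (W q' \<omega> - W p' \<omega>) $ k) 0"
      by (rule past) (use pq 2 in auto)
    have 2: "has_bochner_integral M (\<lambda>\<omega>. (a \<omega> * c \<omega> * (W q \<omega> - W p' \<omega>) $ j) * (W q' \<omega> - W q \<omega>) $ k) 0"
      by (rule past) (use pq 2 in auto)
    have 3: "has_bochner_integral M (\<lambda>\<omega>. a \<omega> * c \<omega> * ((W q \<omega> - W p' \<omega>) $ j * (W q \<omega> - W p' \<omega>) $ k))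
      (if j = k then (q - p') * expectation (\<lambda>\<omega>. a \<omega> * c \<omega>) else 0)"
      by (rule past_times_increment(2)[OF _ _ ac iac]) (use pq \<open>p' < q\<close> in auto)
    have "max 0 (min q q' - max p p') = q - p'" using \<open>p' < q\<close> \<open>q \<le> q'\<close> pq by auto
    note m = this
    from has_bochner_integral_add[OF has_bochner_integral_add[OF 1 2] 3] show ?thesis
      unfolding m by (simp add: algebra_simps split del: if_split)
  next
    case 3
    have 1: "has_bochner_integral M (\<lambda>\<omega>. (a \<omega> * c \<omega> * (W p' \<omega> - W p \<omega>) $ j) * (W q' \<omega> - W p' \<omega>) $ k) 0"
      by (rule past) (use pq 3 in auto)
    have 2: "has_bochner_integral M (\<lambda>\<omega>. a \<omega> * c \<omega> * (W q' \<omega> - W p' \<omega>) $ k * (W q \<omega> - W q' \<omega>) $ j) 0"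
    proof (rule past_times_increment(1))
      show "0 \<le> q'" "q' \<le> q" using pq 3 by auto
      have ac': "a \<in> borel_measurable (F q')" "c \<in> borel_measurable (F q')"
        using measurable_filtration_mono a(1) c(1) pq by (meson order_trans)+
      have W': "W q' \<in> borel_measurable (F q')" "W p' \<in> borel_measurable (F q')"
        using pq by (auto intro!: brownian_adapted)
      show "(\<lambda>\<omega>. a \<omega> * c \<omega> * (W q' \<omega> - W p' \<omega>) $ k) \<in> borel_measurable (F q')"
        using ac' W' by measurable
      show "integrable M (\<lambda>\<omega>. a \<omega> * c \<omega> * (W q' \<omega> - W p' \<omega>) $ k)"
        using past_times_increment(1)[OF _ pq(4) ac iac] pq by (auto simp: has_bochner_integral_iff)
    qed
    have p3: "has_bochner_integral M (\<lambda>\<omega>. a \<omega> * c \<omega> * ((W q' \<omega> - W p' \<omega>) $ j * (W q' \<omega> - W p' \<omega>) $ k))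
      (if j = k then (q' - p') * expectation (\<lambda>\<omega>. a \<omega> * c \<omega>) else 0)"
      by (rule past_times_increment(2)[OF _ _ ac iac]) (use pq in auto)
    have "max 0 (min q q' - max p p') = q' - p'" using 3 pq by auto
    note m = this
    from has_bochner_integral_add[OF has_bochner_integral_add[OF 1 2] p3] show ?thesis
      unfolding m by (simp add: algebra_simps split del: if_split)
  qed
qed

lemma increments_product:
  fixes a c :: "'a \<Rightarrow> real"
  assumes pq: "0 \<le> p" "p \<le> q" "0 \<le> p'" "p' \<le> q'"
    and a: "a \<in> borel_measurable (F p)" "\<And>\<omega>. \<omega> \<in> space M \<Longrightarrow> \<bar>a \<omega>\<bar> \<le> A"
    and c: "c \<in> borel_measurable (F p')" "\<And>\<omega>. \<omega> \<in> space M \<Longrightarrow> \<bar>c \<omega>\<bar> \<le> C"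
  shows "has_bochner_integral M
      (\<lambda>\<omega>. (a \<omega> * (W q \<omega> - W p \<omega>) $ j) * (c \<omega> * (W q' \<omega> - W p' \<omega>) $ k))
      (if j = k then max 0 (min q q' - max p p') * expectation (\<lambda>\<omega>. a \<omega> * c \<omega>) else 0)"
proof (cases "p \<le> p'")
  case True
  show ?thesis by (rule increments_product_ordered[OF pq(1,2) True pq(4) a c])
next
  case False
  then show ?thesis
    using increments_product_ordered[OF pq(3,4) _ pq(2) c a, of k j]
    by (simp add: mult.commute min.commute max.commute eq_commute[of k j] cong: if_cong)
qed

lemma interval_integrals_product:
  fixes \<xi> \<eta> :: "'a \<Rightarrow> real^'n^'m"
  assumes pq: "0 \<le> p" "p \<le> q" "0 \<le> p'" "p' \<le> q'"
    and \<xi>: "\<xi> \<in> borel_measurable (F p)" "\<And>\<omega>. \<omega> \<in> space M \<Longrightarrow> norm (\<xi> \<omega>) \<le> A"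
    and \<eta>: "\<eta> \<in> borel_measurable (F p')" "\<And>\<omega>. \<omega> \<in> space M \<Longrightarrow> norm (\<eta> \<omega>) \<le> C"
  shows "has_bochner_integral M
      (\<lambda>\<omega>. (\<xi> \<omega> *v (W q \<omega> - W p \<omega>)) \<bullet> (\<eta> \<omega> *v (W q' \<omega> - W p' \<omega>)))
      (max 0 (min q q' - max p p') * expectation (\<lambda>\<omega>. \<xi> \<omega> \<bullet> \<eta> \<omega>))"
proof -
  let ?m = "max 0 (min q q' - max p p')"
  have [measurable]: "\<xi> \<in> borel_measurable M" "\<eta> \<in> borel_measurable M"
    using \<xi>(1) \<eta>(1) measurable_filtration by auto
  have b\<xi>: "\<bar>\<xi> \<omega> $ i $ j\<bar> \<le> A" if "\<omega> \<in> space M" for \<omega> i j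
    using \<xi>(2)[OF that] matrix_nth_le_norm[of "\<xi> \<omega>" i j] by linarith
  have b\<eta>: "\<bar>\<eta> \<omega> $ i $ j\<bar> \<le> C" if "\<omega> \<in> space M" for \<omega> i j
    using \<eta>(2)[OF that] matrix_nth_le_norm[of "\<eta> \<omega>" i j] by linarith
  have int: "integrable M (\<lambda>\<omega>. \<xi> \<omega> $ i $ j * \<eta> \<omega> $ i $ j)" for i j
    by (rule integrable_bounded[of _ "A * C"])
       (auto simp: abs_mult intro!: mult_mono b\<xi> b\<eta> intro: order_trans[OF abs_ge_zero b\<xi>])
  have "has_bochner_integral M (\<lambda>\<omega>. \<Sum>i\<in>UNIV. \<Sum>j\<in>UNIV. \<Sum>k\<in>UNIV.
      (\<xi> \<omega> $ i $ j * (W q \<omega> - W p \<omega>) $ j) * (\<eta> \<omega> $ i $ k * (W q' \<omega> - W p' \<omega>) $ k))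
    (\<Sum>i\<in>UNIV. \<Sum>j\<in>UNIV. \<Sum>k\<in>UNIV.
      if j = k then ?m * expectation (\<lambda>\<omega>. \<xi> \<omega> $ i $ j * \<eta> \<omega> $ i $ k) else 0)"
    by (intro has_bochner_integral_sum increments_product[OF pq])
       (use \<xi>(1) \<eta>(1) b\<xi> b\<eta> in \<open>auto intro!: borel_measurable_nth_cart\<close>)
  also have "(\<lambda>\<omega>. \<Sum>i\<in>UNIV. \<Sum>j\<in>UNIV. \<Sum>k\<in>UNIV.
      (\<xi> \<omega> $ i $ j * (W q \<omega> - W p \<omega>) $ j) * (\<eta> \<omega> $ i $ k * (W q' \<omega> - W p' \<omega>) $ k))
    = (\<lambda>\<omega>. (\<xi> \<omega> *v (W q \<omega> - W p \<omega>)) \<bullet> (\<eta> \<omega> *v (W q' \<omega> - W p' \<omega>)))"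
    by (simp add: fun_eq_iff inner_vec_def matrix_vector_mult_def sum_product)
  also have "(\<Sum>i\<in>UNIV. \<Sum>j\<in>UNIV. \<Sum>k\<in>UNIV.
      if j = k then ?m * expectation (\<lambda>\<omega>. \<xi> \<omega> $ i $ j * \<eta> \<omega> $ i $ k) else 0)
    = ?m * (\<Sum>i\<in>UNIV. \<Sum>j\<in>UNIV. expectation (\<lambda>\<omega>. \<xi> \<omega> $ i $ j * \<eta> \<omega> $ i $ j))"
    by (simp add: sum_distrib_left)
  also have "(\<Sum>i\<in>UNIV. \<Sum>j\<in>UNIV. expectation (\<lambda>\<omega>. \<xi> \<omega> $ i $ j * \<eta> \<omega> $ i $ j))
    = expectation (\<lambda>\<omega>. \<xi> \<omega> \<bullet> \<eta> \<omega>)"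
    by (simp add: inner_vec_def Bochner_Integration.integral_sum int)
  finally show ?thesis .
qed

lemma past_times_interval_integral:
  fixes \<xi> :: "'a \<Rightarrow> real^'n^'m" and G :: "'a \<Rightarrow> real^'m"
  assumes uv: "0 \<le> u" "u \<le> v"
    and \<xi>: "\<xi> \<in> borel_measurable (F u)" "\<And>\<omega>. \<omega> \<in> space M \<Longrightarrow> norm (\<xi> \<omega>) \<le> A"
    and G: "G \<in> borel_measurable (F u)" "\<And>\<omega>. \<omega> \<in> space M \<Longrightarrow> norm (G \<omega>) \<le> C"
  shows "has_bochner_integral M (\<lambda>\<omega>. G \<omega> \<bullet> (\<xi> \<omega> *v (W v \<omega> - W u \<omega>))) 0"
proof -
  have meas: "\<xi> \<in> borel_measurable M" "G \<in> borel_measurable M"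
    using \<xi>(1) G(1) measurable_filtration by auto
  have "integrable M (\<lambda>\<omega>. G \<omega> $ i * \<xi> \<omega> $ i $ j)" for i j
  proof (rule integrable_bounded[of _ "C * A"])
    fix \<omega> assume "\<omega> \<in> space M"
    then have "\<bar>\<xi> \<omega> $ i $ j\<bar> \<le> A" "\<bar>G \<omega> $ i\<bar> \<le> C"
      using \<xi>(2)[of \<omega>] matrix_nth_le_norm[of "\<xi> \<omega>" i j] G(2)[of \<omega>] component_le_norm_cart[of "G \<omega>" i]
      by auto
    then show "norm (G \<omega> $ i * \<xi> \<omega> $ i $ j) \<le> C * A"
      unfolding real_norm_def abs_mult by (intro mult_mono) auto
  qed (use meas in measurable)
  then have "has_bochner_integral M (\<lambda>\<omega>. \<Sum>i\<in>UNIV. \<Sum>j\<in>UNIV. G \<omega> $ i * \<xi> \<omega> $ i $ j * (W v \<omega> - W u \<omega>) $ j)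
      (\<Sum>i\<in>(UNIV::'m set). \<Sum>j\<in>(UNIV::'n set). 0)"
    using \<xi>(1) G(1)
    by (intro has_bochner_integral_sum past_times_increment(1)[OF uv])
       (auto intro!: borel_measurable_times borel_measurable_nth_cart)
  then show ?thesis
    by (simp add: inner_vec_def matrix_vector_mult_def sum_distrib_left mult_ac)
qed

text \<open>
  The pairs of an elementary process and its integral. Closing single intervals under sums, without
  any order between the intervals, makes differences and truncations of such processes elementary again, so that
  two approximations along different partitions can be compared without a common refinement.
\<close>

inductive elementary_integral ::
    "real \<Rightarrow> (real \<Rightarrow> 'a \<Rightarrow> real^'n^'m) \<Rightarrow> ('a \<Rightarrow> real^'m) \<Rightarrow> bool" for t where
  interval: "0 \<le> p \<Longrightarrow> p \<le> q \<Longrightarrow> q \<le> t \<Longrightarrow> \<xi> \<in> borel_measurable (F p) \<Longrightarrow>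
    (\<And>\<omega>. \<omega> \<in> space M \<Longrightarrow> norm (\<xi> \<omega>) \<le> C) \<Longrightarrow>
    elementary_integral t (\<lambda>s \<omega>. indicat_real {p<..q} s *\<^sub>R \<xi> \<omega>) (\<lambda>\<omega>. \<xi> \<omega> *v (W q \<omega> - W p \<omega>))"
| add: "elementary_integral t U S \<Longrightarrow> elementary_integral t V R \<Longrightarrow>
    elementary_integral t (\<lambda>s \<omega>. U s \<omega> + V s \<omega>) (\<lambda>\<omega>. S \<omega> + R \<omega>)"

lemma elementary_integral_zero:
  assumes "0 \<le> t"
  shows "elementary_integral t (\<lambda>s \<omega>. 0) (\<lambda>\<omega>. 0)"
  using interval[of 0 0 t "\<lambda>_. 0" 0] assms by simp

lemma elementary_integral_minus:
  "elementary_integral t U S \<Longrightarrow> elementary_integral t (\<lambda>s \<omega>. - U s \<omega>) (\<lambda>\<omega>. - S \<omega>)"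
proof (induction rule: elementary_integral.induct)
  case (interval p q \<xi> C)
  then show ?case
    using elementary_integral.interval[of p q t "\<lambda>\<omega>. - \<xi> \<omega>" C]
    by (simp add: matrix_vector_mult_minus_left)
next
  case (add U S V R)
  then show ?case using elementary_integral.add by fastforce
qed

lemma elementary_integral_diff:
  "elementary_integral t U S \<Longrightarrow> elementary_integral t V R \<Longrightarrow>
    elementary_integral t (\<lambda>s \<omega>. U s \<omega> - V s \<omega>) (\<lambda>\<omega>. S \<omega> - R \<omega>)"
  using add[OF _ elementary_integral_minus] by fastforce

lemma elementary_integral_measurable:
  assumes "elementary_integral t U S"
  shows "(\<lambda>(s, \<omega>). U s \<omega>) \<in> borel_measurable (borel \<Otimes>\<^sub>M M) \<and> S \<in> borel_measurable M"
  using assms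
proof induction
  case (interval p q \<xi> C)
  then have [measurable]: "\<xi> \<in> borel_measurable M" "W p \<in> borel_measurable M" "W q \<in> borel_measurable M"
    using measurable_filtration brownian_measurable by auto
  show ?case by (simp add: split_beta')
next
  case (add U S V R)
  then show ?case by (auto simp: split_beta' intro!: borel_measurable_add)
qed

text \<open>
  The isometry in bilinear form. Both sides are bilinear in the two elementary processes, which
  reduces the claim to two intervals.
\<close>

lemma elementary_integral_inner:
  assumes "elementary_integral t U S" "elementary_integral t V R"
  shows "integrable M (\<lambda>\<omega>. S \<omega> \<bullet> R \<omega>) \<and>
    (\<forall>\<omega>. set_integrable lborel {0..t} (\<lambda>s. U s \<omega> \<bullet> V s \<omega>)) \<and>
    integrable M (\<lambda>\<omega>. LINT s:{0..t}|lborel. U s \<omega> \<bullet> V s \<omega>) \<and>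
    expectation (\<lambda>\<omega>. S \<omega> \<bullet> R \<omega>) = expectation (\<lambda>\<omega>. LINT s:{0..t}|lborel. U s \<omega> \<bullet> V s \<omega>)"
  using assms
proof (induction arbitrary: V R)
  case (interval p q \<xi> A)
  note \<xi> = interval.hyps
  show ?case
    using interval.prems
  proof induction
    case (interval p' q' \<eta> C)
    note \<eta> = interval.hyps
    let ?m = "max 0 (min q q' - max p p')"
    have [measurable]: "\<xi> \<in> borel_measurable M" "\<eta> \<in> borel_measurable M"
      using \<xi>(4) \<eta>(4) measurable_filtration by auto
    have eq: "indicat_real {0..t} s *\<^sub>R ((indicat_real {p<..q} s *\<^sub>R \<xi> \<omega>) \<bullet> (indicat_real {p'<..q'} s *\<^sub>R \<eta> \<omega>))
        = (\<xi> \<omega> \<bullet> \<eta> \<omega>) * indicat_real {max p p'<..min q q'} s" for s \<omega>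
      using \<xi>(1-3) \<eta>(1-3) by (auto simp: indicator_def)
    have int: "set_integrable lborel {0..t}
        (\<lambda>s. (indicat_real {p<..q} s *\<^sub>R \<xi> \<omega>) \<bullet> (indicat_real {p'<..q'} s *\<^sub>R \<eta> \<omega>))" for \<omega>
      unfolding set_integrable_def eq
      by (intro integrable_mult_right integrable_real_indicator) (auto simp: emeasure_lborel_Ioc_finite)
    have val: "(LINT s:{0..t}|lborel. (indicat_real {p<..q} s *\<^sub>R \<xi> \<omega>) \<bullet> (indicat_real {p'<..q'} s *\<^sub>R \<eta> \<omega>))
        = ?m * (\<xi> \<omega> \<bullet> \<eta> \<omega>)" for \<omega>
      unfolding set_lebesgue_integral_def eq by (auto simp: max_def)
    have ii: "integrable M (\<lambda>\<omega>. \<xi> \<omega> \<bullet> \<eta> \<omega>)"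
    proof (rule integrable_bounded[of _ "A * C"])
      fix \<omega> assume w: "\<omega> \<in> space M"
      have "norm (\<xi> \<omega> \<bullet> \<eta> \<omega>) \<le> norm (\<xi> \<omega>) * norm (\<eta> \<omega>)" using Cauchy_Schwarz_ineq2 by auto
      also have "\<dots> \<le> A * C"
        using \<xi>(5)[OF w] \<eta>(5)[OF w] by (intro mult_mono) (auto intro: order_trans[OF norm_ge_zero])
      finally show "norm (\<xi> \<omega> \<bullet> \<eta> \<omega>) \<le> A * C" .
    qed measurable
    show ?case
      using interval_integrals_product[OF \<xi>(1,2) \<eta>(1,2) \<xi>(4,5) \<eta>(4,5)] int ii
      unfolding val by (simp add: has_bochner_integral_iff)
  next
    case (add V S' V' R')
    note 1 = add.IH(1) and 2 = add.IH(2)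
    show ?case
      using 1 2 by (simp add: inner_add_right set_integral_add)
  qed
next
  case (add U S U' S')
  note 1 = add.IH(1)[OF add.prems] and 2 = add.IH(2)[OF add.prems]
  show ?case
    using 1 2 by (simp add: inner_add_left set_integral_add)
qed

definition mean_square :: "('a \<Rightarrow> 'b::real_normed_vector) \<Rightarrow> ennreal" where
  "mean_square S = (\<integral>\<^sup>+\<omega>. ennreal ((norm (S \<omega>))\<^sup>2) \<partial>M)"

definition path_mean_square :: "real \<Rightarrow> (real \<Rightarrow> 'a \<Rightarrow> 'b::real_normed_vector) \<Rightarrow> ennreal" where
  "path_mean_square t U = (\<integral>\<^sup>+\<omega>. (\<integral>\<^sup>+s\<in>{0..t}. ennreal ((norm (U s \<omega>))\<^sup>2) \<partial>lborel) \<partial>M)"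

lemma elementary_integral_isometry:
  assumes "elementary_integral t U S"
  shows "mean_square S = path_mean_square t U"
proof -
  note i = elementary_integral_inner[OF assms assms, folded power2_norm_eq_inner]
  have "(\<integral>\<^sup>+s\<in>{0..t}. ennreal ((norm (U s \<omega>))\<^sup>2) \<partial>lborel)
      = ennreal (LINT s:{0..t}|lborel. (norm (U s \<omega>))\<^sup>2)" for \<omega>
    using i by (intro nn_set_integral_eq_set_integral) auto
  moreover have "(\<integral>\<^sup>+\<omega>. ennreal (LINT s:{0..t}|lborel. (norm (U s \<omega>))\<^sup>2) \<partial>M)
      = ennreal (expectation (\<lambda>\<omega>. LINT s:{0..t}|lborel. (norm (U s \<omega>))\<^sup>2))"
    using i by (intro nn_integral_eq_integral)
       (auto simp: set_lebesgue_integral_def intro!: integral_nonneg_AE)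
  moreover have "(\<integral>\<^sup>+\<omega>. ennreal ((norm (S \<omega>))\<^sup>2) \<partial>M) = ennreal (expectation (\<lambda>\<omega>. (norm (S \<omega>))\<^sup>2))"
    using i by (intro nn_integral_eq_integral) auto
  ultimately show ?thesis using i unfolding mean_square_def path_mean_square_def by simp
qed

text \<open>
  Cutting an elementary process at time \<open>s\<close> only removes increments after \<open>s\<close>, and these are
  orthogonal to \<open>F s\<close>.
\<close>

lemma elementary_integral_truncate:
  fixes U :: "real \<Rightarrow> 'a \<Rightarrow> real^'n^'m"
  assumes "elementary_integral t U S" "0 \<le> s" "s \<le> t"
  shows "\<exists>S'. elementary_integral s (\<lambda>r \<omega>. indicat_real {0..s} r *\<^sub>R U r \<omega>) S' \<and>
    (\<forall>G C. G \<in> borel_measurable (F s) \<longrightarrow> (\<forall>\<omega>\<in>space M. norm (G \<omega>) \<le> C) \<longrightarrow>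
      has_bochner_integral M (\<lambda>\<omega>. G \<omega> \<bullet> (S \<omega> - S' \<omega>)) 0)"
  using assms(1)
proof induction
  case (interval p q \<xi> A)
  consider "s \<le> p" | "p < s" "q \<le> s" | "p < s" "s < q" by linarith
  then show ?case
  proof cases
    case 1
    have e: "(\<lambda>r \<omega>. indicat_real {0..s} r *\<^sub>R indicat_real {p<..q} r *\<^sub>R \<xi> \<omega>) = (\<lambda>_ _. 0)"
      using 1 by (auto simp: indicator_def fun_eq_iff)
    show ?thesis
      unfolding e
      using past_times_interval_integral[OF interval(1,2,4,5) measurable_filtration_mono[OF 1]]
        elementary_integral_zero[OF assms(2)]
      by (intro exI[of _ "\<lambda>_. 0"]) auto
  next
    case 2
    have e: "(\<lambda>r \<omega>. indicat_real {0..s} r *\<^sub>R indicat_real {p<..q} r *\<^sub>R \<xi> \<omega>)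
        = (\<lambda>r \<omega>. indicat_real {p<..q} r *\<^sub>R \<xi> \<omega>)"
      using 2 interval(1) by (auto simp: indicator_def fun_eq_iff)
    show ?thesis
      unfolding e
      using elementary_integral.interval[OF interval(1,2) 2(2) interval(4,5)]
      by (intro exI[of _ "\<lambda>\<omega>. \<xi> \<omega> *v (W q \<omega> - W p \<omega>)"]) (auto simp: has_bochner_integral_zero)
  next
    case 3
    have e: "(\<lambda>r \<omega>. indicat_real {0..s} r *\<^sub>R indicat_real {p<..q} r *\<^sub>R \<xi> \<omega>)
        = (\<lambda>r \<omega>. indicat_real {p<..s} r *\<^sub>R \<xi> \<omega>)"
      using 3 interval(1) by (auto simp: indicator_def fun_eq_iff)
    have d: "\<xi> \<omega> *v (W q \<omega> - W p \<omega>) - \<xi> \<omega> *v (W s \<omega> - W p \<omega>) = \<xi> \<omega> *v (W q \<omega> - W s \<omega>)" for \<omega>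
      by (simp add: vec.diff algebra_simps)
    have "\<xi> \<in> borel_measurable (F s)"
      using interval(4) 3 measurable_filtration_mono less_imp_le by blast
    from past_times_interval_integral[OF assms(2) _ this interval(5), of q] 3
    show ?thesis
      unfolding e
      using elementary_integral.interval[OF interval(1) _ order_refl interval(4,5), of s] 3 d
      by (intro exI[of _ "\<lambda>\<omega>. \<xi> \<omega> *v (W s \<omega> - W p \<omega>)"]) (auto simp: e)
  qed
next
  case (add U S V R)
  from add.IH(1) obtain S' where
    S': "elementary_integral s (\<lambda>r \<omega>. indicat_real {0..s} r *\<^sub>R U r \<omega>) S'"
      "\<forall>G C. G \<in> borel_measurable (F s) \<longrightarrow> (\<forall>\<omega>\<in>space M. norm (G \<omega>) \<le> C) \<longrightarrow>
        has_bochner_integral M (\<lambda>\<omega>. G \<omega> \<bullet> (S \<omega> - S' \<omega>)) 0"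
    by (elim exE conjE)
  from add.IH(2) obtain R' where
    R': "elementary_integral s (\<lambda>r \<omega>. indicat_real {0..s} r *\<^sub>R V r \<omega>) R'"
      "\<forall>G C. G \<in> borel_measurable (F s) \<longrightarrow> (\<forall>\<omega>\<in>space M. norm (G \<omega>) \<le> C) \<longrightarrow>
        has_bochner_integral M (\<lambda>\<omega>. G \<omega> \<bullet> (R \<omega> - R' \<omega>)) 0"
    by (elim exE conjE)
  have "has_bochner_integral M (\<lambda>\<omega>. G \<omega> \<bullet> (S \<omega> + R \<omega> - (S' \<omega> + R' \<omega>))) 0"
    if "G \<in> borel_measurable (F s)" "\<forall>\<omega>\<in>space M. norm (G \<omega>) \<le> C" for G C
  proof -
    have "has_bochner_integral M (\<lambda>\<omega>. G \<omega> \<bullet> (S \<omega> - S' \<omega>)) 0"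
      "has_bochner_integral M (\<lambda>\<omega>. G \<omega> \<bullet> (R \<omega> - R' \<omega>)) 0"
      using S'(2) R'(2) that by blast+
    from has_bochner_integral_add[OF this] show ?thesis
      by (simp add: inner_add_right inner_diff_right algebra_simps)
  qed
  then show ?case
    using elementary_integral.add[OF S'(1) R'(1)]
    by (intro exI[of _ "\<lambda>\<omega>. S' \<omega> + R' \<omega>"]) (auto simp: scaleR_add_right)
qed

lemma simple_integral_elementary:
  assumes "simple_integrand M F t p k \<xi>"
  shows "elementary_integral t (simple_process p k \<xi>) (simple_integral p k \<xi> W)"
proof -
  have p: "0 \<le> p 0" "\<And>i. i < k \<Longrightarrow> p i \<le> p (Suc i)" "p k \<le> t"
    and \<xi>: "\<And>i. i < k \<Longrightarrow> \<xi> i \<in> borel_measurable (F (p i)) \<and> (\<exists>C. \<forall>\<omega>\<in>space M. norm (\<xi> i \<omega>) \<le> C)"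
    using assms unfolding simple_integrand_def by auto
  have mono: "p i \<le> p j" if "i \<le> j" "j \<le> k" for i j
    using that by (induction j rule: dec_induct) (auto intro: order_trans[OF _ p(2)])
  have "elementary_integral t (simple_process p j \<xi>) (simple_integral p j \<xi> W)" if "j \<le> k" for j
    using that
  proof (induction j)
    case 0
    have "0 \<le> t" using mono[of 0 k] p by simp
    then show ?case
      using elementary_integral_zero by (simp add: simple_process_def[abs_def] simple_integral_def[abs_def])
  next
    case (Suc j)
    then have j: "j < k" by simp
    then obtain C where "\<forall>\<omega>\<in>space M. norm (\<xi> j \<omega>) \<le> C" using \<xi> by blast
    then have i: "elementary_integral t (\<lambda>s \<omega>. indicat_real {p j<..p (Suc j)} s *\<^sub>R \<xi> j \<omega>)
        (\<lambda>\<omega>. \<xi> j \<omega> *v (W (p (Suc j)) \<omega> - W (p j) \<omega>))"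
      using p mono[of 0 j] mono[of "Suc j" k] \<xi>[OF j] Suc.prems j by (intro interval[where C=C]) auto
    have "elementary_integral t (simple_process p j \<xi>) (simple_integral p j \<xi> W)"
      using Suc by simp
    from add[OF this i] show ?case
      unfolding simple_process_def[abs_def] simple_integral_def[abs_def] sum.lessThan_Suc .
  qed
  then show ?thesis by simp
qed

end

section \<open>Mean square estimates for the Ito integral\<close>

lemma norm_add_square_le: "(norm (a + b))\<^sup>2 \<le> 2 * (norm a)\<^sup>2 + 2 * (norm b)\<^sup>2" for a :: "'b::real_normed_vector"
proof -
  have "(norm (a + b))\<^sup>2 \<le> (norm a + norm b)\<^sup>2" by (intro power_mono norm_triangle_ineq) simp
  also have "\<dots> \<le> 2 * (norm a)\<^sup>2 + 2 * (norm b)\<^sup>2"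
    using sum_squares_ge_zero[of "norm a - norm b" 0] by (simp add: power2_eq_square algebra_simps)
  finally show ?thesis .
qed

lemma norm_add_square_le_ennreal:
  "ennreal ((norm (a + b))\<^sup>2) \<le> 2 * ennreal ((norm a)\<^sup>2) + 2 * ennreal ((norm b)\<^sup>2)"
  for a :: "'b::real_normed_vector"
  using ennreal_leI[OF norm_add_square_le[of a b]]
  by (simp add: ennreal_plus ennreal_mult'')

lemma le_add_square_divide: "x \<le> \<epsilon> + x\<^sup>2 / \<epsilon>" if "0 < \<epsilon>" for x \<epsilon> :: real
proof (cases "x \<le> \<epsilon>")
  case False
  then have "x * \<epsilon> \<le> x * x" using that by (intro mult_left_mono) auto
  then have "x \<le> x\<^sup>2 / \<epsilon>" using that by (simp add: field_simps power2_eq_square)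
  then show ?thesis using that by linarith
qed (use that in \<open>simp add: add_increasing2\<close>)

context brownian_space
begin

text \<open>
  Measurability of the integrand on \<open>[0, t]\<close> only, as the Ito integral over \<open>[0, t]\<close> requires it.
\<close>

definition path_measurable :: "real \<Rightarrow> (real \<Rightarrow> 'a \<Rightarrow> 'b::topological_space) \<Rightarrow> bool" where
  "path_measurable t U \<longleftrightarrow> (\<lambda>(s, \<omega>). U s \<omega>) \<in> borel_measurable (restrict_space borel {0..t} \<Otimes>\<^sub>M M)"

lemma mean_square_minus: "mean_square (\<lambda>\<omega>. A \<omega> - B \<omega>) = mean_square (\<lambda>\<omega>. B \<omega> - A \<omega>)"
  unfolding mean_square_def by (simp add: norm_minus_commute)

lemma mean_square_triangle:
  fixes A B :: "'a \<Rightarrow> 'b::{real_normed_vector, second_countable_topology}"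
  assumes [measurable]: "A \<in> borel_measurable M" "B \<in> borel_measurable M"
  shows "mean_square (\<lambda>\<omega>. A \<omega> + B \<omega>) \<le> 2 * mean_square A + 2 * mean_square B"
proof -
  have "mean_square (\<lambda>\<omega>. A \<omega> + B \<omega>)
      \<le> (\<integral>\<^sup>+\<omega>. 2 * ennreal ((norm (A \<omega>))\<^sup>2) + 2 * ennreal ((norm (B \<omega>))\<^sup>2) \<partial>M)"
    unfolding mean_square_def by (intro nn_integral_mono norm_add_square_le_ennreal)
  also have "\<dots> = 2 * mean_square A + 2 * mean_square B"
    unfolding mean_square_def by (simp add: nn_integral_add nn_integral_cmult)
  finally show ?thesis .
qed

lemma path_mean_square_restrict:
  "path_mean_square t U
    = (\<integral>\<^sup>+\<omega>. (\<integral>\<^sup>+s. ennreal ((norm (U s \<omega>))\<^sup>2) \<partial>restrict_space lborel {0..t}) \<partial>M)"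
  unfolding path_mean_square_def by (subst nn_integral_restrict_space) auto

lemma path_measurableD:
  fixes U :: "real \<Rightarrow> 'a \<Rightarrow> 'b::{real_normed_vector, second_countable_topology}"
  assumes "path_measurable t U"
  shows "(\<lambda>(\<omega>, s). ennreal ((norm (U s \<omega>))\<^sup>2)) \<in> borel_measurable (M \<Otimes>\<^sub>M restrict_space lborel {0..t})"
proof -
  have "sets (restrict_space borel {0..t} \<Otimes>\<^sub>M M) = sets (restrict_space lborel {0..t} \<Otimes>\<^sub>M M)"
    by (intro sets_pair_measure_cong sets_restrict_space_cong) auto
  then have [measurable]: "(\<lambda>x. U (fst x) (snd x)) \<in> borel_measurable (restrict_space lborel {0..t} \<Otimes>\<^sub>M M)"
    using assms by (simp add: path_measurable_def split_beta' cong: measurable_cong_sets)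
  have "(\<lambda>y. U (snd y) (fst y)) \<in> borel_measurable (M \<Otimes>\<^sub>M restrict_space lborel {0..t})"
  proof -
    have "(\<lambda>y. (snd y, fst y)) \<in> M \<Otimes>\<^sub>M restrict_space lborel {0..t} \<rightarrow>\<^sub>M restrict_space lborel {0..t} \<Otimes>\<^sub>M M"
      by (intro measurable_Pair measurable_fst measurable_snd)
    from measurable_compose[OF this \<open>(\<lambda>x. U (fst x) (snd x)) \<in> _\<close>] show ?thesis by simp
  qed
  then show ?thesis by (simp add: split_beta')
qed

lemma path_mean_square_triangle:
  fixes U V :: "real \<Rightarrow> 'a \<Rightarrow> 'b::{real_normed_vector, second_countable_topology}"
  assumes U: "path_measurable t U" and V: "path_measurable t V"
  shows "path_mean_square t (\<lambda>s \<omega>. U s \<omega> + V s \<omega>) \<le> 2 * path_mean_square t U + 2 * path_mean_square t V"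
proof -
  let ?R = "restrict_space lborel {0..t}"
  interpret R: sigma_finite_measure ?R
    by (intro sigma_finite_measure_restrict_space) (auto intro: lborel.sigma_finite_measure_axioms)
  note [measurable] = path_measurableD[OF U] path_measurableD[OF V]
  have "path_mean_square t (\<lambda>s \<omega>. U s \<omega> + V s \<omega>)
      \<le> (\<integral>\<^sup>+\<omega>. (\<integral>\<^sup>+s. 2 * ennreal ((norm (U s \<omega>))\<^sup>2) + 2 * ennreal ((norm (V s \<omega>))\<^sup>2) \<partial>?R) \<partial>M)"
    unfolding path_mean_square_restrict by (intro nn_integral_mono norm_add_square_le_ennreal)
  also have "\<dots> = (\<integral>\<^sup>+\<omega>. 2 * (\<integral>\<^sup>+s. ennreal ((norm (U s \<omega>))\<^sup>2) \<partial>?R)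
      + 2 * (\<integral>\<^sup>+s. ennreal ((norm (V s \<omega>))\<^sup>2) \<partial>?R) \<partial>M)"
  proof (rule nn_integral_cong)
    fix \<omega> assume [measurable]: "\<omega> \<in> space M"
    have m[measurable]: "(\<lambda>s. ennreal ((norm (U s \<omega>))\<^sup>2)) \<in> borel_measurable ?R"
      "(\<lambda>s. ennreal ((norm (V s \<omega>))\<^sup>2)) \<in> borel_measurable ?R"
      using measurable_Pair2[OF path_measurableD[OF U] \<open>\<omega> \<in> space M\<close>]
        measurable_Pair2[OF path_measurableD[OF V] \<open>\<omega> \<in> space M\<close>] by auto
    show "(\<integral>\<^sup>+s. 2 * ennreal ((norm (U s \<omega>))\<^sup>2) + 2 * ennreal ((norm (V s \<omega>))\<^sup>2) \<partial>?R)
      = 2 * (\<integral>\<^sup>+s. ennreal ((norm (U s \<omega>))\<^sup>2) \<partial>?R) + 2 * (\<integral>\<^sup>+s. ennreal ((norm (V s \<omega>))\<^sup>2) \<partial>?R)"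
      by (simp add: nn_integral_add nn_integral_cmult[OF m(1)] nn_integral_cmult[OF m(2)])
  qed
  also have "\<dots> = 2 * path_mean_square t U + 2 * path_mean_square t V"
  proof -
    have [measurable]: "(\<lambda>\<omega>. \<integral>\<^sup>+s. ennreal ((norm (U s \<omega>))\<^sup>2) \<partial>?R) \<in> borel_measurable M"
      "(\<lambda>\<omega>. \<integral>\<^sup>+s. ennreal ((norm (V s \<omega>))\<^sup>2) \<partial>?R) \<in> borel_measurable M"
      by (rule R.borel_measurable_nn_integral, fact)+
    show ?thesis unfolding path_mean_square_restrict
      by (simp add: nn_integral_add nn_integral_cmult)
  qed
  finally show ?thesis .
qed

lemma path_mean_square_mono_time:
  "s \<le> t \<Longrightarrow> path_mean_square s U \<le> path_mean_square t U"
  unfolding path_mean_square_def by (intro nn_integral_mono) (auto split: split_indicator)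

lemma path_measurable_mono_time:
  assumes "s \<le> t" "path_measurable t U"
  shows "path_measurable s U"
proof -
  have "(\<lambda>x. x) \<in> restrict_space borel {0..s} \<rightarrow>\<^sub>M restrict_space borel {0..t::real}"
    using assms(1) by (intro measurable_restrict_space3) auto
  then have "(\<lambda>x. (fst x, snd x)) \<in> restrict_space borel {0..s} \<Otimes>\<^sub>M M \<rightarrow>\<^sub>M restrict_space borel {0..t} \<Otimes>\<^sub>M M"
    by (intro measurable_Pair measurable_snd measurable_compose[OF measurable_fst])
  from measurable_compose[OF this assms(2)[unfolded path_measurable_def]]
  show ?thesis unfolding path_measurable_def by (simp add: split_beta')
qed

lemma path_measurable_global:
  assumes "(\<lambda>(s, \<omega>). U s \<omega>) \<in> borel_measurable (borel \<Otimes>\<^sub>M M)"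
  shows "path_measurable t U"
proof -
  have "(\<lambda>x. (fst x, snd x)) \<in> restrict_space borel {0..t} \<Otimes>\<^sub>M M \<rightarrow>\<^sub>M borel \<Otimes>\<^sub>M M"
    by (intro measurable_Pair measurable_snd measurable_compose[OF measurable_fst] measurable_restrict_space1) auto
  from measurable_compose[OF this assms] show ?thesis
    unfolding path_measurable_def by (simp add: split_beta')
qed

lemma path_measurable_diff:
  fixes U V :: "real \<Rightarrow> 'a \<Rightarrow> 'b::{real_normed_vector, second_countable_topology}"
  shows "path_measurable t U \<Longrightarrow> path_measurable t V \<Longrightarrow> path_measurable t (\<lambda>s \<omega>. U s \<omega> - V s \<omega>)"
  unfolding path_measurable_def split_beta' by (rule borel_measurable_diff)

lemma path_mean_square_minus:
  "path_mean_square t (\<lambda>s \<omega>. U s \<omega> - V s \<omega>) = path_mean_square t (\<lambda>s \<omega>. V s \<omega> - U s \<omega>)"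
  unfolding path_mean_square_def by (simp add: norm_minus_commute)

lemma elementary_path_measurable: "elementary_integral t U S \<Longrightarrow> path_measurable s U"
  using elementary_integral_measurable path_measurable_global by blast

lemma ito_integral_approximation:
  fixes H :: "real \<Rightarrow> 'a \<Rightarrow> real^'n^'m"
  assumes "ito_integral M F W H t I"
  obtains U S where "\<And>m::nat. elementary_integral t (U m) (S m)"
    "(\<lambda>m. path_mean_square t (\<lambda>s \<omega>. H s \<omega> - U m s \<omega>)) \<longlonglongrightarrow> 0"
    "(\<lambda>m. mean_square (\<lambda>\<omega>. I \<omega> - S m \<omega>)) \<longlonglongrightarrow> 0"
    "path_measurable t H" "I \<in> borel_measurable M"
proof -
  from assms obtain p k and \<xi> :: "nat \<Rightarrow> nat \<Rightarrow> 'a \<Rightarrow> real^'n^'m" where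
    "\<forall>m. simple_integrand M F t (p m) (k m) (\<xi> m)"
    "(\<lambda>m. path_mean_square t (\<lambda>s \<omega>. H s \<omega> - simple_process (p m) (k m) (\<xi> m) s \<omega>)) \<longlonglongrightarrow> 0"
    "(\<lambda>m. mean_square (\<lambda>\<omega>. I \<omega> - simple_integral (p m) (k m) (\<xi> m) W \<omega>)) \<longlonglongrightarrow> 0"
    "path_measurable t H" "I \<in> borel_measurable M"
    unfolding ito_integral_def path_mean_square_def mean_square_def path_measurable_def by blast
  note * = this
  show ?thesis
    by (rule that[OF simple_integral_elementary[OF *(1)[rule_format]] *(2-5)])
qed

lemma tendsto_ennreal_cmult_zero: "(f \<longlongrightarrow> 0) G \<Longrightarrow> c \<noteq> top \<Longrightarrow> ((\<lambda>x. c * f x) \<longlongrightarrow> (0::ennreal)) G"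
  using ennreal_tendsto_cmult[of c f 0 G] by (simp add: top.not_eq_extremum)

text \<open>
  The isometry holds with constant 1, but a constant of any size suffices below, and 4 is what
  two applications of \<open>|a + b|\<^sup>2 \<le> 2|a|\<^sup>2 + 2|b|\<^sup>2\<close> along an approximating sequence give.
\<close>

lemma
  assumes I: "ito_integral M F W H t I"
  shows path_mean_square_le_ito: "path_mean_square t H \<le> 4 * mean_square I"
    and ito_le_path_mean_square: "mean_square I \<le> 4 * path_mean_square t H"
proof -
  from I obtain U S where US: "\<And>m::nat. elementary_integral t (U m) (S m)"
    and e: "(\<lambda>m. path_mean_square t (\<lambda>s \<omega>. H s \<omega> - U m s \<omega>)) \<longlonglongrightarrow> 0"
    and e': "(\<lambda>m. mean_square (\<lambda>\<omega>. I \<omega> - S m \<omega>)) \<longlonglongrightarrow> 0"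
    and H: "path_measurable t H" and I[measurable]: "I \<in> borel_measurable M"
    by (rule ito_integral_approximation) (rule that; assumption)
  have S[measurable]: "S m \<in> borel_measurable M" for m using elementary_integral_measurable[OF US] by auto
  have U: "path_measurable t (U m)" for m using US elementary_path_measurable by blast
  have iso: "mean_square (S m) = path_mean_square t (U m)" for m
    by (rule elementary_integral_isometry[OF US])
  let ?e = "\<lambda>m. path_mean_square t (\<lambda>s \<omega>. H s \<omega> - U m s \<omega>)"
  let ?e' = "\<lambda>m. mean_square (\<lambda>\<omega>. I \<omega> - S m \<omega>)"
  have 1: "path_mean_square t H \<le> 2 * ?e m + 2 * path_mean_square t (U m)" for m
    using path_mean_square_triangle[OF path_measurable_diff[OF H U[of m]] U[of m]] by simp
  have 2: "mean_square (S m) \<le> 2 * ?e' m + 2 * mean_square I" for m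
    using mean_square_triangle[of "\<lambda>\<omega>. S m \<omega> - I \<omega>" I] by (simp add: mean_square_minus[of "S m" I])
  have 3: "mean_square I \<le> 2 * ?e' m + 2 * mean_square (S m)" for m
    using mean_square_triangle[of "\<lambda>\<omega>. I \<omega> - S m \<omega>" "S m"] by simp
  have 4: "path_mean_square t (U m) \<le> 2 * ?e m + 2 * path_mean_square t H" for m
    using path_mean_square_triangle[OF path_measurable_diff[OF U[of m] H] H]
    by (simp add: path_mean_square_minus[of t "U m" H])
  have *: "2 * a + 2 * (2 * b + 2 * c) = 2 * a + 4 * b + 4 * (c::ennreal)" for a b c
    by (simp add: distrib_left mult.assoc[symmetric] add.assoc)
  have five: "path_mean_square t H \<le> 2 * ?e m + 4 * ?e' m + 4 * mean_square I" for m
    using order_trans[OF 1[of m] add_left_mono[OF mult_left_mono[OF 2[of m, unfolded iso]]]] by (simp add: * add.assoc)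
  have six: "mean_square I \<le> 2 * ?e' m + 4 * ?e m + 4 * path_mean_square t H" for m
    using order_trans[OF 3[of m] add_left_mono[OF mult_left_mono[OF 4[of m, folded iso]]]] by (simp add: * add.assoc)
  have lim: "(\<lambda>m. 2 * a m + 4 * b m + c) \<longlonglongrightarrow> c" if "a \<longlonglongrightarrow> 0" "b \<longlonglongrightarrow> 0"
    for a b :: "nat \<Rightarrow> ennreal" and c
    using tendsto_add[OF tendsto_add[OF tendsto_ennreal_cmult_zero[OF that(1), of 2]
      tendsto_ennreal_cmult_zero[OF that(2), of 4]] tendsto_const[of c]] by simp
  show "path_mean_square t H \<le> 4 * mean_square I"
    by (rule tendsto_lowerbound[OF lim[OF e e']]) (use five in auto)
  show "mean_square I \<le> 4 * path_mean_square t H"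
    by (rule tendsto_lowerbound[OF lim[OF e' e]]) (use six in auto)
qed

lemma mean_square_bounds_mean:
  fixes A :: "'a \<Rightarrow> 'b::{banach, second_countable_topology}"
  assumes "0 < \<epsilon>" and [measurable]: "A \<in> borel_measurable M"
  shows "(\<integral>\<^sup>+\<omega>. ennreal (norm (A \<omega>)) \<partial>M) \<le> ennreal \<epsilon> + ennreal (1 / \<epsilon>) * mean_square A"
proof -
  have "norm a \<le> \<epsilon> + 1 / \<epsilon> * (norm a)\<^sup>2" for a :: 'b
    using le_add_square_divide[OF assms(1), of "norm a"] by simp
  then have "(\<integral>\<^sup>+\<omega>. ennreal (norm (A \<omega>)) \<partial>M) \<le> (\<integral>\<^sup>+\<omega>. ennreal (\<epsilon> + 1 / \<epsilon> * (norm (A \<omega>))\<^sup>2) \<partial>M)"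
    by (intro nn_integral_mono ennreal_leI)
  also have "\<dots> = (\<integral>\<^sup>+\<omega>. ennreal \<epsilon> + ennreal (1 / \<epsilon>) * ennreal ((norm (A \<omega>))\<^sup>2) \<partial>M)"
    using assms(1) by (intro nn_integral_cong) (simp add: ennreal_plus ennreal_mult' del: times_divide_eq_left)
  also have "\<dots> = ennreal \<epsilon> + ennreal (1 / \<epsilon>) * mean_square A"
    unfolding mean_square_def by (simp add: nn_integral_add nn_integral_cmult emeasure_space_1)
  finally show ?thesis .
qed

text \<open>
  The integrals over \<open>[0, t]\<close> and \<open>[0, s]\<close> come with unrelated approximations \<open>U\<close> and \<open>V\<close>.
  Truncating \<open>U\<close> at \<open>s\<close> gives a second approximation of the integrand on \<open>[0, s]\<close>; by the isometry the
  truncated integrals approach the same limit as those of \<open>V\<close>. The increment is therefore a mean square limit of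
  elementary integrals over \<open>(s, t]\<close>, which are orthogonal to \<open>F s\<close>.
\<close>

lemma ito_integral_increment_orthogonal:
  fixes H :: "real \<Rightarrow> 'a \<Rightarrow> real^'n^'m"
  assumes st: "0 \<le> s" "s \<le> t"
    and It: "ito_integral M F W H t I" and Is: "ito_integral M F W H s J"
    and G: "G \<in> borel_measurable (F s)" "\<And>\<omega>. \<omega> \<in> space M \<Longrightarrow> norm (G \<omega>) \<le> C"
  shows "has_bochner_integral M (\<lambda>\<omega>. G \<omega> \<bullet> (I \<omega> - J \<omega>)) 0"
proof -
  from It obtain U S where US: "\<And>m::nat. elementary_integral t (U m) (S m)"
    and e: "(\<lambda>m. path_mean_square t (\<lambda>s \<omega>. H s \<omega> - U m s \<omega>)) \<longlonglongrightarrow> 0"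
    and e': "(\<lambda>m. mean_square (\<lambda>\<omega>. I \<omega> - S m \<omega>)) \<longlonglongrightarrow> 0"
    and H: "path_measurable t H" and I[measurable]: "I \<in> borel_measurable M"
    by (rule ito_integral_approximation) (rule that; assumption)
  from Is obtain V R where VR: "\<And>m::nat. elementary_integral s (V m) (R m)"
    and d: "(\<lambda>m. path_mean_square s (\<lambda>s \<omega>. H s \<omega> - V m s \<omega>)) \<longlonglongrightarrow> 0"
    and d': "(\<lambda>m. mean_square (\<lambda>\<omega>. J \<omega> - R m \<omega>)) \<longlonglongrightarrow> 0"
    and J[measurable]: "J \<in> borel_measurable M"
    by (rule ito_integral_approximation) (rule that; assumption)
  have "\<forall>m. \<exists>S'. elementary_integral s (\<lambda>r \<omega>. indicat_real {0..s} r *\<^sub>R U m r \<omega>) S' \<and>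
    has_bochner_integral M (\<lambda>\<omega>. G \<omega> \<bullet> (S m \<omega> - S' \<omega>)) 0"
    using elementary_integral_truncate[OF US st] G by blast
  from choice[OF this]
  obtain S' where S': "elementary_integral s (\<lambda>r \<omega>. indicat_real {0..s} r *\<^sub>R U m r \<omega>) (S' m)"
    and ort: "has_bochner_integral M (\<lambda>\<omega>. G \<omega> \<bullet> (S m \<omega> - S' m \<omega>)) 0" for m
    by auto
  have [measurable]: "S m \<in> borel_measurable M" "R m \<in> borel_measurable M" "S' m \<in> borel_measurable M" for m
    using elementary_integral_measurable US VR S' by blast+
  have [measurable]: "G \<in> borel_measurable M" using G(1) measurable_filtration by blast
  \<comment> \<open>the error made when the increment is replaced by the elementary integral over \<open>(s, t]\<close>\<close>
  let ?D = "\<lambda>m \<omega>. (I \<omega> - J \<omega>) - (S m \<omega> - S' m \<omega>)"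
  have Hs: "path_measurable s H" using path_measurable_mono_time[OF st(2) H] .
  have 1: "mean_square (\<lambda>\<omega>. S' m \<omega> - R m \<omega>) \<le>
      2 * path_mean_square t (\<lambda>s \<omega>. H s \<omega> - U m s \<omega>) + 2 * path_mean_square s (\<lambda>s \<omega>. H s \<omega> - V m s \<omega>)" for m
  proof -
    have Um: "path_measurable s (U m)" and Vm: "path_measurable s (V m)"
      using US VR elementary_path_measurable by blast+
    have "mean_square (\<lambda>\<omega>. S' m \<omega> - R m \<omega>)
        = path_mean_square s (\<lambda>r \<omega>. indicat_real {0..s} r *\<^sub>R U m r \<omega> - V m r \<omega>)"
      by (rule elementary_integral_isometry[OF elementary_integral_diff[OF S' VR]])
    also have "\<dots> = path_mean_square s (\<lambda>r \<omega>. (U m r \<omega> - H r \<omega>) + (H r \<omega> - V m r \<omega>))"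
      unfolding path_mean_square_def
      by (intro nn_integral_cong) (auto simp: indicator_def)
    also have "\<dots> \<le> 2 * path_mean_square s (\<lambda>r \<omega>. U m r \<omega> - H r \<omega>) + 2 * path_mean_square s (\<lambda>r \<omega>. H r \<omega> - V m r \<omega>)"
      by (intro path_mean_square_triangle path_measurable_diff Um Vm Hs)
    also have "path_mean_square s (\<lambda>r \<omega>. U m r \<omega> - H r \<omega>) \<le> path_mean_square t (\<lambda>r \<omega>. H r \<omega> - U m r \<omega>)"
      using path_mean_square_mono_time[OF st(2)] by (simp add: path_mean_square_minus[of s "U m"])
    finally show ?thesis by (simp add: add_right_mono mult_left_mono)
  qed
  have 2: "mean_square (?D m) \<le> 2 * mean_square (\<lambda>\<omega>. I \<omega> - S m \<omega>)
      + 2 * (2 * mean_square (\<lambda>\<omega>. S' m \<omega> - R m \<omega>) + 2 * mean_square (\<lambda>\<omega>. J \<omega> - R m \<omega>))" for m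
  proof -
    have "mean_square (?D m) = mean_square (\<lambda>\<omega>. (I \<omega> - S m \<omega>) + ((S' m \<omega> - R m \<omega>) + (R m \<omega> - J \<omega>)))"
      by (simp add: algebra_simps)
    also have "\<dots> \<le> 2 * mean_square (\<lambda>\<omega>. I \<omega> - S m \<omega>) + 2 * mean_square (\<lambda>\<omega>. (S' m \<omega> - R m \<omega>) + (R m \<omega> - J \<omega>))"
      by (rule mean_square_triangle) measurable
    also have "mean_square (\<lambda>\<omega>. (S' m \<omega> - R m \<omega>) + (R m \<omega> - J \<omega>))
        \<le> 2 * mean_square (\<lambda>\<omega>. S' m \<omega> - R m \<omega>) + 2 * mean_square (\<lambda>\<omega>. J \<omega> - R m \<omega>)"
      using mean_square_triangle[of "\<lambda>\<omega>. S' m \<omega> - R m \<omega>" "\<lambda>\<omega>. R m \<omega> - J \<omega>"]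
      by (simp add: mean_square_minus[of "R m"])
    finally show ?thesis by (simp add: add_left_mono mult_left_mono)
  qed
  have lim: "(\<lambda>m. mean_square (?D m)) \<longlonglongrightarrow> 0"
  proof -
    have z: "(\<lambda>m. 2 * a m + 2 * b m) \<longlonglongrightarrow> 0" if "a \<longlonglongrightarrow> 0" "b \<longlonglongrightarrow> 0" for a b :: "nat \<Rightarrow> ennreal"
      using tendsto_add[OF tendsto_ennreal_cmult_zero[OF that(1), of 2] tendsto_ennreal_cmult_zero[OF that(2), of 2]]
      by simp
    have "(\<lambda>m. mean_square (\<lambda>\<omega>. S' m \<omega> - R m \<omega>)) \<longlonglongrightarrow> 0"
      by (rule tendsto_sandwich[OF _ _ tendsto_const z[OF e d]]) (use 1 in auto)
    from z[OF e' z[OF this d']] show ?thesis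
      by (rule tendsto_sandwich[OF _ _ tendsto_const, rotated -1]) (use 2 in auto)
  qed
  have Dm[measurable]: "?D m \<in> borel_measurable M" for m by measurable
  from not_empty obtain \<omega>' where "\<omega>' \<in> space M" by auto
  from order_trans[OF norm_ge_zero G(2)[OF this]] have C: "0 \<le> C" .
  have nn: "(\<integral>\<^sup>+\<omega>. ennreal (norm (G \<omega> \<bullet> ?D m \<omega>)) \<partial>M)
      \<le> ennreal C * (ennreal \<epsilon> + ennreal (1 / \<epsilon>) * mean_square (?D m))" if "0 < \<epsilon>" for \<epsilon> m
  proof -
    have "(\<integral>\<^sup>+\<omega>. ennreal (norm (G \<omega> \<bullet> ?D m \<omega>)) \<partial>M) \<le> (\<integral>\<^sup>+\<omega>. ennreal C * ennreal (norm (?D m \<omega>)) \<partial>M)"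
    proof (rule nn_integral_mono)
      fix \<omega> assume w: "\<omega> \<in> space M"
      have "norm (G \<omega> \<bullet> ?D m \<omega>) \<le> norm (G \<omega>) * norm (?D m \<omega>)" using Cauchy_Schwarz_ineq2 by auto
      also have "\<dots> \<le> C * norm (?D m \<omega>)" using G(2)[OF w] by (intro mult_right_mono) auto
      finally show "ennreal (norm (G \<omega> \<bullet> ?D m \<omega>)) \<le> ennreal C * ennreal (norm (?D m \<omega>))"
        using C by (simp add: ennreal_mult''[symmetric] ennreal_leI)
    qed
    also have "\<dots> = ennreal C * (\<integral>\<^sup>+\<omega>. ennreal (norm (?D m \<omega>)) \<partial>M)"
      by (rule nn_integral_cmult) measurable
    also have "\<dots> \<le> ennreal C * (ennreal \<epsilon> + ennreal (1 / \<epsilon>) * mean_square (?D m))"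
      by (intro mult_left_mono mean_square_bounds_mean that Dm) simp
    finally show ?thesis .
  qed
  have split: "G \<omega> \<bullet> (I \<omega> - J \<omega>) = G \<omega> \<bullet> ?D m \<omega> + G \<omega> \<bullet> (S m \<omega> - S' m \<omega>)" for m \<omega>
    by (simp add: inner_diff_right)
  have int: "integrable M (\<lambda>\<omega>. G \<omega> \<bullet> ?D m \<omega>)" if "mean_square (?D m) < top" for m
  proof (rule integrableI_bounded)
    show "(\<integral>\<^sup>+\<omega>. ennreal (norm (G \<omega> \<bullet> ?D m \<omega>)) \<partial>M) < \<infinity>"
      using that by (intro le_less_trans[OF nn[of 1 m]]) (simp_all add: ennreal_mult_less_top)
  qed measurable
  have ev: "\<forall>\<^sub>F m in sequentially. mean_square (?D m) < top"
    using order_tendstoD(2)[OF lim, of top] by simp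
  then obtain m0 where m0: "mean_square (?D m0) < top"
    using eventually_happens'[OF sequentially_bot] by blast
  have intIJ: "integrable M (\<lambda>\<omega>. G \<omega> \<bullet> (I \<omega> - J \<omega>))"
    unfolding split[of _ m0] using int[OF m0] ort[of m0]
    by (intro Bochner_Integration.integrable_add) (auto simp: has_bochner_integral_iff)
  let ?x = "expectation (\<lambda>\<omega>. G \<omega> \<bullet> (I \<omega> - J \<omega>))"
  have bound: "ennreal \<bar>?x\<bar> \<le> ennreal C * ennreal \<epsilon>" if "0 < \<epsilon>" for \<epsilon>
  proof (rule tendsto_lowerbound)
    have "(\<lambda>m. ennreal (1 / \<epsilon>) * mean_square (?D m)) \<longlonglongrightarrow> 0"
      by (rule tendsto_ennreal_cmult_zero[OF lim]) simp
    from ennreal_tendsto_cmult[OF _ tendsto_add[OF tendsto_const[of "ennreal \<epsilon>"] this], of "ennreal C"]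
    show "(\<lambda>m. ennreal C * (ennreal \<epsilon> + ennreal (1 / \<epsilon>) * mean_square (?D m))) \<longlonglongrightarrow> ennreal C * ennreal \<epsilon>"
      by simp
    show "\<forall>\<^sub>F m in sequentially. ennreal \<bar>?x\<bar> \<le> ennreal C * (ennreal \<epsilon> + ennreal (1 / \<epsilon>) * mean_square (?D m))"
      using ev
    proof eventually_elim
      case (elim m)
      have "?x = expectation (\<lambda>\<omega>. G \<omega> \<bullet> ?D m \<omega>) + expectation (\<lambda>\<omega>. G \<omega> \<bullet> (S m \<omega> - S' m \<omega>))"
        unfolding split[of _ m] using int[OF elim] ort[of m]
        by (intro Bochner_Integration.integral_add) (auto simp: has_bochner_integral_iff)
      then have "?x = expectation (\<lambda>\<omega>. G \<omega> \<bullet> ?D m \<omega>)" using ort[of m] by (simp add: has_bochner_integral_iff)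
      then have "ennreal \<bar>?x\<bar> \<le> (\<integral>\<^sup>+\<omega>. ennreal (norm (G \<omega> \<bullet> ?D m \<omega>)) \<partial>M)"
        using integral_norm_bound_ennreal[OF int[OF elim]] by simp
      also note nn[OF that]
      finally show ?case .
    qed
  qed simp
  have "\<bar>?x\<bar> \<le> 0"
  proof (rule field_le_epsilon)
    fix \<delta> :: real assume "0 < \<delta>"
    then have "\<bar>?x\<bar> \<le> C * (\<delta> / (C + 1))"
      using bound[of "\<delta> / (C + 1)"] C by (simp add: ennreal_mult''[symmetric])
    also have "\<dots> \<le> \<delta>" using C \<open>0 < \<delta>\<close> by (simp add: field_simps)
    finally show "\<bar>?x\<bar> \<le> 0 + \<delta>" by simp
  qed
  then show ?thesis using intIJ by (simp add: has_bochner_integral_iff)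
qed

end

section \<open>Functionals of continuous processes in a compact set\<close>

text \<open>
  The process is the limit of its discretisations to the grids with mesh \<open>1 / (n + 1)\<close>, each of which
  takes countably many values in time. Since only nonnegative times matter, the process is frozen at its initial
  value before time 0.
\<close>

lemma (in prob_space) continuous_process_jointly_measurable:
  fixes Z :: "real \<Rightarrow> 'a \<Rightarrow> 'b::{second_countable_topology, metric_space}"
  assumes meas: "\<And>t. 0 \<le> t \<Longrightarrow> Z t \<in> borel_measurable M"
    and cont: "\<And>\<omega>. \<omega> \<in> space M \<Longrightarrow> continuous_on {0..} (\<lambda>t. Z t \<omega>)"
  shows "(\<lambda>(s, \<omega>). Z (max 0 s) \<omega>) \<in> borel_measurable (borel \<Otimes>\<^sub>M M)"
proof (rule borel_measurable_LIMSEQ_metric)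
  let ?a = "\<lambda>n s. max 0 (real_of_int \<lfloor>s * real (Suc n)\<rfloor> / real (Suc n))"
  fix n
  have "(\<lambda>x. Z (max 0 (real_of_int k / real (Suc n))) (snd x)) \<in> borel_measurable (borel \<Otimes>\<^sub>M M)" for k
    by (rule measurable_compose[OF measurable_snd meas]) simp
  then have "(\<lambda>x. Z (max 0 (real_of_int \<lfloor>fst x * real (Suc n)\<rfloor> / real (Suc n))) (snd x))
      \<in> borel_measurable (borel \<Otimes>\<^sub>M M)"
    by (rule measurable_compose_countable) measurable
  then show "(\<lambda>(s, \<omega>). Z (?a n s) \<omega>) \<in> borel_measurable (borel \<Otimes>\<^sub>M M)"
    by (simp add: split_beta')
next
  let ?a = "\<lambda>n s. max 0 (real_of_int \<lfloor>s * real (Suc n)\<rfloor> / real (Suc n))"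
  fix x :: "real \<times> 'a" assume "x \<in> space (borel \<Otimes>\<^sub>M M)"
  then obtain s \<omega> where x: "x = (s, \<omega>)" and w: "\<omega> \<in> space M" by (auto simp: space_pair_measure)
  have "(\<lambda>n. real_of_int \<lfloor>s * real (Suc n)\<rfloor> / real (Suc n)) \<longlonglongrightarrow> s"
  proof (rule LIMSEQ_I)
    fix r :: real assume "0 < r"
    then obtain N where N: "inverse (real (Suc N)) < r" using reals_Archimedean by blast
    have "norm (real_of_int \<lfloor>s * real (Suc n)\<rfloor> / real (Suc n) - s) < r" if "N \<le> n" for n
    proof -
      have "real_of_int \<lfloor>s * real (Suc n)\<rfloor> / real (Suc n) - s
          = (real_of_int \<lfloor>s * real (Suc n)\<rfloor> - s * real (Suc n)) / real (Suc n)"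
        by (simp add: diff_divide_distrib)
      then have "norm (real_of_int \<lfloor>s * real (Suc n)\<rfloor> / real (Suc n) - s)
          = \<bar>real_of_int \<lfloor>s * real (Suc n)\<rfloor> - s * real (Suc n)\<bar> / real (Suc n)"
        by (simp only: real_norm_def abs_divide abs_of_nat)
      also have "\<bar>real_of_int \<lfloor>s * real (Suc n)\<rfloor> - s * real (Suc n)\<bar> \<le> 1" by linarith
      then have "\<bar>real_of_int \<lfloor>s * real (Suc n)\<rfloor> - s * real (Suc n)\<bar> / real (Suc n) \<le> 1 / real (Suc n)"
        by (rule divide_right_mono) simp
      also have "1 / real (Suc n) \<le> inverse (real (Suc N))"
        using that by (simp add: field_simps)
      finally show ?thesis using N by (rule le_less_trans)
    qed
    then show "\<exists>N. \<forall>n\<ge>N. norm (real_of_int \<lfloor>s * real (Suc n)\<rfloor> / real (Suc n) - s) < r" by blast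
  qed
  then have "(\<lambda>n. ?a n s) \<longlonglongrightarrow> max 0 s" by (intro tendsto_max tendsto_const)
  from continuous_on_tendsto_compose[OF cont[OF w] this]
  have "(\<lambda>n. Z (?a n s) \<omega>) \<longlonglongrightarrow> Z (max 0 s) \<omega>" by simp
  then show "(\<lambda>n. case x of (s, \<omega>) \<Rightarrow> Z (?a n s) \<omega>) \<longlonglongrightarrow> (case x of (s, \<omega>) \<Rightarrow> Z (max 0 s) \<omega>)"
    unfolding x prod.case .
qed

locale compact_process = prob_space M for M :: "'a measure" +
  fixes Z :: "real \<Rightarrow> 'a \<Rightarrow> 'b::euclidean_space" and K :: "'b set"
  assumes process_measurable: "0 \<le> t \<Longrightarrow> Z t \<in> borel_measurable M"
    and path_continuous: "\<omega> \<in> space M \<Longrightarrow> continuous_on {0..} (\<lambda>t. Z t \<omega>)"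
    and stays: "\<omega> \<in> space M \<Longrightarrow> 0 \<le> t \<Longrightarrow> Z t \<omega> \<in> K"
    and compact: "compact K"
begin

lemma state_space_borel: "K \<in> sets borel"
  by (intro borel_closed compact_imp_closed compact)

context
  fixes g :: "'b \<Rightarrow> 'c::euclidean_space"
  assumes g: "continuous_on K g"
begin

lemma functional_bounded: obtains C where "0 \<le> C" "\<And>x. x \<in> K \<Longrightarrow> norm (g x) \<le> C"
proof -
  from compact_imp_bounded[OF compact_continuous_image[OF g compact]]
  obtain C where "\<forall>y\<in>g ` K. norm y \<le> C" by (auto simp: bounded_iff)
  then show ?thesis by (intro that[of "max 0 C"]) auto
qed

lemma functional_jointly_measurable: "(\<lambda>(s, \<omega>). g (Z (max 0 s) \<omega>)) \<in> borel_measurable (borel \<Otimes>\<^sub>M M)"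
proof -
  have "(\<lambda>x. indicator K x *\<^sub>R g x) \<in> borel_measurable borel"
    by (rule borel_measurable_continuous_on_indicator[OF state_space_borel g])
  from measurable_compose[OF continuous_process_jointly_measurable[OF process_measurable path_continuous] this]
  show ?thesis
    by (rule measurable_cong[THEN iffD1, rotated])
       (auto simp: space_pair_measure split_beta' stays)
qed

lemma functional_measurable: "0 \<le> t \<Longrightarrow> (\<lambda>\<omega>. g (Z t \<omega>)) \<in> borel_measurable M"
  using measurable_compose[OF measurable_Pair1'[of t borel M] functional_jointly_measurable] by simp

lemma functional_integrable: "0 \<le> t \<Longrightarrow> integrable M (\<lambda>\<omega>. g (Z t \<omega>))"
proof -
  assume t: "0 \<le> t"
  obtain C where "\<And>x. x \<in> K \<Longrightarrow> norm (g x) \<le> C" using functional_bounded by blast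
  then show ?thesis
    by (intro integrable_const_bound[of _ C] functional_measurable AE_I2) (auto simp: stays t)
qed

lemma functional_path_continuous:
  assumes "\<omega> \<in> space M"
  shows "continuous_on {0..} (\<lambda>s. g (Z s \<omega>))"
  by (rule continuous_on_compose2[OF g path_continuous[OF assms]]) (auto intro: stays[OF assms])

lemma expectation_functional_continuous: "continuous_on {0..} (\<lambda>s. expectation (\<lambda>\<omega>. g (Z s \<omega>)))"
proof -
  obtain C where C: "0 \<le> C" "\<And>x. x \<in> K \<Longrightarrow> norm (g x) \<le> C" using functional_bounded by blast
  show ?thesis
    unfolding continuous_on_sequentially
  proof (intro allI ballI impI, elim conjE)
    fix x :: "nat \<Rightarrow> real" and a :: real
    assume a: "a \<in> {0..}" and x: "\<forall>n. x n \<in> {0..}" "x \<longlonglongrightarrow> a"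
    have "(\<lambda>n. expectation (\<lambda>\<omega>. g (Z (x n) \<omega>))) \<longlonglongrightarrow> expectation (\<lambda>\<omega>. g (Z a \<omega>))"
    proof (rule integral_dominated_convergence[where w="\<lambda>_. C"])
      show "AE \<omega> in M. (\<lambda>n. g (Z (x n) \<omega>)) \<longlonglongrightarrow> g (Z a \<omega>)"
        using continuous_on_tendsto_compose[OF functional_path_continuous x(2)] a x(1) by (intro AE_I2) auto
      show "AE \<omega> in M. norm (g (Z (x n) \<omega>)) \<le> C" for n
        using x(1) by (intro AE_I2 C stays) auto
    qed (use a x in \<open>auto intro!: functional_measurable\<close>)
    then show "((\<lambda>s. expectation (\<lambda>\<omega>. g (Z s \<omega>))) \<circ> x) \<longlonglongrightarrow> expectation (\<lambda>\<omega>. g (Z a \<omega>))"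
      by (simp add: comp_def)
  qed
qed

lemma functional_path_integrable:
  assumes "\<omega> \<in> space M" "0 \<le> u"
  shows "set_integrable lborel {u..v} (\<lambda>s. g (Z s \<omega>))"
  by (rule borel_integrable_atLeastAtMost')
     (rule continuous_on_subset[OF functional_path_continuous[OF assms(1)]], use assms in auto)

lemma
  assumes u: "0 \<le> u"
  shows path_integral_integrable: "integrable M (\<lambda>\<omega>. LINT s:{u..v}|lborel. g (Z s \<omega>))"
    and expectation_path_integral: "expectation (\<lambda>\<omega>. LINT s:{u..v}|lborel. g (Z s \<omega>))
      = integral {u..v} (\<lambda>s. expectation (\<lambda>\<omega>. g (Z s \<omega>)))"
proof -
  have finite: "emeasure (lborel \<Otimes>\<^sub>M M) ({u..v} \<times> space M) < \<infinity>"
    using emeasure_pair_measure_Times[of "{u..v}" lborel "space M"]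
    by (cases "u \<le> v") (simp_all add: emeasure_space_1)
  interpret pair_sigma_finite lborel M ..
  obtain C where C: "0 \<le> C" "\<And>x. x \<in> K \<Longrightarrow> norm (g x) \<le> C" using functional_bounded by blast
  let ?f = "\<lambda>s \<omega>. indicat_real {u..v} s *\<^sub>R g (Z (max 0 s) \<omega>)"
  have "(\<lambda>(s, \<omega>). g (Z (max 0 s) \<omega>)) \<in> borel_measurable (lborel \<Otimes>\<^sub>M M)"
    using functional_jointly_measurable
    by (subst measurable_cong_sets[OF sets_pair_measure_cong[OF sets_lborel refl] refl])
  then have [measurable]: "(\<lambda>x. g (Z (max 0 (fst x)) (snd x))) \<in> borel_measurable (lborel \<Otimes>\<^sub>M M)"
    by (simp add: split_beta')
  have int: "integrable (lborel \<Otimes>\<^sub>M M) (case_prod ?f)"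
  proof (rule integrableI_bounded_set[where A="{u..v} \<times> space M" and B=C])
    show "emeasure (lborel \<Otimes>\<^sub>M M) ({u..v} \<times> space M) < \<infinity>" by (fact finite)
    show "AE x in lborel \<Otimes>\<^sub>M M. x \<in> {u..v} \<times> space M \<longrightarrow> norm (case_prod ?f x) \<le> C"
      using C stays by (intro AE_I2) auto
    show "AE x in lborel \<Otimes>\<^sub>M M. x \<notin> {u..v} \<times> space M \<longrightarrow> case_prod ?f x = 0"
      by (intro AE_I2) (auto simp: space_pair_measure indicator_def split: if_splits)
  qed (simp_all add: split_beta')
  have eq: "?f s \<omega> = indicat_real {u..v} s *\<^sub>R g (Z s \<omega>)" for s \<omega>
    using u by (auto simp: indicator_def max_def)
  show "integrable M (\<lambda>\<omega>. LINT s:{u..v}|lborel. g (Z s \<omega>))"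
    using integrable_snd[OF int] by (simp add: eq set_lebesgue_integral_def)
  have i: "integrable lborel (\<lambda>s. expectation (\<lambda>\<omega>. ?f s \<omega>))"
    using integrable_fst[OF int] by simp
  have "expectation (\<lambda>\<omega>. LINT s:{u..v}|lborel. g (Z s \<omega>)) = (LINT s|lborel. expectation (\<lambda>\<omega>. ?f s \<omega>))"
    unfolding set_lebesgue_integral_def eq[symmetric] using Fubini_integral[OF int] by simp
  also have "\<dots> = (LINT s:{u..v}|lborel. expectation (\<lambda>\<omega>. g (Z s \<omega>)))"
    unfolding set_lebesgue_integral_def by (simp add: eq)
  also have "\<dots> = integral {u..v} (\<lambda>s. expectation (\<lambda>\<omega>. g (Z s \<omega>)))"
    using i by (intro set_borel_integral_eq_integral) (simp add: set_integrable_def eq)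
  finally show "expectation (\<lambda>\<omega>. LINT s:{u..v}|lborel. g (Z s \<omega>))
      = integral {u..v} (\<lambda>s. expectation (\<lambda>\<omega>. g (Z s \<omega>)))" .
qed

lemma path_integral_norm_le:
  assumes "\<omega> \<in> space M" "0 \<le> u" "u \<le> v" "\<And>x. x \<in> K \<Longrightarrow> norm (g x) \<le> C"
  shows "norm (LINT s:{u..v}|lborel. g (Z s \<omega>)) \<le> C * (v - u)"
proof -
  have "norm (integral {u..v} (\<lambda>s. g (Z s \<omega>))) \<le> C * (v - u)"
    using assms
    by (intro integral_bound continuous_on_subset[OF functional_path_continuous[OF assms(1)]])
       (auto intro!: assms(4) stays)
  then show ?thesis
    using set_borel_integral_eq_integral(2)[OF functional_path_integrable[OF assms(1,2)]] by simp
qed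

lemma path_integral_combine:
  assumes "\<omega> \<in> space M" "0 \<le> u" "u \<le> v"
  shows "(LINT s:{0..v}|lborel. g (Z s \<omega>)) - (LINT s:{0..u}|lborel. g (Z s \<omega>))
    = (LINT s:{u..v}|lborel. g (Z s \<omega>))"
proof -
  note i = set_borel_integral_eq_integral[OF functional_path_integrable[OF assms(1)]]
  show ?thesis
    using Henstock_Kurzweil_Integration.integral_combine[OF assms(2,3) i(1)[OF order_refl, of v]]
    by (simp add: i(2) assms algebra_simps)
qed

end

lemma expectation_path_mean_square:
  fixes g :: "'b \<Rightarrow> 'c::euclidean_space"
  assumes g: "continuous_on K g"
  shows "(\<integral>\<^sup>+\<omega>. (\<integral>\<^sup>+s\<in>{0..t}. ennreal ((norm (g (Z s \<omega>)))\<^sup>2) \<partial>lborel) \<partial>M)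
    = ennreal (integral {0..t} (\<lambda>s. expectation (\<lambda>\<omega>. (norm (g (Z s \<omega>)))\<^sup>2)))"
proof -
  have g2: "continuous_on K (\<lambda>x. (norm (g x))\<^sup>2)" by (intro continuous_intros g)
  have "(\<integral>\<^sup>+s\<in>{0..t}. ennreal ((norm (g (Z s \<omega>)))\<^sup>2) \<partial>lborel)
      = ennreal (LINT s:{0..t}|lborel. (norm (g (Z s \<omega>)))\<^sup>2)" if "\<omega> \<in> space M" for \<omega>
    using functional_path_integrable[OF g2 that order_refl, of t] by (rule nn_set_integral_eq_set_integral) simp
  then have "(\<integral>\<^sup>+\<omega>. (\<integral>\<^sup>+s\<in>{0..t}. ennreal ((norm (g (Z s \<omega>)))\<^sup>2) \<partial>lborel) \<partial>M)
      = (\<integral>\<^sup>+\<omega>. ennreal (LINT s:{0..t}|lborel. (norm (g (Z s \<omega>)))\<^sup>2) \<partial>M)"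
    by (intro nn_integral_cong) auto
  also have "\<dots> = ennreal (expectation (\<lambda>\<omega>. LINT s:{0..t}|lborel. (norm (g (Z s \<omega>)))\<^sup>2))"
    using path_integral_integrable[OF g2 order_refl, of t]
    by (intro nn_integral_eq_integral) (auto simp: set_lebesgue_integral_def intro!: integral_nonneg_AE)
  also have "\<dots> = ennreal (integral {0..t} (\<lambda>s. expectation (\<lambda>\<omega>. (norm (g (Z s \<omega>)))\<^sup>2)))"
    by (simp add: expectation_path_integral[OF g2 order_refl])
  finally show ?thesis .
qed

end

section \<open>Moments of solutions of stochastic differential equations\<close>

locale sde_space = prob_space M + W: brownian_space M F W + B: brownian_space M F B
  for M :: "'a measure" and F :: "real \<Rightarrow> 'a measure" and W B :: "real \<Rightarrow> 'a \<Rightarrow> real^'n"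

locale bounded_solution = sde_space M F W B
  for M :: "'a measure" and F and W B :: "real \<Rightarrow> 'a \<Rightarrow> real^'n" +
  fixes \<alpha> \<kappa> :: "real^'n \<Rightarrow> real^'n^'n" and \<beta> :: "real^'n \<Rightarrow> real^'n"
    and Z :: "real \<Rightarrow> 'a \<Rightarrow> real^'n" and K :: "(real^'n) set"
  assumes solution: "sde_solution M F W B \<alpha> \<beta> \<kappa> Z" and stays_in: "stays_in M K Z"
    and compact_space: "compact K"
    and continuous_coeffs: "continuous_on K \<alpha>" "continuous_on K \<beta>" "continuous_on K \<kappa>"
begin

lemma adapted: "0 \<le> t \<Longrightarrow> Z t \<in> borel_measurable (F t)"
  using solution unfolding sde_solution_def by blast

sublocale compact_process M Z K
proof unfold_locales
  show "Z t \<in> borel_measurable M" if "0 \<le> t" for t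
    using W.measurable_filtration[OF adapted[OF that]] .
  show "continuous_on {0..} (\<lambda>t. Z t \<omega>)" if "\<omega> \<in> space M" for \<omega>
    using solution that unfolding sde_solution_def by blast
  show "Z t \<omega> \<in> K" if "\<omega> \<in> space M" "0 \<le> t" for t \<omega>
    using stays_in that unfolding stays_in_def by blast
qed (rule compact_space)

text \<open>
  Subtracting the equations at times \<open>t\<close> and \<open>s\<close> leaves the drift and two Ito increments, each
  orthogonal to \<open>F s\<close>.
\<close>

lemma increment_orthogonal:
  assumes st: "0 \<le> s" "s \<le> t" and G: "G \<in> borel_measurable (F s)" "\<And>\<omega>. \<omega> \<in> space M \<Longrightarrow> norm (G \<omega>) \<le> C"
  shows "has_bochner_integral M (\<lambda>\<omega>. G \<omega> \<bullet> (Z t \<omega> - Z s \<omega> - (LINT r:{s..t}|lborel. \<beta> (Z r \<omega>)))) 0"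
proof -
  obtain I J where I: "ito_integral M F W (\<lambda>s \<omega>. \<alpha> (Z s \<omega>)) t I"
    and J: "ito_integral M F B (\<lambda>s \<omega>. \<kappa> (Z s \<omega>)) t J"
    and Zt: "AE \<omega> in M. Z t \<omega> = Z 0 \<omega> + I \<omega> + (LINT s:{0..t}|lborel. \<beta> (Z s \<omega>)) + J \<omega>"
    using solution order_trans[OF st] unfolding sde_solution_def by blast
  obtain I' J' where I': "ito_integral M F W (\<lambda>s \<omega>. \<alpha> (Z s \<omega>)) s I'"
    and J': "ito_integral M F B (\<lambda>s \<omega>. \<kappa> (Z s \<omega>)) s J'"
    and Zs: "AE \<omega> in M. Z s \<omega> = Z 0 \<omega> + I' \<omega> + (LINT s:{0..s}|lborel. \<beta> (Z s \<omega>)) + J' \<omega>"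
    using solution st unfolding sde_solution_def by blast
  have 1: "has_bochner_integral M (\<lambda>\<omega>. G \<omega> \<bullet> (I \<omega> - I' \<omega>) + G \<omega> \<bullet> (J \<omega> - J' \<omega>)) (0 + 0)"
    by (intro has_bochner_integral_add W.ito_integral_increment_orthogonal[OF st I I' G]
        B.ito_integral_increment_orthogonal[OF st J J' G])
  have ae: "AE \<omega> in M. G \<omega> \<bullet> (I \<omega> - I' \<omega>) + G \<omega> \<bullet> (J \<omega> - J' \<omega>)
      = G \<omega> \<bullet> (Z t \<omega> - Z s \<omega> - (LINT r:{s..t}|lborel. \<beta> (Z r \<omega>)))"
    using Zt Zs AE_space
  proof eventually_elim
    case (elim \<omega>)
    show ?case
      using path_integral_combine[OF continuous_coeffs(2) elim(3) st, symmetric] elim(1,2)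
      by (simp add: inner_add_right inner_diff_right)
  qed
  have [measurable]: "Z t \<in> borel_measurable M" "Z s \<in> borel_measurable M" "G \<in> borel_measurable M"
    using process_measurable st W.measurable_filtration[OF G(1)] by auto
  have [measurable]: "(\<lambda>\<omega>. LINT r:{s..t}|lborel. \<beta> (Z r \<omega>)) \<in> borel_measurable M"
    by (rule borel_measurable_integrable[OF path_integral_integrable[OF continuous_coeffs(2) st(1)]])
  have "has_bochner_integral M (\<lambda>\<omega>. G \<omega> \<bullet> (I \<omega> - I' \<omega>) + G \<omega> \<bullet> (J \<omega> - J' \<omega>)) 0
     \<longleftrightarrow> has_bochner_integral M (\<lambda>\<omega>. G \<omega> \<bullet> (Z t \<omega> - Z s \<omega> - (LINT r:{s..t}|lborel. \<beta> (Z r \<omega>)))) 0"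
    by (rule has_bochner_integral_cong_AE) (use 1 ae in auto)
  with 1 show ?thesis by simp
qed

end

context bounded_solution
begin

lemma mean_increment:
  assumes st: "0 \<le> s" "s \<le> t"
  shows "expectation (\<lambda>\<omega>. c \<bullet> Z t \<omega>) - expectation (\<lambda>\<omega>. c \<bullet> Z s \<omega>)
    = integral {s..t} (\<lambda>r. expectation (\<lambda>\<omega>. c \<bullet> \<beta> (Z r \<omega>)))"
proof -
  have c: "continuous_on K (\<lambda>x. c \<bullet> x)" "continuous_on K (\<lambda>x. c \<bullet> \<beta> x)"
    by (intro continuous_intros continuous_coeffs)+
  have inner: "c \<bullet> (LINT r:{s..t}|lborel. \<beta> (Z r \<omega>)) = (LINT r:{s..t}|lborel. c \<bullet> \<beta> (Z r \<omega>))"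
    if "\<omega> \<in> space M" for \<omega>
    using functional_path_integrable[OF continuous_coeffs(2) that st(1), of t]
    unfolding set_lebesgue_integral_def set_integrable_def
    by (simp flip: inner_scaleR_right add: integral_inner_right)
  have "has_bochner_integral M (\<lambda>\<omega>. c \<bullet> (Z t \<omega> - Z s \<omega> - (LINT r:{s..t}|lborel. \<beta> (Z r \<omega>)))) 0"
    by (rule increment_orthogonal[OF st, of "\<lambda>_. c" "norm c"]) auto
  then have "0 = expectation (\<lambda>\<omega>. c \<bullet> (Z t \<omega> - Z s \<omega> - (LINT r:{s..t}|lborel. \<beta> (Z r \<omega>))))"
    by (simp add: has_bochner_integral_iff)
  also have "\<dots> = expectation (\<lambda>\<omega>. c \<bullet> Z t \<omega> - c \<bullet> Z s \<omega> - (LINT r:{s..t}|lborel. c \<bullet> \<beta> (Z r \<omega>)))"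
    by (intro Bochner_Integration.integral_cong) (simp_all add: inner_diff_right inner)
  also have "\<dots> = expectation (\<lambda>\<omega>. c \<bullet> Z t \<omega>) - expectation (\<lambda>\<omega>. c \<bullet> Z s \<omega>)
      - expectation (\<lambda>\<omega>. LINT r:{s..t}|lborel. c \<bullet> \<beta> (Z r \<omega>))"
    using functional_integrable[OF c(1)] path_integral_integrable[OF c(2) st(1)] st by simp
  finally show ?thesis using expectation_path_integral[OF c(2) st(1), of t] by simp
qed

text \<open>
  Pairing the increment with \<open>Z s\<close> removes the martingale part. The square of the increment, which
  contains the large diffusion term, has the favourable sign and is dropped, so the constant does not depend on
  \<open>\<alpha>\<close> and \<open>\<kappa>\<close>.
\<close>

lemma second_moment_increment:
  assumes st: "0 \<le> s" "s \<le> t"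
    and R: "\<And>x. x \<in> K \<Longrightarrow> norm x \<le> R" and C: "\<And>x. x \<in> K \<Longrightarrow> norm (\<beta> x) \<le> C"
  shows "expectation (\<lambda>\<omega>. (norm (Z s \<omega>))\<^sup>2) \<le> expectation (\<lambda>\<omega>. (norm (Z t \<omega>))\<^sup>2) + 2 * R * C * (t - s)"
proof -
  let ?L = "\<lambda>\<omega>. LINT r:{s..t}|lborel. \<beta> (Z r \<omega>)"
  have c: "continuous_on K (\<lambda>x. (norm x)\<^sup>2)" by (intro continuous_intros)
  have o: "has_bochner_integral M (\<lambda>\<omega>. Z s \<omega> \<bullet> (Z t \<omega> - Z s \<omega> - ?L \<omega>)) 0"
    by (rule increment_orthogonal[OF st adapted, of R]) (use st R stays in auto)
  have "expectation (\<lambda>\<omega>. (norm (Z s \<omega>))\<^sup>2 + 2 * (Z s \<omega> \<bullet> (Z t \<omega> - Z s \<omega> - ?L \<omega>)) - 2 * R * C * (t - s))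
      \<le> expectation (\<lambda>\<omega>. (norm (Z t \<omega>))\<^sup>2)"
  proof (rule integral_mono)
    show "integrable M (\<lambda>\<omega>. (norm (Z s \<omega>))\<^sup>2 + 2 * (Z s \<omega> \<bullet> (Z t \<omega> - Z s \<omega> - ?L \<omega>)) - 2 * R * C * (t - s))"
      using functional_integrable[OF c] o st by (auto simp: has_bochner_integral_iff)
    show "integrable M (\<lambda>\<omega>. (norm (Z t \<omega>))\<^sup>2)" using functional_integrable[OF c] st by auto
    fix \<omega> assume w: "\<omega> \<in> space M"
    have "0 \<le> (norm (Z t \<omega> - Z s \<omega>))\<^sup>2" by simp
    then have 1: "(norm (Z s \<omega>))\<^sup>2 + 2 * (Z s \<omega> \<bullet> (Z t \<omega> - Z s \<omega>)) \<le> (norm (Z t \<omega>))\<^sup>2"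
      by (simp add: power2_norm_eq_inner inner_diff_left inner_diff_right inner_commute)
    have "- (Z s \<omega> \<bullet> ?L \<omega>) \<le> norm (Z s \<omega>) * norm (?L \<omega>)"
      using Cauchy_Schwarz_ineq2[of "Z s \<omega>" "?L \<omega>"] by linarith
    also have "\<dots> \<le> R * (C * (t - s))"
      using w st R C by (intro mult_mono path_integral_norm_le continuous_coeffs)
         (auto intro: stays order_trans[OF norm_ge_zero])
    finally show "(norm (Z s \<omega>))\<^sup>2 + 2 * (Z s \<omega> \<bullet> (Z t \<omega> - Z s \<omega> - ?L \<omega>)) - 2 * R * C * (t - s)
        \<le> (norm (Z t \<omega>))\<^sup>2"
      using 1 by (simp add: inner_diff_right algebra_simps)
  qed
  then show ?thesis
    using functional_integrable[OF c] o st by (simp add: has_bochner_integral_iff prob_space)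
qed

text \<open>
  The integral against \<open>W\<close> is what remains of the equation when the increment of \<open>Z\<close>, the drift
  and the integral against \<open>B\<close> are subtracted. All of these are bounded in mean square independently of \<open>\<alpha>\<close>,
  and the mean square of the integral controls that of \<open>\<alpha>(Z)\<close>.
\<close>

lemma diffusion_energy:
  assumes t: "0 \<le> t"
    and R: "\<And>x. x \<in> K \<Longrightarrow> norm x \<le> R" and C: "\<And>x. x \<in> K \<Longrightarrow> norm (\<beta> x) \<le> C"
    and D: "\<And>x. x \<in> K \<Longrightarrow> norm (\<kappa> x) \<le> D"
  shows "integral {0..t} (\<lambda>s. expectation (\<lambda>\<omega>. (norm (\<alpha> (Z s \<omega>)))\<^sup>2))
    \<le> 8 * (2 * R + C * t)\<^sup>2 + 32 * D\<^sup>2 * t"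
proof -
  obtain I J where I: "ito_integral M F W (\<lambda>s \<omega>. \<alpha> (Z s \<omega>)) t I"
    and J: "ito_integral M F B (\<lambda>s \<omega>. \<kappa> (Z s \<omega>)) t J"
    and Zt: "AE \<omega> in M. Z t \<omega> = Z 0 \<omega> + I \<omega> + (LINT s:{0..t}|lborel. \<beta> (Z s \<omega>)) + J \<omega>"
    using solution t unfolding sde_solution_def by blast
  let ?L = "\<lambda>\<omega>. LINT r:{0..t}|lborel. \<beta> (Z r \<omega>)"
  have [measurable]: "Z t \<in> borel_measurable M" "Z 0 \<in> borel_measurable M" "J \<in> borel_measurable M"
    using process_measurable t J unfolding ito_integral_def by auto
  have [measurable]: "?L \<in> borel_measurable M"
    by (rule borel_measurable_integrable[OF path_integral_integrable[OF continuous_coeffs(2) order_refl]])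
  have mI: "W.mean_square I = W.mean_square (\<lambda>\<omega>. (Z t \<omega> - Z 0 \<omega> - ?L \<omega>) + - J \<omega>)"
    unfolding W.mean_square_def
    by (rule nn_integral_cong_AE) (use Zt in \<open>eventually_elim, simp\<close>)
  have m1: "W.mean_square (\<lambda>\<omega>. Z t \<omega> - Z 0 \<omega> - ?L \<omega>) \<le> ennreal ((2 * R + C * t)\<^sup>2)"
  proof -
    have "W.mean_square (\<lambda>\<omega>. Z t \<omega> - Z 0 \<omega> - ?L \<omega>) \<le> (\<integral>\<^sup>+\<omega>. ennreal ((2 * R + C * t)\<^sup>2) \<partial>M)"
      unfolding W.mean_square_def
    proof (rule nn_integral_mono)
      fix \<omega> assume w: "\<omega> \<in> space M"
      have "norm (?L \<omega>) \<le> C * t"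
        using path_integral_norm_le[OF continuous_coeffs(2) w order_refl t C] by simp
      moreover have "norm (Z t \<omega>) \<le> R" "norm (Z 0 \<omega>) \<le> R" using R stays w t by auto
      moreover have "norm (Z t \<omega> - Z 0 \<omega> - ?L \<omega>) \<le> norm (Z t \<omega>) + norm (Z 0 \<omega>) + norm (?L \<omega>)"
        using norm_triangle_ineq4[of "Z t \<omega> - Z 0 \<omega>" "?L \<omega>"] norm_triangle_ineq4[of "Z t \<omega>" "Z 0 \<omega>"]
        by linarith
      ultimately have "norm (Z t \<omega> - Z 0 \<omega> - ?L \<omega>) \<le> 2 * R + C * t" by linarith
      then show "ennreal ((norm (Z t \<omega> - Z 0 \<omega> - ?L \<omega>))\<^sup>2) \<le> ennreal ((2 * R + C * t)\<^sup>2)"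
        by (intro ennreal_leI power_mono) auto
    qed
    then show ?thesis by (simp add: emeasure_space_1)
  qed
  have m2: "W.mean_square J \<le> 4 * ennreal (D\<^sup>2 * t)"
  proof -
    have "W.mean_square J \<le> 4 * W.path_mean_square t (\<lambda>s \<omega>. \<kappa> (Z s \<omega>))"
      by (rule B.ito_le_path_mean_square[OF J])
    also have "W.path_mean_square t (\<lambda>s \<omega>. \<kappa> (Z s \<omega>)) \<le> (\<integral>\<^sup>+\<omega>. (\<integral>\<^sup>+s\<in>{0..t}. ennreal (D\<^sup>2) \<partial>lborel) \<partial>M)"
      unfolding W.path_mean_square_def
      using D stays by (intro nn_integral_mono) (auto split: split_indicator intro!: power_mono)
    also have "\<dots> = ennreal (D\<^sup>2 * t)"
      using t by (simp add: nn_integral_cmult_indicator emeasure_space_1 ennreal_mult)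
    finally show ?thesis by (simp add: mult_left_mono)
  qed
  have "ennreal (integral {0..t} (\<lambda>s. expectation (\<lambda>\<omega>. (norm (\<alpha> (Z s \<omega>)))\<^sup>2)))
      = W.path_mean_square t (\<lambda>s \<omega>. \<alpha> (Z s \<omega>))"
    unfolding W.path_mean_square_def expectation_path_mean_square[OF continuous_coeffs(1)] ..
  also have "\<dots> \<le> 4 * W.mean_square I" by (rule W.path_mean_square_le_ito[OF I])
  finally have 1: "ennreal (integral {0..t} (\<lambda>s. expectation (\<lambda>\<omega>. (norm (\<alpha> (Z s \<omega>)))\<^sup>2))) \<le> 4 * W.mean_square I" .
  have "W.mean_square I \<le> 2 * W.mean_square (\<lambda>\<omega>. Z t \<omega> - Z 0 \<omega> - ?L \<omega>) + 2 * W.mean_square (\<lambda>\<omega>. - J \<omega>)"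
    unfolding mI by (rule W.mean_square_triangle) measurable
  also have "W.mean_square (\<lambda>\<omega>. - J \<omega>) = W.mean_square J" by (simp add: W.mean_square_def)
  finally have 2: "4 * W.mean_square I \<le> 4 * (2 * W.mean_square (\<lambda>\<omega>. Z t \<omega> - Z 0 \<omega> - ?L \<omega>) + 2 * W.mean_square J)"
    by (rule mult_left_mono) simp
  note 1
  also note 2
  also have "4 * (2 * W.mean_square (\<lambda>\<omega>. Z t \<omega> - Z 0 \<omega> - ?L \<omega>) + 2 * W.mean_square J)
      \<le> 4 * (2 * ennreal ((2 * R + C * t)\<^sup>2) + 2 * (4 * ennreal (D\<^sup>2 * t)))"
    by (intro mult_left_mono add_mono m1 m2) auto
  also have "\<dots> = ennreal (8 * (2 * R + C * t)\<^sup>2 + 32 * D\<^sup>2 * t)"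
    using t by (simp add: ennreal_plus ennreal_mult'' distrib_left mult.assoc[symmetric])
  finally show ?thesis using t by (subst (asm) ennreal_le_iff) auto
qed

end

section \<open>Convergence of bounded martingale solutions\<close>

locale driftless_solution = bounded_solution M F W B \<alpha> "\<lambda>_. 0" "\<lambda>_. 0" Z K
  for M :: "'a measure" and F W B \<alpha> Z and K :: "(real^'n) set"
begin

lemma martingale_orthogonal:
  assumes "0 \<le> s" "s \<le> t" "G \<in> borel_measurable (F s)" "\<And>\<omega>. \<omega> \<in> space M \<Longrightarrow> norm (G \<omega>) \<le> C"
  shows "has_bochner_integral M (\<lambda>\<omega>. G \<omega> \<bullet> (Z t \<omega> - Z s \<omega>)) 0"
  using increment_orthogonal[OF assms] by (simp add: set_lebesgue_integral_def)

lemma state_bounded: obtains R where "0 \<le> R" "\<And>x. x \<in> K \<Longrightarrow> norm x \<le> R"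
  using functional_bounded[OF continuous_on_id] by blast

definition second_moment :: "real \<Rightarrow> real" where
  "second_moment t = expectation (\<lambda>\<omega>. (norm (Z t \<omega>))\<^sup>2)"

lemma integrable_second_moment: "0 \<le> t \<Longrightarrow> integrable M (\<lambda>\<omega>. (norm (Z t \<omega>))\<^sup>2)"
  by (rule functional_integrable) (auto intro!: continuous_intros)

lemma increment_second_moment:
  assumes st: "0 \<le> s" "s \<le> t"
  shows "has_bochner_integral M (\<lambda>\<omega>. (norm (Z t \<omega> - Z s \<omega>))\<^sup>2) (second_moment t - second_moment s)"
proof -
  obtain R where R: "\<And>x. x \<in> K \<Longrightarrow> norm x \<le> R" using state_bounded by blast
  have o: "has_bochner_integral M (\<lambda>\<omega>. Z s \<omega> \<bullet> (Z t \<omega> - Z s \<omega>)) 0"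
    by (rule martingale_orthogonal[OF st adapted, of R]) (use st R stays in auto)
  have "has_bochner_integral M (\<lambda>\<omega>. (norm (Z t \<omega>))\<^sup>2 - (norm (Z s \<omega>))\<^sup>2 - 2 * (Z s \<omega> \<bullet> (Z t \<omega> - Z s \<omega>)))
      (second_moment t - second_moment s - 2 * 0)"
    using st unfolding second_moment_def
    by (intro has_bochner_integral_diff has_bochner_integral_mult_right has_bochner_integral_integrable
        integrable_second_moment o) auto
  then show ?thesis
    by (simp add: power2_norm_eq_inner inner_diff_left inner_diff_right inner_commute algebra_simps)
qed

lemma second_moment_mono: "0 \<le> s \<Longrightarrow> s \<le> t \<Longrightarrow> second_moment s \<le> second_moment t"
proof -
  assume "0 \<le> s" "s \<le> t"
  from increment_second_moment[OF this]
  have "expectation (\<lambda>\<omega>. (norm (Z t \<omega> - Z s \<omega>))\<^sup>2) = second_moment t - second_moment s"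
    by (simp add: has_bochner_integral_iff)
  moreover have "0 \<le> expectation (\<lambda>\<omega>. (norm (Z t \<omega> - Z s \<omega>))\<^sup>2)"
    by (rule Bochner_Integration.integral_nonneg) simp
  ultimately show ?thesis by simp
qed

text \<open>
  Kolmogorov's inequality. On the event that \<open>k\<close> is the first index at which the walk leaves the
  ball, the later increment is orthogonal to the current displacement, so the final displacement is in mean square
  at least the displacement at \<open>k\<close>, which exceeds \<open>\<epsilon>\<close>.
\<close>

lemma discrete_maximal_inequality:
  fixes \<tau> :: "nat \<Rightarrow> real"
  assumes \<tau>: "0 \<le> \<tau> 0" "mono \<tau>" and \<epsilon>: "0 < \<epsilon>"
  shows "\<epsilon>\<^sup>2 * prob {\<omega>\<in>space M. \<exists>k\<le>N. \<epsilon> < norm (Z (\<tau> k) \<omega> - Z (\<tau> 0) \<omega>)}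
    \<le> second_moment (\<tau> N) - second_moment (\<tau> 0)"
proof -
  obtain R where R: "0 \<le> R" "\<And>x. x \<in> K \<Longrightarrow> norm x \<le> R" using state_bounded by blast
  have \<tau>k: "0 \<le> \<tau> k" "\<tau> 0 \<le> \<tau> k" for k using \<tau> monoD[OF \<tau>(2), of 0 k] by auto
  define X where "X k \<omega> = Z (\<tau> k) \<omega> - Z (\<tau> 0) \<omega>" for k \<omega>
  define A where "A k = {\<omega>\<in>space M. \<epsilon> < norm (X k \<omega>) \<and> (\<forall>j<k. norm (X j \<omega>) \<le> \<epsilon>)}" for k
  have XF: "X j \<in> borel_measurable (F (\<tau> k))" if "j \<le> k" for j k
  proof -
    have "Z (\<tau> j) \<in> borel_measurable (F (\<tau> k))" "Z (\<tau> 0) \<in> borel_measurable (F (\<tau> k))"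
      using W.measurable_filtration_mono[OF monoD[OF \<tau>(2) that] adapted[OF \<tau>k(1)]]
        W.measurable_filtration_mono[OF \<tau>k(2) adapted[OF \<tau>k(1)]] by auto
    then show ?thesis unfolding X_def[abs_def] by measurable
  qed
  have AF: "A k \<in> sets (F (\<tau> k))" for k
  proof -
    have "{\<omega>\<in>space (F (\<tau> k)). \<epsilon> < norm (X k \<omega>) \<and> (\<forall>j\<in>{..<k}. norm (X j \<omega>) \<le> \<epsilon>)} \<in> sets (F (\<tau> k))"
      using XF by (intro sets.sets_Collect_conj sets.sets_Collect_finite_All borel_measurable_less
        borel_measurable_le borel_measurable_norm borel_measurable_const) auto
    then show ?thesis by (simp add: A_def Ball_def)
  qed
  have A[measurable]: "A k \<in> sets M" for k using AF W.sets_filtration_sub by blast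
  have [measurable]: "X k \<in> borel_measurable M" for k
    using XF W.measurable_filtration by blast
  have Xb: "norm (X k \<omega>) \<le> 2 * R" if "\<omega> \<in> space M" for k \<omega>
    using R(2)[OF stays[OF that \<tau>k(1)[of k]]] R(2)[OF stays[OF that \<tau>k(1)[of 0]]]
      norm_triangle_ineq4[of "Z (\<tau> k) \<omega>" "Z (\<tau> 0) \<omega>"] unfolding X_def by linarith
  have int: "integrable M (\<lambda>\<omega>. indicat_real (A k) \<omega> * (norm (X N \<omega>))\<^sup>2)" for k
    using power_mono[OF Xb norm_ge_zero, of _ N 2]
    by (intro integrable_const_bound[of _ "(2 * R)\<^sup>2"] AE_I2) (auto simp: indicator_def)
  have step: "\<epsilon>\<^sup>2 * prob (A k) \<le> expectation (\<lambda>\<omega>. indicat_real (A k) \<omega> * (norm (X N \<omega>))\<^sup>2)" if "k \<le> N" for k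
  proof -
    let ?G = "\<lambda>\<omega>. indicat_real (A k) \<omega> *\<^sub>R X k \<omega>"
    have "has_bochner_integral M (\<lambda>\<omega>. ?G \<omega> \<bullet> (Z (\<tau> N) \<omega> - Z (\<tau> k) \<omega>)) 0"
    proof (rule martingale_orthogonal)
      show "?G \<in> borel_measurable (F (\<tau> k))" using XF[OF order_refl] AF by measurable
      show "norm (?G \<omega>) \<le> 2 * R" if "\<omega> \<in> space M" for \<omega>
        using Xb[OF that] R(1) by (auto simp: indicator_def)
    qed (use \<tau>k monoD[OF \<tau>(2) that] in auto)
    then have o: "has_bochner_integral M (\<lambda>\<omega>. ?G \<omega> \<bullet> (X N \<omega> - X k \<omega>)) 0" by (simp add: X_def)
    have i: "has_bochner_integral M (\<lambda>\<omega>. indicat_real (A k) \<omega> * \<epsilon>\<^sup>2 + 2 * (?G \<omega> \<bullet> (X N \<omega> - X k \<omega>)))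
        (prob (A k) * \<epsilon>\<^sup>2 + 2 * 0)"
      by (intro has_bochner_integral_add has_bochner_integral_mult_left has_bochner_integral_mult_right
          has_bochner_integral_real_indicator A o) (simp add: less_top[symmetric])
    then have "\<epsilon>\<^sup>2 * prob (A k)
        = expectation (\<lambda>\<omega>. indicat_real (A k) \<omega> * \<epsilon>\<^sup>2 + 2 * (?G \<omega> \<bullet> (X N \<omega> - X k \<omega>)))"
      by (simp add: has_bochner_integral_iff)
    also have "\<dots> \<le> expectation (\<lambda>\<omega>. indicat_real (A k) \<omega> * (norm (X N \<omega>))\<^sup>2)"
    proof (rule integral_mono[OF _ int])
      show "integrable M (\<lambda>\<omega>. indicat_real (A k) \<omega> * \<epsilon>\<^sup>2 + 2 * (?G \<omega> \<bullet> (X N \<omega> - X k \<omega>)))"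
        using i unfolding has_bochner_integral_iff by blast
      fix \<omega>
      show "indicat_real (A k) \<omega> * \<epsilon>\<^sup>2 + 2 * (?G \<omega> \<bullet> (X N \<omega> - X k \<omega>)) \<le> indicat_real (A k) \<omega> * (norm (X N \<omega>))\<^sup>2"
      proof (cases "\<omega> \<in> A k")
        case True
        then have "\<epsilon>\<^sup>2 \<le> (norm (X k \<omega>))\<^sup>2" using \<epsilon> by (intro power_mono) (auto simp: A_def)
        moreover have "(norm (X N \<omega>))\<^sup>2 = (norm (X k \<omega>))\<^sup>2 + 2 * (X k \<omega> \<bullet> (X N \<omega> - X k \<omega>)) + (norm (X N \<omega> - X k \<omega>))\<^sup>2"
          by (simp add: power2_norm_eq_inner inner_diff_left inner_diff_right inner_commute)
        moreover have "0 \<le> (norm (X N \<omega> - X k \<omega>))\<^sup>2" by simp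
        ultimately have "\<epsilon>\<^sup>2 + 2 * (X k \<omega> \<bullet> (X N \<omega> - X k \<omega>)) \<le> (norm (X N \<omega>))\<^sup>2" by linarith
        then show ?thesis using True by simp
      qed simp
    qed
    finally show ?thesis .
  qed
  have disj: "disjoint_family_on A {..N}"
    unfolding disjoint_family_on_def A_def by (auto simp: not_less[symmetric]) (metis linorder_neqE_nat not_less)
  have "{\<omega>\<in>space M. \<exists>k\<le>N. \<epsilon> < norm (Z (\<tau> k) \<omega> - Z (\<tau> 0) \<omega>)} = (\<Union>k\<in>{..N}. A k)"
  proof safe
    fix \<omega> k assume w: "\<omega> \<in> space M" "k \<le> N" "\<epsilon> < norm (Z (\<tau> k) \<omega> - Z (\<tau> 0) \<omega>)"
    let ?k = "LEAST k. \<epsilon> < norm (X k \<omega>)"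
    have ex: "\<epsilon> < norm (X k \<omega>)" using w by (simp add: X_def)
    have "?k \<le> k" by (rule Least_le[of "\<lambda>k. \<epsilon> < norm (X k \<omega>)", OF ex])
    moreover have "\<omega> \<in> A ?k"
      unfolding A_def using LeastI[of "\<lambda>k. \<epsilon> < norm (X k \<omega>)", OF ex] not_less_Least w(1)
      by (auto simp: not_less[symmetric])
    ultimately show "\<omega> \<in> (\<Union>k\<in>{..N}. A k)" using w(2) by (intro UN_I[of ?k]) auto
  qed (auto simp: A_def X_def)
  then have "\<epsilon>\<^sup>2 * prob {\<omega>\<in>space M. \<exists>k\<le>N. \<epsilon> < norm (Z (\<tau> k) \<omega> - Z (\<tau> 0) \<omega>)} = (\<Sum>k\<le>N. \<epsilon>\<^sup>2 * prob (A k))"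
    using finite_measure_finite_Union[OF _ _ disj] by (simp add: sum_distrib_left image_subset_iff)
  also have "\<dots> \<le> (\<Sum>k\<le>N. expectation (\<lambda>\<omega>. indicat_real (A k) \<omega> * (norm (X N \<omega>))\<^sup>2))"
    by (intro sum_mono step) simp
  also have "\<dots> = expectation (\<lambda>\<omega>. \<Sum>k\<le>N. indicat_real (A k) \<omega> * (norm (X N \<omega>))\<^sup>2)"
    by (rule Bochner_Integration.integral_sum[symmetric]) (rule int)
  also have "\<dots> \<le> expectation (\<lambda>\<omega>. (norm (X N \<omega>))\<^sup>2)"
  proof (rule integral_mono)
    show "integrable M (\<lambda>\<omega>. (norm (X N \<omega>))\<^sup>2)"
      using increment_second_moment[OF \<tau>(1) \<tau>k(2), of N] by (auto simp: X_def has_bochner_integral_iff)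
    fix \<omega>
    have "(\<Sum>k\<le>N. indicat_real (A k) \<omega>) = indicat_real (\<Union>k\<le>N. A k) \<omega>"
      by (rule indicator_UN_disjoint[OF _ disj, symmetric]) simp
    then have "(\<Sum>k\<le>N. indicat_real (A k) \<omega> * (norm (X N \<omega>))\<^sup>2)
        = indicat_real (\<Union>k\<le>N. A k) \<omega> * (norm (X N \<omega>))\<^sup>2"
      by (simp only: sum_distrib_right[symmetric])
    then show "(\<Sum>k\<le>N. indicat_real (A k) \<omega> * (norm (X N \<omega>))\<^sup>2) \<le> (norm (X N \<omega>))\<^sup>2"
      by (simp only:) (simp add: indicator_def)
  qed (intro Bochner_Integration.integrable_sum int)
  also have "\<dots> = second_moment (\<tau> N) - second_moment (\<tau> 0)"
    using increment_second_moment[OF \<tau>(1) \<tau>k(2), of N] by (auto simp: X_def has_bochner_integral_iff)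
  finally show ?thesis .
qed

end

lemma tendsto_at_top_of_small_oscillation:
  fixes f :: "real \<Rightarrow> 'b::banach"
  assumes osc: "\<And>j::nat. \<exists>n::nat. \<forall>t\<ge>real n. norm (f t - f (real n)) \<le> 1 / real (Suc j)"
  shows "\<exists>l. (f \<longlongrightarrow> l) at_top"
proof -
  have osc': "\<exists>n::nat. \<forall>t\<ge>real n. norm (f t - f (real n)) < e" if e: "0 < e" for e
  proof -
    obtain j where "inverse (real (Suc j)) < e" using reals_Archimedean[OF e] by blast
    with osc[of j] show ?thesis by (auto simp: inverse_eq_divide intro: le_less_trans)
  qed
  have "Cauchy (\<lambda>n. f (real n))"
  proof (rule CauchyI)
    fix e :: real assume "0 < e"
    then obtain n where n: "\<And>t. real n \<le> t \<Longrightarrow> norm (f t - f (real n)) < e / 2"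
      using osc'[of "e / 2"] by auto
    have "norm (f (real i) - f (real j)) < e" if "n \<le> i" "n \<le> j" for i j
      using norm_triangle_ineq4[of "f (real i) - f (real n)" "f (real j) - f (real n)"]
        n[of "real i"] n[of "real j"] that by simp
    then show "\<exists>M. \<forall>i\<ge>M. \<forall>j\<ge>M. norm (f (real i) - f (real j)) < e" by blast
  qed
  then obtain l where l: "(\<lambda>n. f (real n)) \<longlonglongrightarrow> l"
    using Cauchy_convergent convergent_def by blast
  have "(f \<longlongrightarrow> l) at_top"
  proof (rule tendstoI)
    fix e :: real assume e: "0 < e"
    then obtain n where n: "\<And>t. real n \<le> t \<Longrightarrow> norm (f t - f (real n)) < e / 3"
      using osc'[of "e / 3"] by auto
    have "norm (l - f (real n)) \<le> e / 3"
    proof (rule tendsto_upperbound)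
      show "(\<lambda>i. norm (f (real i) - f (real n))) \<longlonglongrightarrow> norm (l - f (real n))"
        by (intro tendsto_intros l)
      show "\<forall>\<^sub>F i in sequentially. norm (f (real i) - f (real n)) \<le> e / 3"
        using eventually_ge_at_top[of n] by eventually_elim (use n in \<open>auto intro: less_imp_le\<close>)
    qed simp
    then have d: "dist (f t) l < e" if "real n \<le> t" for t
      using n[OF that] norm_triangle_ineq4[of "f t - f (real n)" "l - f (real n)"] e
      by (simp add: dist_norm)
    show "\<forall>\<^sub>F t in at_top. dist (f t) l < e"
      using eventually_ge_at_top[of "real n"] by eventually_elim (rule d)
  qed
  then show ?thesis by blast
qed

text \<open>
  Continuity reduces convergence to countably many conditions, which makes it an event. Writing
  \<open>max 0\<close> keeps all times nonnegative.
\<close>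

lemma tendsto_at_top_iff_rational:
  fixes f :: "real \<Rightarrow> 'b::real_normed_vector"
  assumes f: "continuous_on {0..} f"
  shows "(f \<longlongrightarrow> z) at_top \<longleftrightarrow>
    (\<forall>j::nat. \<exists>n::nat. \<forall>r::rat. real n \<le> of_rat r \<longrightarrow> norm (f (max 0 (of_rat r)) - z) \<le> 1 / real (Suc j))"
    (is "_ \<longleftrightarrow> ?R")
proof
  assume lim: "(f \<longlongrightarrow> z) at_top"
  show ?R
  proof
    fix j :: nat
    have "\<forall>\<^sub>F t in at_top. dist (f t) z < 1 / real (Suc j)" by (rule tendstoD[OF lim]) simp
    then obtain T where T: "\<And>t. T \<le> t \<Longrightarrow> dist (f t) z < 1 / real (Suc j)"
      by (auto simp: eventually_at_top_linorder)
    obtain n where n: "T \<le> real n" using real_arch_simple by blast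
    have "norm (f (max 0 (of_rat r)) - z) \<le> 1 / real (Suc j)" if "real n \<le> of_rat r" for r
    proof -
      have "max 0 (of_rat r) = (of_rat r :: real)" using that order_trans[OF of_nat_0_le_iff that] by simp
      then show ?thesis using T[of "of_rat r"] n that by (simp add: dist_norm)
    qed
    then show "\<exists>n::nat. \<forall>r. real n \<le> of_rat r \<longrightarrow> norm (f (max 0 (of_rat r)) - z) \<le> 1 / real (Suc j)" by blast
  qed
next
  assume R: ?R
  show "(f \<longlongrightarrow> z) at_top"
  proof (rule tendstoI)
    fix e :: real assume e: "0 < e"
    obtain j where j: "inverse (real (Suc j)) < e" using reals_Archimedean[OF e] by blast
    obtain n where n: "\<And>r::rat. real n \<le> of_rat r \<Longrightarrow> norm (f (max 0 (of_rat r)) - z) \<le> 1 / real (Suc j)"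
      using R by blast
    have d: "norm (f t - z) < e" if t: "real n \<le> t" for t
    proof (rule ccontr)
      assume neg: "\<not> norm (f t - z) < e"
      have t0: "0 \<le> t" using t order_trans[OF of_nat_0_le_iff] by blast
      have "0 < norm (f t - z) - inverse (real (Suc j))" using neg j by linarith
      then obtain d where d: "0 < d"
        "\<And>u. 0 \<le> u \<Longrightarrow> dist u t < d \<Longrightarrow> dist (f u) (f t) < norm (f t - z) - inverse (real (Suc j))"
        using f t0 unfolding continuous_on_iff by (metis atLeast_iff)
      obtain r where r: "t < of_rat r" "of_rat r < t + d" using of_rat_dense[of t "t + d"] d(1) by auto
      have "norm (f (of_rat r) - z) \<le> inverse (real (Suc j))"
        using n[of r] r(1) t t0 by (simp add: inverse_eq_divide)
      moreover have "dist (f (of_rat r)) (f t) < norm (f t - z) - inverse (real (Suc j))"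
      proof (rule d(2))
        show "0 \<le> (of_rat r :: real)" using r(1) t0 by linarith
        show "dist (of_rat r) t < d" using r by (simp add: dist_real_def)
      qed
      moreover have "norm (f t - z) \<le> dist (f (of_rat r)) (f t) + norm (f (of_rat r) - z)"
        using norm_triangle_ineq4[of "f (of_rat r) - z" "f (of_rat r) - f t"] by (simp add: dist_norm)
      ultimately show False by linarith
    qed
    show "\<forall>\<^sub>F t in at_top. dist (f t) z < e"
      using eventually_ge_at_top[of "real n"] unfolding dist_norm by eventually_elim (rule d)
  qed
qed

lemma (in compact_process) convergence_event:
  "{\<omega>\<in>space M. ((\<lambda>t. Z t \<omega>) \<longlongrightarrow> z) at_top} \<in> sets M"
proof -
  have [measurable]: "Z (max 0 (of_rat r)) \<in> borel_measurable M" for r :: rat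
    by (rule process_measurable) simp
  have "{\<omega>\<in>space M. \<forall>j::nat. \<exists>n::nat. \<forall>r::rat. real n \<le> of_rat r \<longrightarrow>
      norm (Z (max 0 (of_rat r)) \<omega> - z) \<le> 1 / real (Suc j)} \<in> sets M"
    by measurable
  also have "{\<omega>\<in>space M. \<forall>j::nat. \<exists>n::nat. \<forall>r::rat. real n \<le> of_rat r \<longrightarrow>
      norm (Z (max 0 (of_rat r)) \<omega> - z) \<le> 1 / real (Suc j)}
    = {\<omega>\<in>space M. ((\<lambda>t. Z t \<omega>) \<longlongrightarrow> z) at_top}"
    using tendsto_at_top_iff_rational[OF path_continuous] by blast
  finally show ?thesis .
qed

context driftless_solution
begin

text \<open>
  The grids with mesh \<open>2 ^ - i\<close> up to \<open>s + 2 ^ i\<close> increase with \<open>i\<close>, and by continuity a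
  displacement that exceeds \<open>\<epsilon>\<close> at some time also does so at a grid point.
\<close>

lemma maximal_inequality:
  assumes s: "0 \<le> s" and \<epsilon>: "0 < \<epsilon>" and m: "\<And>t. s \<le> t \<Longrightarrow> second_moment t \<le> m"
  shows "{\<omega>\<in>space M. \<exists>t\<ge>s. \<epsilon> < norm (Z t \<omega> - Z s \<omega>)} \<in> sets M"
    and "\<epsilon>\<^sup>2 * prob {\<omega>\<in>space M. \<exists>t\<ge>s. \<epsilon> < norm (Z t \<omega> - Z s \<omega>)} \<le> m - second_moment s"
proof -
  define \<tau> where "\<tau> i k = s + real k / 2 ^ i" for i k :: nat
  define A where "A i = {\<omega>\<in>space M. \<exists>k\<le>4 ^ i. \<epsilon> < norm (Z (\<tau> i k) \<omega> - Z (\<tau> i 0) \<omega>)}" for i :: nat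
  have \<tau>0: "\<tau> i 0 = s" for i by (simp add: \<tau>_def)
  have \<tau>s: "s \<le> \<tau> i k" for i k by (simp add: \<tau>_def)
  have [measurable]: "Z (\<tau> i k) \<in> borel_measurable M" for i k
    using process_measurable order_trans[OF s \<tau>s] by auto
  have Am: "A i \<in> sets M" for i unfolding A_def by measurable
  have inc: "incseq A"
  proof (rule incseq_SucI, rule subsetI)
    fix i \<omega> assume "\<omega> \<in> A i"
    then obtain k where k: "\<omega> \<in> space M" "k \<le> 4 ^ i" "\<epsilon> < norm (Z (\<tau> i k) \<omega> - Z s \<omega>)"
      by (auto simp: A_def \<tau>0)
    have "\<tau> (Suc i) (2 * k) = \<tau> i k" by (simp add: \<tau>_def)
    then show "\<omega> \<in> A (Suc i)" using k unfolding A_def \<tau>0 by (auto intro!: exI[of _ "2 * k"])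
  qed
  have bound: "\<epsilon>\<^sup>2 * prob (A i) \<le> m - second_moment s" for i
  proof -
    have mono: "mono (\<tau> i)" by (auto intro!: monoI simp: \<tau>_def divide_right_mono)
    have "\<epsilon>\<^sup>2 * prob (A i) \<le> second_moment (\<tau> i (4 ^ i)) - second_moment (\<tau> i 0)"
      unfolding A_def by (rule discrete_maximal_inequality[OF _ mono \<epsilon>]) (simp add: \<tau>0 s)
    then show ?thesis using m[OF \<tau>s, of i "4 ^ i"] by (simp add: \<tau>0)
  qed
  have eq: "{\<omega>\<in>space M. \<exists>t\<ge>s. \<epsilon> < norm (Z t \<omega> - Z s \<omega>)} = (\<Union>i. A i)"
  proof safe
    fix \<omega> t assume w: "\<omega> \<in> space M" and t: "s \<le> t" "\<epsilon> < norm (Z t \<omega> - Z s \<omega>)"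
    have "continuous_on {0..} (\<lambda>u. norm (Z u \<omega> - Z s \<omega>))"
      by (intro continuous_intros path_continuous w)
    then have "\<exists>d>0. \<forall>u\<in>{0..}. dist u t < d \<longrightarrow>
        dist (norm (Z u \<omega> - Z s \<omega>)) (norm (Z t \<omega> - Z s \<omega>)) < norm (Z t \<omega> - Z s \<omega>) - \<epsilon>"
      using t s unfolding continuous_on_iff by auto
    then obtain d where d: "0 < d" "\<And>u. 0 \<le> u \<Longrightarrow> dist u t < d \<Longrightarrow>
        dist (norm (Z u \<omega> - Z s \<omega>)) (norm (Z t \<omega> - Z s \<omega>)) < norm (Z t \<omega> - Z s \<omega>) - \<epsilon>"
      by auto
    obtain i1 where i1: "1 / d < 2 ^ i1" using real_arch_pow[of 2 "1 / d"] by auto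
    obtain i2 where i2: "t - s + 1 < 2 ^ i2" using real_arch_pow[of 2 "t - s + 1"] by auto
    define i where "i = max i1 i2"
    have "(2::real) ^ i1 \<le> 2 ^ i" "(2::real) ^ i2 \<le> 2 ^ i" by (auto simp: i_def intro: power_increasing)
    then have i: "1 / d < 2 ^ i" "t - s + 1 < 2 ^ i" using i1 i2 by linarith+
    define k where "k = nat \<lceil>(t - s) * 2 ^ i\<rceil>"
    have kk: "(t - s) * 2 ^ i \<le> real k" "real k \<le> (t - s) * 2 ^ i + 1"
      using t(1) unfolding k_def by (auto simp: of_nat_nat intro: less_imp_le)
    have "t \<le> \<tau> i k" using kk(1) by (simp add: \<tau>_def field_simps)
    moreover have "\<tau> i k \<le> t + 1 / 2 ^ i"
      using divide_right_mono[OF kk(2), of "2 ^ i"] by (simp add: \<tau>_def add_divide_distrib)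
    moreover have "1 / 2 ^ i < d" using i(1) d(1) by (simp add: field_simps)
    ultimately have "dist (\<tau> i k) t < d" by (simp add: dist_real_def)
    from d(2)[OF order_trans[OF s \<tau>s] this] have "\<epsilon> < norm (Z (\<tau> i k) \<omega> - Z s \<omega>)"
      by (simp add: dist_real_def)
    moreover have "k \<le> 4 ^ i"
    proof -
      have one: "(1::real) \<le> 2 ^ i" by simp
      have "real k \<le> (t - s) * 2 ^ i + 2 ^ i" using kk(2) one by linarith
      also have "\<dots> = (t - s + 1) * 2 ^ i" by (simp add: algebra_simps)
      also have "\<dots> \<le> 2 ^ i * 2 ^ i" using i(2) by (intro mult_right_mono) auto
      also have "\<dots> = real (4 ^ i)" by (simp flip: power_mult_distrib)
      finally show ?thesis by (simp only: of_nat_le_iff)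
    qed
    ultimately show "\<omega> \<in> (\<Union>i. A i)" using w unfolding A_def \<tau>0 by (intro UN_I[of i]) auto
  next
    fix \<omega> i assume "\<omega> \<in> A i"
    then show "\<exists>t\<ge>s. \<epsilon> < norm (Z t \<omega> - Z s \<omega>)" using \<tau>s unfolding A_def \<tau>0 by blast
  qed (auto simp: A_def)
  show "{\<omega>\<in>space M. \<exists>t\<ge>s. \<epsilon> < norm (Z t \<omega> - Z s \<omega>)} \<in> sets M"
    unfolding eq using Am by blast
  have "(\<lambda>i. prob (A i)) \<longlonglongrightarrow> prob (\<Union>i. A i)"
    by (rule finite_Lim_measure_incseq[OF _ inc]) (use Am in auto)
  from tendsto_mult_left[OF this, of "\<epsilon>\<^sup>2"]
  show "\<epsilon>\<^sup>2 * prob {\<omega>\<in>space M. \<exists>t\<ge>s. \<epsilon> < norm (Z t \<omega> - Z s \<omega>)} \<le> m - second_moment s"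
    unfolding eq by (rule LIMSEQ_le_const2) (use bound in auto)
qed

text \<open>
  The second moment is increasing and bounded, so its growth after time \<open>n\<close> tends to 0, and the
  maximal inequality turns this into small oscillation after \<open>n\<close>.
\<close>

lemma AE_small_oscillation:
  assumes \<epsilon>: "0 < \<epsilon>"
  shows "AE \<omega> in M. \<exists>n::nat. \<forall>t\<ge>real n. norm (Z t \<omega> - Z (real n) \<omega>) \<le> \<epsilon>"
proof -
  obtain R where R: "0 \<le> R" "\<And>x. x \<in> K \<Longrightarrow> norm x \<le> R" using state_bounded by blast
  have sR: "second_moment t \<le> R\<^sup>2" if "0 \<le> t" for t
    unfolding second_moment_def
    using R stays that by (intro integral_le_const integrable_second_moment AE_I2 power_mono) auto
  have inc: "incseq (\<lambda>n. second_moment (real n))"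
    by (auto intro!: incseq_SucI second_moment_mono)
  then obtain m where m: "(\<lambda>n. second_moment (real n)) \<longlonglongrightarrow> m"
    by (rule incseq_convergent[where B="R\<^sup>2"]) (use sR in auto)
  have le: "second_moment t \<le> m" if "0 \<le> t" for t
  proof -
    obtain n where "t \<le> real n" using real_arch_simple by blast
    then show ?thesis using second_moment_mono[OF that, of "real n"] incseq_le[OF inc m, of n] by linarith
  qed
  define A where "A n = {\<omega>\<in>space M. \<exists>t\<ge>real n. \<epsilon> < norm (Z t \<omega> - Z (real n) \<omega>)}" for n :: nat
  have A: "A n \<in> sets M" "\<epsilon>\<^sup>2 * prob (A n) \<le> m - second_moment (real n)" for n
  proof -
    have le': "second_moment t \<le> m" if "real n \<le> t" for t
      using that order_trans[OF of_nat_0_le_iff that] by (intro le)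
    show "A n \<in> sets M" "\<epsilon>\<^sup>2 * prob (A n) \<le> m - second_moment (real n)"
      unfolding A_def using maximal_inequality[OF of_nat_0_le_iff \<epsilon> le'] by auto
  qed
  have "\<epsilon>\<^sup>2 * prob (\<Inter>n. A n) \<le> m - second_moment (real n)" for n
    using A(2)[of n] finite_measure_mono[OF _ A(1), of "\<Inter>n. A n" n] \<epsilon>
    by (intro order_trans[OF mult_left_mono A(2)[of n]]) auto
  moreover have "(\<lambda>n. m - second_moment (real n)) \<longlonglongrightarrow> m - m" by (intro tendsto_intros m)
  ultimately have "\<epsilon>\<^sup>2 * prob (\<Inter>n. A n) \<le> 0" by (intro LIMSEQ_le_const[where X="\<lambda>n. m - second_moment (real n)"]) auto
  then have "prob (\<Inter>n. A n) = 0"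
    using \<epsilon> by (metis antisym measure_nonneg mult_le_0_iff not_less zero_less_power)
  moreover have "(\<Inter>n. A n) \<in> sets M" using A(1) by blast
  ultimately have "(\<Inter>n. A n) \<in> null_sets M" by (simp add: emeasure_eq_measure null_sets_def)
  then show ?thesis
    by (rule AE_I') (auto simp: A_def not_le)
qed

lemma AE_convergent: "AE \<omega> in M. \<exists>l. ((\<lambda>t. Z t \<omega>) \<longlongrightarrow> l) at_top"
proof -
  have "AE \<omega> in M. \<forall>j::nat. \<exists>n::nat. \<forall>t\<ge>real n. norm (Z t \<omega> - Z (real n) \<omega>) \<le> 1 / real (Suc j)"
    unfolding AE_all_countable by (intro allI AE_small_oscillation) simp
  then show ?thesis
    by eventually_elim (rule tendsto_at_top_of_small_oscillation, blast)
qed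

text \<open>
  Taking the limit along the integers gives a measurable function on the whole space.
\<close>

definition limit :: "'a \<Rightarrow> real^'n" where
  "limit \<omega> = lim (\<lambda>n. Z (real n) \<omega>)"

lemma limit_measurable [measurable]: "limit \<in> borel_measurable M"
  unfolding limit_def[abs_def] by (rule borel_measurable_lim_metric) (auto intro: process_measurable)

lemma AE_tendsto_limit: "AE \<omega> in M. ((\<lambda>t. Z t \<omega>) \<longlongrightarrow> limit \<omega>) at_top \<and> limit \<omega> \<in> K"
  using AE_convergent AE_space
proof eventually_elim
  case (elim \<omega>)
  then obtain l where l: "((\<lambda>t. Z t \<omega>) \<longlongrightarrow> l) at_top" by blast
  have s: "(\<lambda>n. Z (real n) \<omega>) \<longlonglongrightarrow> l"
    by (rule filterlim_compose[OF l filterlim_real_sequentially])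
  then have "limit \<omega> = l" unfolding limit_def by (rule limI)
  moreover have "l \<in> K"
    by (rule closed_sequentially[OF compact_imp_closed[OF compact] _ s]) (use elim stays in auto)
  ultimately show ?case using l by simp
qed

text \<open>
  By dominated convergence the mean of \<open>|\<alpha>(Z t)|\<^sup>2\<close> tends to that of \<open>|\<alpha>(limit)|\<^sup>2\<close>. Its integral
  over \<open>[0, t]\<close> is bounded in \<open>t\<close>, so this limit is 0.
\<close>

lemma AE_limit_zero: "AE \<omega> in M. \<alpha> (limit \<omega>) = 0"
proof -
  obtain R where R: "0 \<le> R" "\<And>x. x \<in> K \<Longrightarrow> norm x \<le> R" using state_bounded by blast
  define g where "g x = indicat_real K x *\<^sub>R (norm (\<alpha> x))\<^sup>2" for x
  have c: "continuous_on K (\<lambda>x. (norm (\<alpha> x))\<^sup>2)" by (intro continuous_intros continuous_coeffs)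
  have g[measurable]: "g \<in> borel_measurable borel"
    unfolding g_def[abs_def] by (rule borel_measurable_continuous_on_indicator[OF state_space_borel c])
  obtain C where C: "0 \<le> C" "\<And>x. x \<in> K \<Longrightarrow> norm ((norm (\<alpha> x))\<^sup>2) \<le> C"
    using functional_bounded[OF c] by blast
  have gC: "norm (g x) \<le> C" for x using C(2)[of x] C(1) by (auto simp: g_def indicator_def)
  let ?e = "\<lambda>s. expectation (\<lambda>\<omega>. (norm (\<alpha> (Z s \<omega>)))\<^sup>2)"
  have [measurable]: "Z (max 0 t) \<in> borel_measurable M" for t by (rule process_measurable) simp
  have "((\<lambda>t. expectation (\<lambda>\<omega>. g (Z (max 0 t) \<omega>))) \<longlongrightarrow> expectation (\<lambda>\<omega>. g (limit \<omega>))) at_top"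
  proof (rule integral_dominated_convergence_at_top[where w="\<lambda>_. C"])
    show "AE \<omega> in M. ((\<lambda>t. g (Z (max 0 t) \<omega>)) \<longlongrightarrow> g (limit \<omega>)) at_top"
      using AE_tendsto_limit AE_space
    proof eventually_elim
      case (elim \<omega>)
      have "((\<lambda>t. (norm (\<alpha> (Z t \<omega>)))\<^sup>2) \<longlongrightarrow> (norm (\<alpha> (limit \<omega>)))\<^sup>2) at_top"
      proof (rule continuous_on_tendsto_compose[OF c])
        show "\<forall>\<^sub>F t in at_top. Z t \<omega> \<in> K"
          using eventually_ge_at_top[of 0] by eventually_elim (use elim stays in auto)
      qed (use elim in auto)
      moreover have "\<forall>\<^sub>F t in at_top. (norm (\<alpha> (Z t \<omega>)))\<^sup>2 = g (Z (max 0 t) \<omega>)"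
        using eventually_ge_at_top[of 0] by eventually_elim (use elim stays in \<open>auto simp: g_def max_def\<close>)
      moreover have "g (limit \<omega>) = (norm (\<alpha> (limit \<omega>)))\<^sup>2" using elim by (simp add: g_def)
      ultimately show ?case by (simp add: tendsto_cong)
    qed
    show "\<forall>\<^sub>F t in at_top. AE \<omega> in M. norm (g (Z (max 0 t) \<omega>)) \<le> C" using gC by simp
  qed auto
  moreover have "expectation (\<lambda>\<omega>. g (Z (max 0 t) \<omega>)) = ?e (max 0 t)" for t
    by (intro Bochner_Integration.integral_cong) (auto simp: g_def stays)
  ultimately have lim: "((\<lambda>t. ?e (max 0 t)) \<longlongrightarrow> expectation (\<lambda>\<omega>. g (limit \<omega>))) at_top" by simp
  define l where "l = expectation (\<lambda>\<omega>. g (limit \<omega>))"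
  have "l \<le> 0"
  proof (rule ccontr)
    assume "\<not> l \<le> 0"
    then have "l / 2 < l" by simp
    from order_tendstoD(1)[OF lim[folded l_def] this]
    obtain T where T: "\<And>t. T \<le> t \<Longrightarrow> l / 2 < ?e (max 0 t)" by (auto simp: eventually_at_top_linorder)
    define T' where "T' = max 0 T"
    \<comment> \<open>a time so long that the mean, being at least \<open>l / 2\<close> after \<open>T'\<close>, would exceed the energy bound\<close>
    define t where "t = T' + (8 * (2 * R)\<^sup>2 + 1) / (l / 2)"
    have T'0: "0 \<le> T'" by (simp add: T'_def)
    have tT: "T' \<le> t" using \<open>\<not> l \<le> 0\<close> by (simp add: t_def)
    have ge: "l / 2 \<le> ?e x" if "T' \<le> x" for x
      using T[of x] that by (simp add: T'_def)
    have int: "?e integrable_on {u..v}" if "0 \<le> u" for u v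
      by (intro integrable_continuous_real continuous_on_subset[OF expectation_functional_continuous[OF c]])
         (use that in auto)
    have "8 * (2 * R)\<^sup>2 + 1 = l / 2 * (t - T')" using \<open>\<not> l \<le> 0\<close> by (simp add: t_def)
    also have "\<dots> = integral {T'..t} (\<lambda>_. l / 2)" using tT by (simp add: integral_const_real)
    also have "\<dots> \<le> integral {T'..t} ?e"
      by (intro integral_le int T'0) (use ge in auto)
    also have "\<dots> \<le> integral {0..t} ?e"
      using T'0 by (intro integral_subset_le int) auto
    also have "\<dots> \<le> 8 * (2 * R + 0 * t)\<^sup>2 + 32 * 0\<^sup>2 * t"
      by (rule diffusion_energy) (use T'0 tT R in auto)
    finally show False by simp
  qed
  moreover have "0 \<le> l" unfolding l_def by (rule Bochner_Integration.integral_nonneg) (simp add: g_def)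
  ultimately have "expectation (\<lambda>\<omega>. g (limit \<omega>)) = 0" by (simp add: l_def)
  moreover have "integrable M (\<lambda>\<omega>. g (limit \<omega>))"
    by (rule integrable_const_bound[of _ C]) (use gC in auto)
  ultimately have "AE \<omega> in M. g (limit \<omega>) = 0"
    by (subst (asm) integral_nonneg_eq_0_iff_AE) (auto simp: g_def)
  with AE_tendsto_limit show ?thesis
    by eventually_elim (simp add: g_def)
qed

text \<open>
  The second identity is the conservation of the mean of a martingale, passed to the limit.
\<close>

lemma limit_distribution:
  fixes p :: "real^'n \<Rightarrow> real"
  defines "p \<equiv> \<lambda>z. prob {\<omega>\<in>space M. ((\<lambda>t. Z t \<omega>) \<longlongrightarrow> z) at_top}"
  assumes S: "S = {x\<in>K. \<alpha> x = 0}" "finite S" and x: "AE \<omega> in M. Z 0 \<omega> = x"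
  shows "(\<Sum>z\<in>S. p z) = 1" and "(\<Sum>z\<in>S. p z *\<^sub>R z) = x"
proof -
  define E where "E z = {\<omega>\<in>space M. ((\<lambda>t. Z t \<omega>) \<longlongrightarrow> z) at_top}" for z
  have E[measurable]: "E z \<in> sets M" for z unfolding E_def by (rule convergence_event)
  have lim: "AE \<omega> in M. limit \<omega> \<in> S \<and> (\<forall>z. indicat_real (E z) \<omega> = (if z = limit \<omega> then 1 else 0))"
    using AE_tendsto_limit AE_limit_zero AE_space
  proof eventually_elim
    case (elim \<omega>)
    then show ?case
      using tendsto_unique[OF trivial_limit_at_top_linorder, of "\<lambda>t. Z t \<omega>"] S
      by (auto simp: E_def indicator_def)
  qed
  have "1 = expectation (\<lambda>\<omega>. 1::real)" by (simp add: prob_space)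
  also have "\<dots> = expectation (\<lambda>\<omega>. \<Sum>z\<in>S. indicat_real (E z) \<omega>)"
  proof (rule integral_cong_AE)
    show "AE \<omega> in M. 1 = (\<Sum>z\<in>S. indicat_real (E z) \<omega>)"
      using lim by eventually_elim (simp add: S(2))
  qed auto
  also have "\<dots> = (\<Sum>z\<in>S. p z)"
    unfolding p_def E_def[symmetric]
    by (subst Bochner_Integration.integral_sum) (simp_all add: less_top[symmetric])
  finally show "(\<Sum>z\<in>S. p z) = 1" by simp
  obtain R where R: "0 \<le> R" "\<And>x. x \<in> K \<Longrightarrow> norm x \<le> R" using state_bounded by blast
  have "c \<bullet> (\<Sum>z\<in>S. p z *\<^sub>R z) = c \<bullet> x" for c
  proof -
    have mean: "expectation (\<lambda>\<omega>. c \<bullet> Z t \<omega>) = c \<bullet> x" if "0 \<le> t" for t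
    proof -
      have [measurable]: "Z 0 \<in> borel_measurable M" by (rule process_measurable) simp
      have "expectation (\<lambda>\<omega>. c \<bullet> Z t \<omega>) = expectation (\<lambda>\<omega>. c \<bullet> Z 0 \<omega>)"
        using mean_increment[OF order_refl that, of c] by simp
      also have "\<dots> = expectation (\<lambda>\<omega>. c \<bullet> x)"
        by (rule integral_cong_AE) (use x in \<open>auto elim!: eventually_mono\<close>)
      finally show ?thesis by (simp add: prob_space)
    qed
    have "(\<lambda>n. expectation (\<lambda>\<omega>. c \<bullet> Z (real n) \<omega>)) \<longlonglongrightarrow> expectation (\<lambda>\<omega>. c \<bullet> limit \<omega>)"
    proof (rule integral_dominated_convergence[where w="\<lambda>_. norm c * R"])
      show "AE \<omega> in M. (\<lambda>n. c \<bullet> Z (real n) \<omega>) \<longlonglongrightarrow> c \<bullet> limit \<omega>"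
        using AE_tendsto_limit
        by eventually_elim (auto intro!: tendsto_inner filterlim_compose[OF _ filterlim_real_sequentially])
      show "AE \<omega> in M. norm (c \<bullet> Z (real n) \<omega>) \<le> norm c * R" for n
      proof (rule AE_I2)
        fix \<omega> assume "\<omega> \<in> space M"
        then have "norm c * norm (Z (real n) \<omega>) \<le> norm c * R"
          using R stays by (intro mult_left_mono) auto
        then show "norm (c \<bullet> Z (real n) \<omega>) \<le> norm c * R"
          using Cauchy_Schwarz_ineq2[of c "Z (real n) \<omega>"] by simp
      qed
    qed (auto intro!: borel_measurable_inner process_measurable)
    then have "c \<bullet> x = expectation (\<lambda>\<omega>. c \<bullet> limit \<omega>)"
      by (simp add: mean LIMSEQ_const_iff)
    also have "\<dots> = expectation (\<lambda>\<omega>. \<Sum>z\<in>S. indicat_real (E z) \<omega> * (c \<bullet> z))"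
    proof (rule integral_cong_AE)
      show "AE \<omega> in M. c \<bullet> limit \<omega> = (\<Sum>z\<in>S. indicat_real (E z) \<omega> * (c \<bullet> z))"
        using lim by eventually_elim (simp add: S(2) if_distrib[where f="\<lambda>u. u * _"] cong: if_cong)
    qed auto
    also have "\<dots> = c \<bullet> (\<Sum>z\<in>S. p z *\<^sub>R z)"
      unfolding p_def E_def[symmetric]
      by (subst Bochner_Integration.integral_sum)
         (simp_all add: less_top[symmetric] inner_sum_right)
    finally show ?thesis by simp
  qed
  note inner_eq = this
  define w where "w = (\<Sum>z\<in>S. p z *\<^sub>R z) - x"
  have "w \<bullet> w = w \<bullet> (\<Sum>z\<in>S. p z *\<^sub>R z) - w \<bullet> x"
    using inner_diff_right[of w "\<Sum>z\<in>S. p z *\<^sub>R z" x, folded w_def] .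
  then have "w \<bullet> w = 0" by (simp only: inner_eq diff_self)
  then have "w = 0" by (simp only: inner_eq_zero_iff)
  then have "(\<Sum>z\<in>S. p z *\<^sub>R z) - x = 0" unfolding w_def .
  then show "(\<Sum>z\<in>S. p z *\<^sub>R z) = x" by simp
qed

end

section \<open>Barycentric coordinates\<close>

text \<open>
  Moving another point of \<open>S\<close> to the origin makes the remaining points linearly independent, and a
  linear functional can be prescribed on them.
\<close>

lemma affine_coordinate_exists:
  fixes S :: "'b::euclidean_space set"
  assumes S: "\<not> affine_dependent S" and z: "z \<in> S"
  shows "\<exists>g c. \<forall>y\<in>S. g \<bullet> y + c = (if y = z then 1 else 0)"
proof (cases "S = {z}")
  case True
  then show ?thesis by (intro exI[of _ 0] exI[of _ 1]) auto
next
  case False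
  then obtain o' where o': "o' \<in> S" "o' \<noteq> z" using z by blast
  let ?B = "{x - o' |x. x \<in> S - {o'}}"
  have "independent ?B"
    using dependent_imp_affine_dependent[of o' "S - {o'}"] S o' by (auto simp: insert_absorb)
  then obtain f :: "'b \<Rightarrow> real" where f: "linear f" "\<forall>x\<in>?B. f x = (if x = z - o' then 1 else 0)"
    using linear_independent_extend[of ?B "\<lambda>v. if v = z - o' then 1 else 0"] by blast
  have lin: "adjoint f 1 \<bullet> x = f x" for x
    using adjoint_works[OF f(1), of x 1] by (simp add: inner_commute)
  have "adjoint f 1 \<bullet> y + - f o' = (if y = z then 1 else 0)" if "y \<in> S" for y
  proof (cases "y = o'")
    case True
    then show ?thesis using o' by (simp add: lin)
  next
    case False
    then have "y - o' \<in> ?B" using that by blast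
    then have "f (y - o') = (if y - o' = z - o' then 1 else 0)" using f(2) by blast
    then show ?thesis by (simp add: lin linear_diff[OF f(1)])
  qed
  then show ?thesis by blast
qed

lemma inner_const_on_affine_basis:
  fixes S :: "'b::euclidean_space set"
  assumes S: "\<not> affine_dependent S" "card S = Suc DIM('b)" and d: "\<And>y. y \<in> S \<Longrightarrow> d \<bullet> y = k"
  shows "d = 0"
proof -
  have "affine hull S \<subseteq> {y. d \<bullet> y = k}"
    by (rule hull_minimal) (use d affine_hyperplane in auto)
  then have "d \<bullet> y = k" for y using affine_independent_span_eq[OF S] by auto
  from this[of 0] this[of d] show ?thesis by simp
qed

text \<open>
  Two candidate gradients differ by a vector orthogonal to \<open>y - x\<close> for all \<open>y\<close> in the convex set
  \<open>K\<close>, in particular to the differences of points of \<open>S\<close>, which span the space. This argument also covers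
  boundary points \<open>x\<close>.
\<close>

lemma gradient_within_affine:
  fixes K S :: "(real^'n) set"
  assumes K: "convex K" "S \<subseteq> K" "x \<in> K"
    and S: "\<not> affine_dependent S" "card S = CARD('n) + 1"
    and h: "\<And>y. y \<in> K \<Longrightarrow> h y = g \<bullet> y + c"
  shows "gradient_within K h x = g"
  unfolding gradient_within_def
proof (rule the_equality)
  have "((\<lambda>y. g \<bullet> y + c) has_derivative (\<lambda>v. g \<bullet> v)) (at x within K)"
    by (auto intro!: derivative_eq_intros)
  then show D: "(h has_derivative (\<lambda>v. g \<bullet> v)) (at x within K)"
    by (rule has_derivative_transform[OF K(3), rotated]) (use h in auto)
  fix g' assume "(h has_derivative (\<lambda>v. g' \<bullet> v)) (at x within K)"
  from has_derivative_diff[OF this D]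
  have D0: "((\<lambda>_. 0) has_derivative (\<lambda>v. (g' - g) \<bullet> v)) (at x within K)"
    by (simp add: inner_diff_left)
  have zero: "(g' - g) \<bullet> (y - x) = 0" if y: "y \<in> K" for y
  proof (cases "y = x")
    case False
    have "\<bar>(g' - g) \<bullet> (y - x)\<bar> \<le> e * norm (y - x)" if e: "0 < e" for e
    proof -
      obtain d where d: "0 < d" "\<And>w. w \<in> K \<Longrightarrow> norm (w - x) < d \<Longrightarrow> \<bar>(g' - g) \<bullet> (w - x)\<bar> \<le> e * norm (w - x)"
        using D0 e unfolding has_derivative_within_alt by auto
      define u where "u = min 1 (d / (2 * norm (y - x)))"
      have u: "0 < u" "u \<le> 1" using d(1) False by (auto simp: u_def)
      have "u * norm (y - x) \<le> d / (2 * norm (y - x)) * norm (y - x)"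
        by (intro mult_right_mono) (auto simp: u_def)
      then have "u * norm (y - x) < d" using d(1) False by simp
      moreover have "x + u *\<^sub>R (y - x) \<in> K"
        using convexD_alt[OF K(1) K(3) y, of u] u by (simp add: algebra_simps)
      ultimately have "\<bar>(g' - g) \<bullet> (u *\<^sub>R (y - x))\<bar> \<le> e * norm (u *\<^sub>R (y - x))"
        using d(2)[of "x + u *\<^sub>R (y - x)"] u by simp
      then have "u * \<bar>(g' - g) \<bullet> (y - x)\<bar> \<le> u * (e * norm (y - x))"
        using u by (simp only: inner_scaleR_right abs_mult norm_scaleR) (simp add: mult_ac)
      then show ?thesis using u by simp
    qed
    note le = this
    have "\<bar>(g' - g) \<bullet> (y - x)\<bar> \<le> 0"
    proof (rule field_le_epsilon)
      fix e :: real assume "0 < e"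
      then show "\<bar>(g' - g) \<bullet> (y - x)\<bar> \<le> 0 + e" using le[of "e / norm (y - x)"] False by simp
    qed
    then show ?thesis by simp
  qed simp
  have "g' - g = 0"
  proof (rule inner_const_on_affine_basis[OF S(1)])
    show "card S = Suc DIM(real^'n)" using S(2) by simp
    show "(g' - g) \<bullet> y = (g' - g) \<bullet> x" if "y \<in> S" for y
      using zero[of y] that K(2) by (auto simp: inner_diff_right)
  qed
  then show "g' = g" by simp
qed

locale barycentric =
  fixes S K :: "'b::euclidean_space set" and g :: "'b \<Rightarrow> 'b" and c :: "'b \<Rightarrow> real"
  assumes finite_vertices: "finite S" and vertices_subset: "S \<subseteq> K"
    and coordinate_vertex: "y \<in> S \<Longrightarrow> z \<in> S \<Longrightarrow> g z \<bullet> y + c z = (if y = z then 1 else 0)"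
    and coordinate_nonneg: "x \<in> K \<Longrightarrow> z \<in> S \<Longrightarrow> 0 \<le> g z \<bullet> x + c z"
    and coordinate_sum: "x \<in> K \<Longrightarrow> (\<Sum>z\<in>S. g z \<bullet> x + c z) = 1"
    and coordinate_combine: "x \<in> K \<Longrightarrow> (\<Sum>z\<in>S. (g z \<bullet> x + c z) *\<^sub>R z) = x"
begin

definition coordinate :: "'b \<Rightarrow> 'b \<Rightarrow> real" where "coordinate z x = g z \<bullet> x + c z"

text \<open>
  The variance of the probability distribution on \<open>S\<close> whose weights are the coordinates of \<open>x\<close>.
\<close>

definition spread :: "'b \<Rightarrow> real" where
  "spread x = (\<Sum>z\<in>S. coordinate z x * (norm (z - x))\<^sup>2)"

lemmas coordinates = coordinate_vertex[folded coordinate_def] coordinate_nonneg[folded coordinate_def]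
  coordinate_sum[folded coordinate_def] coordinate_combine[folded coordinate_def]

lemma continuous_coordinate: "continuous_on X (coordinate z)"
  unfolding coordinate_def[abs_def] by (intro continuous_intros)

lemma continuous_spread: "continuous_on X spread"
  unfolding spread_def[abs_def] by (intro continuous_intros continuous_coordinate)

lemma spread_nonneg: "x \<in> K \<Longrightarrow> 0 \<le> spread x"
  unfolding spread_def by (intro sum_nonneg mult_nonneg_nonneg coordinates) auto

lemma spread_vertex: "y \<in> S \<Longrightarrow> spread y = 0"
  unfolding spread_def by (intro sum.neutral) (auto simp: coordinates)

lemma spread_eq:
  assumes x: "x \<in> K"
  shows "spread x = (\<Sum>z\<in>S. (norm z)\<^sup>2 * coordinate z x) - (norm x)\<^sup>2"
proof -
  have "spread x = (\<Sum>z\<in>S. (norm z)\<^sup>2 * coordinate z x - 2 * (x \<bullet> (coordinate z x *\<^sub>R z)) + coordinate z x * (norm x)\<^sup>2)"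
    unfolding spread_def
    by (intro sum.cong refl) (simp add: power2_norm_eq_inner inner_diff_left inner_diff_right inner_commute algebra_simps)
  also have "\<dots> = (\<Sum>z\<in>S. (norm z)\<^sup>2 * coordinate z x) - 2 * (x \<bullet> (\<Sum>z\<in>S. coordinate z x *\<^sub>R z))
      + (\<Sum>z\<in>S. coordinate z x) * (norm x)\<^sup>2"
    by (simp add: sum.distrib sum_subtractf inner_sum_right sum_distrib_left sum_distrib_right)
  also have "\<dots> = (\<Sum>z\<in>S. (norm z)\<^sup>2 * coordinate z x) - (norm x)\<^sup>2"
    using x by (simp add: coordinates power2_norm_eq_inner)
  finally show ?thesis .
qed

text \<open>
  The error is an average of \<open>|h x - h z| \<le> L * |z - x|\<close> over the barycentric weights. Bounding
  \<open>|z - x|\<close> by \<open>\<epsilon> + |z - x|\<^sup>2 / \<epsilon>\<close> avoids a square root of the spread, so that the estimate can be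
  integrated directly.
\<close>

lemma lipschitz_interpolation_error:
  fixes h :: "'b \<Rightarrow> 'c::real_normed_vector"
  assumes h: "L-lipschitz_on K h" and x: "x \<in> K" and \<epsilon>: "0 < \<epsilon>"
  shows "norm (h x - (\<Sum>z\<in>S. coordinate z x *\<^sub>R h z)) \<le> L * (\<epsilon> + spread x / \<epsilon>)"
proof -
  have L: "0 \<le> L" using h by (rule lipschitz_on_nonneg)
  have "h x - (\<Sum>z\<in>S. coordinate z x *\<^sub>R h z) = (\<Sum>z\<in>S. coordinate z x *\<^sub>R (h x - h z))"
    using x by (simp add: scaleR_diff_right sum_subtractf scaleR_sum_left[symmetric] coordinates)
  also have "norm \<dots> \<le> (\<Sum>z\<in>S. L * (coordinate z x * \<epsilon> + coordinate z x * (norm (z - x))\<^sup>2 / \<epsilon>))"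
  proof (rule sum_norm_le)
    fix z assume z: "z \<in> S"
    have "norm (h x - h z) \<le> L * norm (z - x)"
      using lipschitz_onD[OF h x, of z] z vertices_subset by (auto simp: dist_norm norm_minus_commute)
    also have "norm (z - x) \<le> \<epsilon> + (norm (z - x))\<^sup>2 / \<epsilon>" by (rule le_add_square_divide[OF \<epsilon>])
    finally have "norm (h x - h z) \<le> L * (\<epsilon> + (norm (z - x))\<^sup>2 / \<epsilon>)" using L by (simp add: mult_left_mono)
    then have "coordinate z x * norm (h x - h z) \<le> coordinate z x * (L * (\<epsilon> + (norm (z - x))\<^sup>2 / \<epsilon>))"
      using coordinates(2)[OF x z] by (rule mult_left_mono)
    also have "coordinate z x * (L * (\<epsilon> + (norm (z - x))\<^sup>2 / \<epsilon>))
        = L * (coordinate z x * \<epsilon> + coordinate z x * (norm (z - x))\<^sup>2 / \<epsilon>)"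
      by (simp add: algebra_simps)
    finally show "norm (coordinate z x *\<^sub>R (h x - h z))
        \<le> L * (coordinate z x * \<epsilon> + coordinate z x * (norm (z - x))\<^sup>2 / \<epsilon>)"
      using coordinates(2)[OF x z] by (simp only: norm_scaleR abs_of_nonneg)
  qed
  also have "\<dots> = L * ((\<Sum>z\<in>S. coordinate z x) * \<epsilon> + spread x / \<epsilon>)"
    unfolding spread_def
    by (simp add: sum_distrib_left[symmetric] sum.distrib sum_distrib_right[symmetric] sum_divide_distrib[symmetric])
  also have "\<dots> = L * (\<epsilon> + spread x / \<epsilon>)" using x by (simp add: coordinates)
  finally show ?thesis .
qed

text \<open>
  On the compact set where the spread is at least \<open>\<epsilon>\<close> the function \<open>s\<close> has no zero, hence is
  bounded away from 0.
\<close>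

lemma spread_le_of_zero_set:
  fixes s :: "'b \<Rightarrow> 'c::real_normed_vector"
  assumes K: "compact K" and s: "continuous_on K s" "\<And>x. x \<in> K \<Longrightarrow> s x = 0 \<Longrightarrow> x \<in> S" and \<epsilon>: "0 < \<epsilon>"
  obtains C where "0 \<le> C" "\<And>x. x \<in> K \<Longrightarrow> spread x \<le> \<epsilon> + C * (norm (s x))\<^sup>2"
proof -
  let ?K' = "K \<inter> spread -` {\<epsilon>..}"
  have "compact ?K'"
    by (rule compact_Int_closed[OF K]) (rule continuous_closed_vimage, simp, use continuous_spread continuous_on_eq_continuous_at in blast)
  show ?thesis
  proof (cases "?K' = {}")
    case True
    then show ?thesis by (intro that[of 0]) (auto simp: not_le less_imp_le)
  next
    case False
    have c1: "continuous_on ?K' (\<lambda>x. norm (s x))"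
      by (rule continuous_on_subset[of K]) (auto intro: continuous_intros s)
    obtain x0 where x0: "x0 \<in> ?K'" "\<And>x. x \<in> ?K' \<Longrightarrow> norm (s x0) \<le> norm (s x)"
      using continuous_attains_inf[OF \<open>compact ?K'\<close> False c1] by blast
    obtain x1 where x1: "x1 \<in> ?K'" "\<And>x. x \<in> ?K' \<Longrightarrow> spread x \<le> spread x1"
      using continuous_attains_sup[OF \<open>compact ?K'\<close> False continuous_spread] by blast
    have "s x0 \<noteq> 0" using x0(1) s(2)[of x0] spread_vertex[of x0] \<epsilon> by auto
    then have m: "0 < (norm (s x0))\<^sup>2" by simp
    define C where "C = spread x1 / (norm (s x0))\<^sup>2"
    have C0: "0 \<le> C" using x1(1) spread_nonneg[of x1] by (simp add: C_def)
    show ?thesis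
    proof (rule that[OF C0])
      fix x assume x: "x \<in> K"
      show "spread x \<le> \<epsilon> + C * (norm (s x))\<^sup>2"
      proof (cases "\<epsilon> \<le> spread x")
        case True
        then have x': "x \<in> ?K'" using x by simp
        have "spread x \<le> C * (norm (s x0))\<^sup>2" using x1(2)[OF x'] m by (simp add: C_def)
        also have "\<dots> \<le> C * (norm (s x))\<^sup>2" using x0(2)[OF x'] C0 by (intro mult_left_mono power_mono) auto
        finally show ?thesis using \<epsilon> by linarith
      next
        case False
        then show ?thesis using C0 by (intro add_increasing2) auto
      qed
    qed
  qed
qed

end

section \<open>Concentration on the vertices\<close>

locale solution_in_simplex = bounded_solution M F W B \<alpha> \<kappa> \<beta> Z K + barycentric S K g c
  for M :: "'a measure" and F W B \<alpha> \<kappa> \<beta> Z and K S :: "(real^'n) set" and g c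
begin

definition mean_coordinate :: "real^'n \<Rightarrow> real \<Rightarrow> real" where
  "mean_coordinate z s = expectation (\<lambda>\<omega>. coordinate z (Z s \<omega>))"

definition mean_spread :: "real \<Rightarrow> real" where
  "mean_spread s = expectation (\<lambda>\<omega>. spread (Z s \<omega>))"

definition mean_rate :: "real^'n \<Rightarrow> real \<Rightarrow> real" where
  "mean_rate z s = expectation (\<lambda>\<omega>. g z \<bullet> \<beta> (Z s \<omega>))"

lemma integrable_spread: "0 \<le> s \<Longrightarrow> integrable M (\<lambda>\<omega>. spread (Z s \<omega>))"
  by (rule functional_integrable[OF continuous_spread])

lemma integrable_coordinate: "0 \<le> s \<Longrightarrow> integrable M (\<lambda>\<omega>. coordinate z (Z s \<omega>))"
  by (rule functional_integrable[OF continuous_coordinate])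

lemma continuous_rate: "continuous_on K (\<lambda>x. g z \<bullet> \<beta> x)"
  by (intro continuous_intros continuous_coeffs)

lemma mean_spread_nonneg: "0 \<le> s \<Longrightarrow> 0 \<le> mean_spread s"
  unfolding mean_spread_def by (intro integral_nonneg_AE AE_I2 spread_nonneg stays)

lemma continuous_mean_spread: "continuous_on {0..} mean_spread"
  unfolding mean_spread_def[abs_def] by (rule expectation_functional_continuous[OF continuous_spread])

lemma continuous_mean_rate: "continuous_on {0..} (mean_rate z)"
  unfolding mean_rate_def[abs_def] by (rule expectation_functional_continuous[OF continuous_rate])

lemma continuous_mean_coordinate: "continuous_on {0..} (mean_coordinate z)"
  unfolding mean_coordinate_def[abs_def] by (rule expectation_functional_continuous[OF continuous_coordinate])

lemma mean_coordinate_nonneg: "0 \<le> s \<Longrightarrow> z \<in> S \<Longrightarrow> 0 \<le> mean_coordinate z s"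
  unfolding mean_coordinate_def by (intro integral_nonneg_AE AE_I2 coordinates stays)

lemma mean_coordinate_increment:
  assumes "0 \<le> s" "s \<le> t"
  shows "mean_coordinate z t - mean_coordinate z s = integral {s..t} (mean_rate z)"
proof -
  have i: "integrable M (\<lambda>\<omega>. g z \<bullet> Z r \<omega>)" if "0 \<le> r" for r
    by (rule functional_integrable[OF _ that]) (intro continuous_intros)
  have "mean_coordinate z r = expectation (\<lambda>\<omega>. g z \<bullet> Z r \<omega>) + c z" if "0 \<le> r" for r
    unfolding mean_coordinate_def coordinate_def using i[OF that] by (simp add: prob_space)
  then show ?thesis
    using mean_increment[OF assms, of "g z"] assms by (simp add: mean_rate_def[abs_def])
qed

text \<open>
  The spread is affine minus the squared norm. The affine part moves only by the drift, and the second
  moment decreases at most at a bounded rate.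
\<close>

lemma mean_spread_increment:
  assumes st: "0 \<le> s" "s \<le> t"
    and R: "\<And>x. x \<in> K \<Longrightarrow> norm x \<le> R" and C: "\<And>x. x \<in> K \<Longrightarrow> norm (\<beta> x) \<le> C"
  shows "mean_spread t \<le> mean_spread s + ((\<Sum>z\<in>S. (norm z)\<^sup>2 * norm (g z)) + 2 * R) * C * (t - s)"
proof -
  have c: "continuous_on K (\<lambda>x. (norm x)\<^sup>2)" by (intro continuous_intros)
  have eq: "mean_spread r = (\<Sum>z\<in>S. (norm z)\<^sup>2 * mean_coordinate z r) - expectation (\<lambda>\<omega>. (norm (Z r \<omega>))\<^sup>2)"
    if "0 \<le> r" for r
  proof -
    have "mean_spread r = expectation (\<lambda>\<omega>. (\<Sum>z\<in>S. (norm z)\<^sup>2 * coordinate z (Z r \<omega>)) - (norm (Z r \<omega>))\<^sup>2)"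
      unfolding mean_spread_def
      by (intro Bochner_Integration.integral_cong refl spread_eq stays that)
    also have "\<dots> = (\<Sum>z\<in>S. (norm z)\<^sup>2 * mean_coordinate z r) - expectation (\<lambda>\<omega>. (norm (Z r \<omega>))\<^sup>2)"
      unfolding mean_coordinate_def
      using integrable_coordinate[OF that] functional_integrable[OF c that]
      by (subst Bochner_Integration.integral_diff) (auto simp: Bochner_Integration.integral_sum)
    finally show ?thesis .
  qed
  have rate: "mean_coordinate z t - mean_coordinate z s \<le> norm (g z) * C * (t - s)" for z
  proof -
    have "norm (mean_rate z r) \<le> norm (g z) * C" if "r \<in> {s..t}" for r
    proof -
      have "norm (mean_rate z r) \<le> expectation (\<lambda>\<omega>. norm (g z \<bullet> \<beta> (Z r \<omega>)))"
        unfolding mean_rate_def by (rule integral_norm_bound)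
      also have "\<dots> \<le> norm (g z) * C"
      proof (rule integral_le_const)
        show "integrable M (\<lambda>\<omega>. norm (g z \<bullet> \<beta> (Z r \<omega>)))"
          using functional_integrable[OF continuous_rate, of r] that st by auto
        show "AE \<omega> in M. norm (g z \<bullet> \<beta> (Z r \<omega>)) \<le> norm (g z) * C"
        proof (rule AE_I2)
          fix \<omega> assume "\<omega> \<in> space M"
          then have "norm (g z) * norm (\<beta> (Z r \<omega>)) \<le> norm (g z) * C"
            using C stays that st by (intro mult_left_mono) auto
          then show "norm (g z \<bullet> \<beta> (Z r \<omega>)) \<le> norm (g z) * C"
            using Cauchy_Schwarz_ineq2[of "g z" "\<beta> (Z r \<omega>)"] by simp
        qed
      qed
      finally show ?thesis .
    qed
    then have "norm (integral {s..t} (mean_rate z)) \<le> norm (g z) * C * (t - s)"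
      using st by (intro integral_bound continuous_on_subset[OF continuous_mean_rate]) auto
    then show ?thesis using mean_coordinate_increment[OF st, of z] by simp
  qed
  have "mean_spread t - mean_spread s
      = (\<Sum>z\<in>S. (norm z)\<^sup>2 * (mean_coordinate z t - mean_coordinate z s))
        + (expectation (\<lambda>\<omega>. (norm (Z s \<omega>))\<^sup>2) - expectation (\<lambda>\<omega>. (norm (Z t \<omega>))\<^sup>2))"
    using st by (simp add: eq right_diff_distrib sum_subtractf)
  also have "\<dots> \<le> (\<Sum>z\<in>S. (norm z)\<^sup>2 * (norm (g z) * C * (t - s))) + 2 * R * C * (t - s)"
    using second_moment_increment[OF st R C]
    by (intro add_mono sum_mono mult_left_mono rate) auto
  also have "\<dots> = ((\<Sum>z\<in>S. (norm z)\<^sup>2 * norm (g z)) + 2 * R) * C * (t - s)"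
    by (simp add: sum_distrib_right distrib_right mult.assoc)
  finally show ?thesis by simp
qed

text \<open>
  The value at \<open>t\<close> is compared with the values on \<open>[t - h, t]\<close> and averaged over this interval.
\<close>

lemma mean_spread_le_average:
  assumes h: "0 < h" "h \<le> t"
    and inc: "\<And>s. 0 \<le> s \<Longrightarrow> s \<le> t \<Longrightarrow> mean_spread t \<le> mean_spread s + C * (t - s)" and C: "0 \<le> C"
  shows "mean_spread t \<le> C * h + integral {0..t} mean_spread / h"
proof -
  have int: "mean_spread integrable_on {u..t}" if "0 \<le> u" for u
    by (intro integrable_continuous_real continuous_on_subset[OF continuous_mean_spread]) (use that in auto)
  have "h * (mean_spread t - C * h) = integral {t - h..t} (\<lambda>_. mean_spread t - C * h)"
    using h by (simp add: integral_const_real)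
  also have "\<dots> \<le> integral {t - h..t} mean_spread"
  proof (rule integral_le)
    fix s assume s: "s \<in> {t - h..t}"
    then have "C * (t - s) \<le> C * h" using C by (intro mult_left_mono) auto
    then show "mean_spread t - C * h \<le> mean_spread s" using inc[of s] s h by auto
  qed (use h int in auto)
  also have "\<dots> \<le> integral {0..t} mean_spread"
    using h int by (intro integral_subset_le) (auto intro: mean_spread_nonneg)
  finally show ?thesis using h by (simp add: field_simps)
qed

text \<open>
  The factor \<open>1 / \<gamma>\<close> comes from the energy bound, which controls \<open>\<gamma> * |\<sigma>|\<^sup>2\<close>.
\<close>

lemma integral_mean_spread_le:
  assumes \<gamma>: "0 < \<gamma>" and \<alpha>: "\<And>x. \<alpha> x = sqrt \<gamma> *\<^sub>R \<sigma> x" and \<sigma>: "continuous_on K \<sigma>"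
    and le: "\<And>x. x \<in> K \<Longrightarrow> spread x \<le> \<delta> + C * (norm (\<sigma> x))\<^sup>2" and C: "0 \<le> C" and t: "0 \<le> t"
    and energy: "integral {0..t} (\<lambda>s. expectation (\<lambda>\<omega>. (norm (\<alpha> (Z s \<omega>)))\<^sup>2)) \<le> E"
  shows "integral {0..t} mean_spread \<le> \<delta> * t + C * E / \<gamma>"
proof -
  let ?e = "\<lambda>s. expectation (\<lambda>\<omega>. (norm (\<sigma> (Z s \<omega>)))\<^sup>2)"
  have c: "continuous_on K (\<lambda>x. (norm (\<sigma> x))\<^sup>2)" by (intro continuous_intros \<sigma>)
  have ei: "?e integrable_on {0..t}"
    by (intro integrable_continuous_real continuous_on_subset[OF expectation_functional_continuous[OF c]]) auto
  have Cei: "(\<lambda>s. C * ?e s) integrable_on {0..t}"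
    using integrable_cmul[OF ei, of C] by simp
  have "integral {0..t} (\<lambda>s. expectation (\<lambda>\<omega>. (norm (\<alpha> (Z s \<omega>)))\<^sup>2)) = integral {0..t} (\<lambda>s. \<gamma> * ?e s)"
    using \<gamma> by (simp add: \<alpha> power_mult_distrib)
  then have "\<gamma> * integral {0..t} ?e \<le> E" using energy by simp
  then have e: "integral {0..t} ?e \<le> E / \<gamma>" using \<gamma> by (simp add: field_simps)
  have "integral {0..t} mean_spread \<le> integral {0..t} (\<lambda>s. \<delta> + C * ?e s)"
  proof (rule integral_le)
    show "mean_spread integrable_on {0..t}"
      by (intro integrable_continuous_real continuous_on_subset[OF continuous_mean_spread]) auto
    show "(\<lambda>s. \<delta> + C * ?e s) integrable_on {0..t}"
      by (intro integrable_add Cei) auto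
    fix s assume s: "s \<in> {0..t}"
    have "mean_spread s \<le> expectation (\<lambda>\<omega>. \<delta> + C * (norm (\<sigma> (Z s \<omega>)))\<^sup>2)"
      unfolding mean_spread_def
      using s by (intro integral_mono integrable_spread le stays Bochner_Integration.integrable_add
        Bochner_Integration.integrable_mult_right functional_integrable[OF c]) auto
    also have "\<dots> = \<delta> + C * ?e s"
      using functional_integrable[OF c, of s] s by (simp add: prob_space)
    finally show "mean_spread s \<le> \<delta> + C * ?e s" .
  qed
  also have "\<dots> = \<delta> * t + C * integral {0..t} ?e"
    using t ei by (subst Henstock_Kurzweil_Integration.integral_add)
      (auto simp: integral_const_real mult.commute intro!: Cei)
  also have "\<dots> \<le> \<delta> * t + C * (E / \<gamma>)" using e C by (intro add_left_mono mult_left_mono)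
  finally show ?thesis by simp
qed

end

section \<open>Finite Markov semigroups\<close>

locale finite_semigroup =
  fixes S :: "'s set" and L :: "'s \<Rightarrow> 's \<Rightarrow> real" and P :: "real \<Rightarrow> 's \<Rightarrow> 's \<Rightarrow> real"
  assumes finite_states: "finite S" and semigroup: "markov_semigroup S L P"
begin

lemma P_nonneg: "0 \<le> t \<Longrightarrow> x \<in> S \<Longrightarrow> z \<in> S \<Longrightarrow> 0 \<le> P t x z"
  and P_sum: "0 \<le> t \<Longrightarrow> x \<in> S \<Longrightarrow> (\<Sum>z\<in>S. P t x z) = 1"
  and P_zero: "x \<in> S \<Longrightarrow> z \<in> S \<Longrightarrow> P 0 x z = (if x = z then 1 else 0)"
  and P_add: "0 \<le> s \<Longrightarrow> 0 \<le> t \<Longrightarrow> x \<in> S \<Longrightarrow> z \<in> S \<Longrightarrow> P (s + t) x z = (\<Sum>y\<in>S. P s x y * P t y z)"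
  and P_rate: "x \<in> S \<Longrightarrow> z \<in> S \<Longrightarrow> ((\<lambda>t. (P t x z - P 0 x z) / t) \<longlongrightarrow> L x z) (at_right 0)"
  using semigroup unfolding markov_semigroup_def probability_vector_def by blast+

lemma P_le_1: "0 \<le> t \<Longrightarrow> x \<in> S \<Longrightarrow> z \<in> S \<Longrightarrow> P t x z \<le> 1"
  using member_le_sum[of z S "P t x"] P_nonneg P_sum finite_states by simp

lemma P_increment:
  assumes "0 \<le> h" "0 \<le> u" "x \<in> S" "z \<in> S"
  shows "P (h + u) x z - P u x z = (\<Sum>y\<in>S. (P h x y - P 0 x y) * P u y z)"
  using P_add[OF assms] P_add[OF order_refl assms(2-4)] by (simp add: left_diff_distrib sum_subtractf)

lemma P_right_zero:
  assumes "x \<in> S" "y \<in> S"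
  shows "((\<lambda>h. P h x y - P 0 x y) \<longlongrightarrow> 0) (at_right 0)"
proof -
  have "((\<lambda>h. h * ((P h x y - P 0 x y) / h)) \<longlongrightarrow> 0 * L x y) (at_right 0)"
    by (intro tendsto_mult P_rate assms tendsto_ident_at)
  moreover have "\<forall>\<^sub>F h in at_right (0::real). h * ((P h x y - P 0 x y) / h) = P h x y - P 0 x y"
    using eventually_at_right_less[of "0::real"] by eventually_elim simp
  ultimately show ?thesis by (simp add: tendsto_cong)
qed

text \<open>
  The semigroup is differentiated at 0 from the right only. Writing \<open>P u = P h P (u - h)\<close> transfers
  this to the left of \<open>u\<close>.
\<close>

lemma P_left_continuous:
  assumes u: "0 < u" and xz: "x \<in> S" "z \<in> S"
  shows "((\<lambda>h. P (u - h) x z) \<longlongrightarrow> P u x z) (at_right 0)"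
proof -
  have "((\<lambda>h. P (u - h) x z - P u x z) \<longlongrightarrow> 0) (at_right 0)"
  proof (rule Lim_null_comparison)
    show "\<forall>\<^sub>F h in at_right 0. norm (P (u - h) x z - P u x z) \<le> (\<Sum>y\<in>S. \<bar>P h x y - P 0 x y\<bar>)"
      using eventually_at_right_less[of "0::real"] eventually_at_right_real[OF u]
    proof eventually_elim
      case (elim h)
      have "P (u - h) x z - P u x z = - (\<Sum>y\<in>S. (P h x y - P 0 x y) * P (u - h) y z)"
        using P_increment[of h "u - h" x z] elim xz by simp
      then have "norm (P (u - h) x z - P u x z) \<le> (\<Sum>y\<in>S. \<bar>P h x y - P 0 x y\<bar> * P (u - h) y z)"
        using elim xz sum_abs[of "\<lambda>y. (P h x y - P 0 x y) * P (u - h) y z" S]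
        by (simp add: abs_mult P_nonneg)
      also have "\<dots> \<le> (\<Sum>y\<in>S. \<bar>P h x y - P 0 x y\<bar> * 1)"
        using elim xz by (intro sum_mono mult_left_mono P_le_1) auto
      finally show ?case by simp
    qed
    have "((\<lambda>h. \<Sum>y\<in>S. \<bar>P h x y - P 0 x y\<bar>) \<longlongrightarrow> (\<Sum>y\<in>S. \<bar>0\<bar>)) (at_right 0)"
      by (intro tendsto_sum tendsto_rabs P_right_zero xz)
    then show "((\<lambda>h. \<Sum>y\<in>S. \<bar>P h x y - P 0 x y\<bar>) \<longlongrightarrow> 0) (at_right 0)" by simp
  qed
  then show ?thesis by (simp add: Lim_null[symmetric])
qed

lemma backward_equation:
  assumes u: "0 < u" and xz: "x \<in> S" "z \<in> S"
  shows "((\<lambda>u. P u x z) has_real_derivative (\<Sum>y\<in>S. L x y * P u y z)) (at u)"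
  unfolding has_field_derivative_iff
proof (rule filterlim_split_at)
  show "((\<lambda>v. (P v x z - P u x z) / (v - u)) \<longlongrightarrow> (\<Sum>y\<in>S. L x y * P u y z)) (at_right u)"
    unfolding filterlim_at_right_to_0[of _ _ u]
  proof (rule Lim_transform_eventually)
    show "((\<lambda>h. \<Sum>y\<in>S. (P h x y - P 0 x y) / h * P u y z) \<longlongrightarrow> (\<Sum>y\<in>S. L x y * P u y z)) (at_right 0)"
      by (intro tendsto_intros P_rate xz)
    show "\<forall>\<^sub>F h in at_right 0. (\<Sum>y\<in>S. (P h x y - P 0 x y) / h * P u y z)
        = (P (h + u) x z - P u x z) / (h + u - u)"
      using eventually_at_right_less[of "0::real"]
      by eventually_elim (use u xz in \<open>simp add: P_increment sum_divide_distrib\<close>)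
  qed
  show "((\<lambda>v. (P v x z - P u x z) / (v - u)) \<longlongrightarrow> (\<Sum>y\<in>S. L x y * P u y z)) (at_left u)"
    unfolding filterlim_at_left_to_right[of _ _ u] filterlim_at_right_to_0[of _ _ "- u"]
  proof (rule Lim_transform_eventually)
    show "((\<lambda>h. \<Sum>y\<in>S. (P h x y - P 0 x y) / h * P (u - h) y z) \<longlongrightarrow> (\<Sum>y\<in>S. L x y * P u y z)) (at_right 0)"
      by (intro tendsto_intros P_rate P_left_continuous u xz)
    show "\<forall>\<^sub>F h in at_right 0. (\<Sum>y\<in>S. (P h x y - P 0 x y) / h * P (u - h) y z)
        = (P (- (h + - u)) x z - P u x z) / (- (h + - u) - u)"
      using eventually_at_right_less[of "0::real"] eventually_at_right_real[OF u]
    proof eventually_elim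
      case (elim h)
      have "P u x z - P (u - h) x z = (\<Sum>y\<in>S. (P h x y - P 0 x y) * P (u - h) y z)"
        using P_increment[of h "u - h" x z] elim xz by simp
      then have "(\<Sum>y\<in>S. (P h x y - P 0 x y) / h * P (u - h) y z) = (P u x z - P (u - h) x z) / h"
        by (simp add: sum_divide_distrib)
      also have "\<dots> = (P (- (h + - u)) x z - P u x z) / (- (h + - u) - u)"
        by (simp add: minus_divide_left[symmetric] diff_divide_distrib)
      finally show ?case .
    qed
  qed
qed

lemma P_continuous:
  assumes xz: "x \<in> S" "z \<in> S"
  shows "continuous_on {0..} (\<lambda>u. P u x z)"
  unfolding continuous_on_eq_continuous_within
proof
  fix u :: real assume "u \<in> {0..}"
  then consider "u = 0" | "0 < u" by fastforce
  then show "continuous (at u within {0..}) (\<lambda>u. P u x z)"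
  proof cases
    case 1
    then show ?thesis
      using P_right_zero[OF xz] by (simp add: continuous_within at_within_Ici_at_right Lim_null[symmetric])
  next
    case 2
    then show ?thesis
      using DERIV_isCont[OF backward_equation[OF 2 xz]] continuous_at_imp_continuous_at_within by blast
  qed
qed

lemma P_apply_bounded:
  assumes "0 \<le> t" "x \<in> S" "\<And>y. y \<in> S \<Longrightarrow> \<bar>f y\<bar> \<le> C"
  shows "\<bar>\<Sum>y\<in>S. P t x y * f y\<bar> \<le> C"
proof -
  have "\<bar>\<Sum>y\<in>S. P t x y * f y\<bar> \<le> (\<Sum>y\<in>S. P t x y * C)"
    by (intro order_trans[OF sum_abs] sum_mono) (auto simp: abs_mult P_nonneg assms mult_left_mono)
  also have "\<dots> = C" by (simp add: sum_distrib_right[symmetric] P_sum assms)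
  finally show ?thesis .
qed

end

text \<open>
  The Markov property for the two times 0 and \<open>t\<close> gives the joint law of the positions at these
  times.
\<close>

lemma markov_jump_process_expectation:
  assumes Y: "markov_jump_process N S L \<nu> Y" and S: "finite S" and t: "0 \<le> t"
  obtains P where "markov_semigroup S L P"
    "prob_space.expectation N (\<lambda>\<omega>. f (Y t \<omega>)) = (\<Sum>z\<in>S. \<nu> z * (\<Sum>y\<in>S. P t z y * f y))"
proof -
  interpret prob_space N using Y unfolding markov_jump_process_def by blast
  have meas: "Y s \<in> N \<rightarrow>\<^sub>M count_space S" if "0 \<le> s" for s
    using Y that unfolding markov_jump_process_def by blast
  have init: "prob {\<omega>\<in>space N. Y 0 \<omega> = z} = \<nu> z" if "z \<in> S" for z
    using Y that unfolding markov_jump_process_def by blast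
  obtain P where P: "markov_semigroup S L P" and markov: "\<forall>(k::nat) (t::nat \<Rightarrow> real) (x::nat \<Rightarrow> _).
           0 \<le> t 0 \<and> (\<forall>i\<le>k. t i \<le> t (Suc i)) \<and> (\<forall>i\<le>Suc k. x i \<in> S) \<longrightarrow>
           measure N {\<omega>\<in>space N. \<forall>i\<le>Suc k. Y (t i) \<omega> = x i} =
           measure N {\<omega>\<in>space N. \<forall>i\<le>k. Y (t i) \<omega> = x i}
             * P (t (Suc k) - t k) (x k) (x (Suc k))"
    using Y unfolding markov_jump_process_def by blast
  have joint: "prob {\<omega>\<in>space N. Y 0 \<omega> = z \<and> Y t \<omega> = y} = \<nu> z * P t z y" if "z \<in> S" "y \<in> S" for z y
  proof -
    have all: "(\<forall>i\<le>Suc 0. Q i) \<longleftrightarrow> Q 0 \<and> Q (Suc 0)" for Q by (auto simp: le_Suc_eq)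
    show ?thesis
      using markov[rule_format, of "\<lambda>i. if i = 0 then 0 else t" 0 "\<lambda>i. if i = 0 then z else y"] that t
      by (simp add: all init)
  qed
  have ev: "{\<omega>\<in>space N. Y s \<omega> = y} \<in> sets N" if "0 \<le> s" "y \<in> S" for s y
    using measurable_sets[OF meas[OF that(1)], of "{y}"] that(2)
    by (simp add: vimage_def Int_def conj_commute)
  have marg: "prob {\<omega>\<in>space N. Y t \<omega> = y} = (\<Sum>z\<in>S. \<nu> z * P t z y)" if y: "y \<in> S" for y
  proof -
    have "{\<omega>\<in>space N. Y t \<omega> = y} = (\<Union>z\<in>S. {\<omega>\<in>space N. Y 0 \<omega> = z \<and> Y t \<omega> = y})"
      using measurable_space[OF meas[OF order_refl]] by auto
    also have "prob \<dots> = (\<Sum>z\<in>S. prob {\<omega>\<in>space N. Y 0 \<omega> = z \<and> Y t \<omega> = y})"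
    proof (rule finite_measure_finite_Union[OF S])
      show "(\<lambda>z. {\<omega>\<in>space N. Y 0 \<omega> = z \<and> Y t \<omega> = y}) ` S \<subseteq> sets N"
        using ev[OF order_refl] ev[OF t y] by (auto intro!: sets.sets_Collect_conj)
      show "disjoint_family_on (\<lambda>z. {\<omega>\<in>space N. Y 0 \<omega> = z \<and> Y t \<omega> = y}) S"
        by (auto simp: disjoint_family_on_def)
    qed
    finally show ?thesis using y by (simp add: joint)
  qed
  have "expectation (\<lambda>\<omega>. f (Y t \<omega>)) = expectation (\<lambda>\<omega>. \<Sum>y\<in>S. indicat_real {\<omega>\<in>space N. Y t \<omega> = y} \<omega> * f y)"
  proof (rule Bochner_Integration.integral_cong)
    fix \<omega> assume w: "\<omega> \<in> space N"
    then have "(\<Sum>y\<in>S. indicat_real {\<omega>\<in>space N. Y t \<omega> = y} \<omega> * f y) = (\<Sum>y\<in>S. if Y t \<omega> = y then f y else 0)"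
      by (intro sum.cong) auto
    then show "f (Y t \<omega>) = (\<Sum>y\<in>S. indicat_real {\<omega>\<in>space N. Y t \<omega> = y} \<omega> * f y)"
      using measurable_space[OF meas[OF t] w] S by simp
  qed simp
  also have "\<dots> = (\<Sum>y\<in>S. prob {\<omega>\<in>space N. Y t \<omega> = y} * f y)"
    using ev[OF t] by (subst Bochner_Integration.integral_sum) (auto simp: less_top[symmetric])
  also have "\<dots> = (\<Sum>y\<in>S. \<Sum>z\<in>S. \<nu> z * (P t z y * f y))"
    by (simp add: marg sum_distrib_right mult.assoc)
  also have "\<dots> = (\<Sum>z\<in>S. \<nu> z * (\<Sum>y\<in>S. P t z y * f y))"
    by (subst sum.swap) (simp add: sum_distrib_left)
  finally show ?thesis using P that by blast
qed

section \<open>Comparison with the averaged semigroup\<close>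

lemma norm_integral_le_integral:
  fixes f :: "'a \<Rightarrow> 'b::{banach, second_countable_topology}"
  assumes "integrable M f" "integrable M h" "\<And>x. x \<in> space M \<Longrightarrow> norm (f x) \<le> h x"
  shows "norm (integral\<^sup>L M f) \<le> integral\<^sup>L M h"
  by (rule order_trans[OF integral_norm_bound integral_mono]) (use assms in auto)

context solution_in_simplex
begin

lemma mean_interpolation_error:
  fixes f :: "real^'n \<Rightarrow> real"
  assumes f: "L-lipschitz_on K f" and s: "0 \<le> s" and \<epsilon>: "0 < \<epsilon>"
  shows "\<bar>expectation (\<lambda>\<omega>. f (Z s \<omega>)) - (\<Sum>z\<in>S. mean_coordinate z s * f z)\<bar> \<le> L * (\<epsilon> + mean_spread s / \<epsilon>)"
proof -
  have fc: "continuous_on K f" using f by (rule lipschitz_on_continuous_on)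
  have "(\<Sum>z\<in>S. mean_coordinate z s * f z) = expectation (\<lambda>\<omega>. \<Sum>z\<in>S. coordinate z (Z s \<omega>) * f z)"
    unfolding mean_coordinate_def using integrable_coordinate[OF s]
    by (subst Bochner_Integration.integral_sum) auto
  then have eq: "expectation (\<lambda>\<omega>. f (Z s \<omega>)) - (\<Sum>z\<in>S. mean_coordinate z s * f z)
      = expectation (\<lambda>\<omega>. f (Z s \<omega>) - (\<Sum>z\<in>S. coordinate z (Z s \<omega>) * f z))"
    using integrable_coordinate[OF s] functional_integrable[OF fc s]
    by (subst Bochner_Integration.integral_diff) auto
  have "\<bar>expectation (\<lambda>\<omega>. f (Z s \<omega>)) - (\<Sum>z\<in>S. mean_coordinate z s * f z)\<bar>
      \<le> expectation (\<lambda>\<omega>. L * (\<epsilon> + spread (Z s \<omega>) / \<epsilon>))"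
    unfolding eq real_norm_def[symmetric]
  proof (rule norm_integral_le_integral)
    show "norm (f (Z s \<omega>) - (\<Sum>z\<in>S. coordinate z (Z s \<omega>) * f z)) \<le> L * (\<epsilon> + spread (Z s \<omega>) / \<epsilon>)"
      if "\<omega> \<in> space M" for \<omega>
      using lipschitz_interpolation_error[OF f stays[OF that s] \<epsilon>] by simp
  qed (use integrable_coordinate[OF s] functional_integrable[OF fc s] integrable_spread[OF s] in auto)
  also have "\<dots> = L * (\<epsilon> + mean_spread s / \<epsilon>)"
    using integrable_spread[OF s] by (simp add: mean_spread_def prob_space)
  finally show ?thesis .
qed

lemma mean_rate_error:
  assumes L: "L-lipschitz_on K \<beta>" and s: "0 \<le> s" and \<epsilon>: "0 < \<epsilon>"
  shows "\<bar>mean_rate z s - (\<Sum>x\<in>S. mean_coordinate x s * (\<beta> x \<bullet> g z))\<bar>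
    \<le> norm (g z) * L * (\<epsilon> + mean_spread s / \<epsilon>)"
proof -
  have "(norm (g z) * L)-lipschitz_on K (\<lambda>x. g z \<bullet> \<beta> x)"
  proof (rule lipschitz_onI)
    fix x y assume xy: "x \<in> K" "y \<in> K"
    have "dist (g z \<bullet> \<beta> x) (g z \<bullet> \<beta> y) \<le> norm (g z) * dist (\<beta> x) (\<beta> y)"
      using Cauchy_Schwarz_ineq2[of "g z" "\<beta> x - \<beta> y"] by (simp add: dist_norm inner_diff_right)
    also have "\<dots> \<le> norm (g z) * (L * dist x y)"
      by (intro mult_left_mono lipschitz_onD[OF L xy]) simp
    finally show "dist (g z \<bullet> \<beta> x) (g z \<bullet> \<beta> y) \<le> norm (g z) * L * dist x y" by (simp add: mult.assoc)
  qed (use lipschitz_on_nonneg[OF L] in simp)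
  from mean_interpolation_error[OF this s \<epsilon>] show ?thesis
    unfolding mean_rate_def by (simp add: inner_commute)
qed

lemma mean_coordinate_derivative:
  assumes "0 < s" "s < t"
  shows "(mean_coordinate z has_real_derivative mean_rate z s) (at s)"
proof -
  have "continuous_on {0..t} (mean_rate z)"
    by (rule continuous_on_subset[OF continuous_mean_rate]) auto
  from integral_has_real_derivative[OF this, of s]
  have "((\<lambda>u. integral {0..u} (mean_rate z)) has_real_derivative mean_rate z s) (at s)"
    using assms by (simp add: at_within_Icc_at)
  from DERIV_add[OF this DERIV_const[of "mean_coordinate z 0"]]
  have "((\<lambda>u. integral {0..u} (mean_rate z) + mean_coordinate z 0) has_real_derivative mean_rate z s) (at s)"
    by simp
  then show ?thesis
  proof (rule has_field_derivative_transform_within_open[where S="{0<..}"])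
    fix u :: real assume "u \<in> {0<..}"
    then show "integral {0..u} (mean_rate z) + mean_coordinate z 0 = mean_coordinate z u"
      using mean_coordinate_increment[of 0 u z] by simp
  qed (use assms in auto)
qed

text \<open>
  Duhamel's formula: the function \<open>h\<close> below is the expectation of \<open>f\<close> at time \<open>t\<close> when the
  averaged semigroup takes over from the solution at time \<open>s\<close>. By the backward equation its derivative contains
  only the defect \<open>e\<close> of the forward equation.
\<close>

lemma averaged_semigroup_error:
  fixes f :: "real^'n \<Rightarrow> real"
  assumes P: "markov_semigroup S A P" and A: "\<And>x z. x \<in> S \<Longrightarrow> z \<in> S \<Longrightarrow> A x z = \<beta> x \<bullet> g z"
    and L: "L-lipschitz_on K \<beta>" and f: "\<And>y. y \<in> S \<Longrightarrow> \<bar>f y\<bar> \<le> C"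
    and t: "0 \<le> t" and \<epsilon>: "0 < \<epsilon>"
  shows "\<bar>(\<Sum>z\<in>S. mean_coordinate z t * f z) - (\<Sum>z\<in>S. mean_coordinate z 0 * (\<Sum>y\<in>S. P t z y * f y))\<bar>
    \<le> C * L * (\<Sum>z\<in>S. norm (g z)) * (\<epsilon> * t + integral {0..t} mean_spread / \<epsilon>)"
proof -
  interpret finite_semigroup S A P by standard (fact finite_vertices P)+
  define v where "v z s = (\<Sum>y\<in>S. P (t - s) z y * f y)" for z s
  define h where "h s = (\<Sum>z\<in>S. mean_coordinate z s * v z s)" for s
  define e where "e z s = mean_rate z s - (\<Sum>x\<in>S. mean_coordinate x s * (\<beta> x \<bullet> g z))" for z s
  have v_deriv: "(v z has_real_derivative - (\<Sum>w\<in>S. A z w * v w s)) (at s)" if "s < t" "z \<in> S" for s z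
  proof -
    have d: "((\<lambda>s. P (t - s) z y) has_real_derivative (\<Sum>w\<in>S. A z w * P (t - s) w y) * (0 - 1)) (at s)" if "y \<in> S" for y
      by (rule DERIV_chain2[OF backward_equation]) (use \<open>s < t\<close> \<open>z \<in> S\<close> that in \<open>auto intro!: derivative_eq_intros\<close>)
    have "(v z has_real_derivative (\<Sum>y\<in>S. (\<Sum>w\<in>S. A z w * P (t - s) w y) * (0 - 1) * f y)) (at s)"
      unfolding v_def[abs_def] by (intro DERIV_sum DERIV_cmult_right d)
    also have "(\<Sum>y\<in>S. (\<Sum>w\<in>S. A z w * P (t - s) w y) * (0 - 1) * f y) = - (\<Sum>y\<in>S. \<Sum>w\<in>S. A z w * (P (t - s) w y * f y))"
      by (simp add: sum_negf sum_distrib_right mult.assoc)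
    also have "\<dots> = - (\<Sum>w\<in>S. A z w * v w s)"
      unfolding v_def by (subst sum.swap) (simp add: sum_distrib_left)
    finally show ?thesis .
  qed
  have v_cont: "continuous_on {0..t} (v z)" if "z \<in> S" for z
    unfolding v_def[abs_def]
    by (intro continuous_intros continuous_on_compose2[OF P_continuous]) (use that in auto)
  have h_cont: "continuous_on {0..t} h"
    unfolding h_def[abs_def]
    by (intro continuous_intros v_cont continuous_on_subset[OF continuous_mean_coordinate]) auto
  have h_deriv: "(h has_real_derivative (\<Sum>z\<in>S. e z s * v z s)) (at s)" if s: "0 < s" "s < t" for s
  proof -
    have "(h has_real_derivative (\<Sum>z\<in>S. mean_rate z s * v z s + (- (\<Sum>w\<in>S. A z w * v w s)) * mean_coordinate z s)) (at s)"
      unfolding h_def[abs_def]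
      by (intro DERIV_sum DERIV_mult mean_coordinate_derivative[OF s] v_deriv s)
    also have "(\<Sum>z\<in>S. mean_rate z s * v z s + (- (\<Sum>w\<in>S. A z w * v w s)) * mean_coordinate z s)
        = (\<Sum>z\<in>S. mean_rate z s * v z s) - (\<Sum>z\<in>S. \<Sum>w\<in>S. mean_coordinate z s * (\<beta> z \<bullet> g w) * v w s)"
      by (simp add: sum_subtractf sum_distrib_left sum_distrib_right A mult_ac)
    also have "\<dots> = (\<Sum>z\<in>S. e z s * v z s)"
      unfolding e_def
      by (subst sum.swap[of _ S S]) (simp add: sum_subtractf left_diff_distrib sum_distrib_right)
    finally show ?thesis .
  qed
  have int: "((\<lambda>s. \<Sum>z\<in>S. e z s * v z s) has_integral (h t - h 0)) {0..t}"
    using t h_cont h_deriv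
    by (intro fundamental_theorem_of_calculus_interior) (auto simp: has_real_derivative_iff_has_vector_derivative)
  let ?G = "\<Sum>z\<in>S. norm (g z)"
  have bound: "norm (\<Sum>z\<in>S. e z s * v z s) \<le> C * L * ?G * (\<epsilon> + mean_spread s / \<epsilon>)" if s: "s \<in> {0..t}" for s
  proof -
    have "norm (\<Sum>z\<in>S. e z s * v z s) \<le> (\<Sum>z\<in>S. (norm (g z) * L * (\<epsilon> + mean_spread s / \<epsilon>)) * C)"
    proof (rule sum_norm_le)
      fix z assume z: "z \<in> S"
      have 1: "\<bar>e z s\<bar> \<le> norm (g z) * L * (\<epsilon> + mean_spread s / \<epsilon>)"
        unfolding e_def by (rule mean_rate_error[OF L _ \<epsilon>]) (use s in auto)
      have 2: "\<bar>v z s\<bar> \<le> C" unfolding v_def by (rule P_apply_bounded) (use s z f in auto)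
      show "norm (e z s * v z s) \<le> (norm (g z) * L * (\<epsilon> + mean_spread s / \<epsilon>)) * C"
        unfolding real_norm_def abs_mult using 1 2 by (intro mult_mono) auto
    qed
    also have "\<dots> = C * L * ?G * (\<epsilon> + mean_spread s / \<epsilon>)"
      by (simp add: sum_distrib_right sum_distrib_left mult_ac)
    finally show ?thesis .
  qed
  have ms: "mean_spread integrable_on {0..t}"
    by (intro integrable_continuous_real continuous_on_subset[OF continuous_mean_spread]) auto
  have gi: "((\<lambda>s. C * L * ?G * (\<epsilon> + mean_spread s / \<epsilon>)) has_integral
      C * L * ?G * (\<epsilon> * t + integral {0..t} mean_spread / \<epsilon>)) {0..t}"
    using t has_integral_const_real[of \<epsilon> 0 t]
    by (intro has_integral_mult_right has_integral_add has_integral_divide integrable_integral ms)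
       (simp_all add: mult.commute)
  have "norm (h t - h 0) \<le> C * L * ?G * (\<epsilon> * t + integral {0..t} mean_spread / \<epsilon>)"
    using Henstock_Kurzweil_Integration.integral_norm_bound_integral[OF has_integral_integrable[OF int] has_integral_integrable[OF gi] bound]
    by (simp only: integral_unique[OF int] integral_unique[OF gi])
  moreover have "h t = (\<Sum>z\<in>S. mean_coordinate z t * f z)"
    unfolding h_def v_def
    by (intro sum.cong refl) (simp add: P_zero finite_vertices if_distrib[where f="\<lambda>u. u * _"] cong: if_cong)
  moreover have "h 0 = (\<Sum>z\<in>S. mean_coordinate z 0 * (\<Sum>y\<in>S. P t z y * f y))"
    by (simp add: h_def v_def)
  ultimately show ?thesis by simp
qed

text \<open>
  A nonnegative coordinate that starts at 0 cannot have a negative rate at time 0.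
\<close>

lemma rate_nonneg_at_face:
  assumes x: "x \<in> K" "AE \<omega> in M. Z 0 \<omega> = x" and z: "z \<in> S" "coordinate z x = 0"
  shows "0 \<le> \<beta> x \<bullet> g z"
proof (rule ccontr)
  assume neg: "\<not> 0 \<le> \<beta> x \<bullet> g z"
  have cong: "expectation (\<lambda>\<omega>. h (Z 0 \<omega>)) = h x" if "continuous_on K h" for h :: "real^'n \<Rightarrow> real"
  proof -
    have "expectation (\<lambda>\<omega>. h (Z 0 \<omega>)) = expectation (\<lambda>\<omega>. h x)"
    proof (rule integral_cong_AE)
      show "AE \<omega> in M. h (Z 0 \<omega>) = h x" using x(2) by eventually_elim simp
    qed (use functional_measurable[OF that order_refl] in auto)
    then show ?thesis by (simp add: prob_space)
  qed
  define r where "r = mean_rate z 0"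
  have r: "r < 0"
    using cong[OF continuous_rate, of z] neg by (simp add: r_def mean_rate_def inner_commute)
  have m0: "mean_coordinate z 0 = 0"
    using cong[OF continuous_coordinate, of z] z by (simp add: mean_coordinate_def)
  have "\<exists>d>0. \<forall>s\<in>{0..}. dist s 0 < d \<longrightarrow> dist (mean_rate z s) r < - r / 2"
    using continuous_mean_rate[of z, unfolded continuous_on_iff, rule_format, of 0 "- r / 2"] r
    unfolding r_def by auto
  then obtain d where d: "0 < d" "\<And>s. 0 \<le> s \<Longrightarrow> s < d \<Longrightarrow> dist (mean_rate z s) r < - r / 2"
    by (auto simp: dist_real_def)
  have "mean_coordinate z (d / 2) = integral {0..d / 2} (mean_rate z)"
    using mean_coordinate_increment[of 0 "d / 2" z] d(1) m0 by simp
  also have "\<dots> \<le> integral {0..d / 2} (\<lambda>_. r / 2)"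
  proof (rule integral_le)
    show "mean_rate z integrable_on {0..d / 2}"
      by (intro integrable_continuous_real continuous_on_subset[OF continuous_mean_rate]) auto
    show "mean_rate z s \<le> r / 2" if "s \<in> {0..d / 2}" for s
      using d(2)[of s] that d(1) by (auto simp: dist_real_def)
  qed auto
  also have "\<dots> = d / 2 * (r / 2)" using d(1) by (simp add: integral_const_real)
  also have "\<dots> < 0" using d(1) r by (simp add: mult_pos_neg)
  finally show False using mean_coordinate_nonneg[of "d / 2" z] d(1) z(1) by simp
qed

end

section \<open>Convergence to the averaged jump process\<close>

text \<open>
  Each of the three limits in the proof is of this form: an error that becomes small with an auxiliary
  parameter \<open>\<epsilon>\<close>, plus a remainder that vanishes for fixed \<open>\<epsilon>\<close> as \<open>\<gamma>\<close> grows.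
\<close>

lemma tendsto_zero_of_small_bounds:
  fixes e :: "real \<Rightarrow> real"
  assumes t: "0 < t" and c: "0 \<le> c"
    and bound: "\<And>\<epsilon>. 0 < \<epsilon> \<Longrightarrow> \<epsilon> \<le> t \<Longrightarrow> \<exists>r. (r \<longlongrightarrow> 0) at_top \<and> (\<forall>\<gamma>>0. \<bar>e \<gamma>\<bar> \<le> c * \<epsilon> + r \<gamma>)"
  shows "(e \<longlongrightarrow> 0) at_top"
proof (rule tendstoI)
  fix \<eta> :: real assume \<eta>: "0 < \<eta>"
  define \<epsilon> where "\<epsilon> = min t (\<eta> / (2 * (c + 1)))"
  have \<epsilon>: "0 < \<epsilon>" "\<epsilon> \<le> t" using t \<eta> c by (auto simp: \<epsilon>_def)
  have "c * \<epsilon> \<le> c * (\<eta> / (2 * (c + 1)))" using c by (intro mult_left_mono) (auto simp: \<epsilon>_def)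
  also have "\<dots> \<le> \<eta> / 2" using c \<eta> by (simp add: field_simps)
  finally have small: "c * \<epsilon> \<le> \<eta> / 2" .
  obtain r where r: "(r \<longlongrightarrow> 0) at_top" "\<And>\<gamma>. 0 < \<gamma> \<Longrightarrow> \<bar>e \<gamma>\<bar> \<le> c * \<epsilon> + r \<gamma>"
    using bound[OF \<epsilon>] by blast
  have "\<forall>\<^sub>F \<gamma> in at_top. r \<gamma> < \<eta> / 2" using order_tendstoD(2)[OF r(1), of "\<eta> / 2"] \<eta> by simp
  then show "\<forall>\<^sub>F \<gamma> in at_top. dist (e \<gamma>) 0 < \<eta>"
    using eventually_gt_at_top[of 0]
  proof eventually_elim
    case (elim \<gamma>)
    then show ?case using r(2)[of \<gamma>] small by simp
  qed
qed

theorem theorem2: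
  fixes K :: "(real^'n) set"
    and \<sigma> \<sigma>\<^sub>0 :: "real^'n \<Rightarrow> real^'n^'n"
    and b :: "real^'n \<Rightarrow> real^'n"
    and M :: "'a measure"
    and F :: "real \<Rightarrow> 'a measure"
    and W B :: "real \<Rightarrow> 'a \<Rightarrow> real^'n"
    and X :: "real^'n \<Rightarrow> real \<Rightarrow> 'a \<Rightarrow> real^'n"
    and X\<gamma> :: "real \<Rightarrow> real \<Rightarrow> 'a \<Rightarrow> real^'n"
    and \<mu> :: "(real^'n) measure"
    and f :: "real^'n \<Rightarrow> real"
    and t :: real
  defines "K\<^sub>0 \<equiv> zero_set K \<sigma>"
    and "H \<equiv> limit_prob M X"
  assumes simplex: "int CARD('n) simplex K"
    and lipschitz: "\<exists>C. C-lipschitz_on K \<sigma>" "\<exists>C. C-lipschitz_on K \<sigma>\<^sub>0" "\<exists>C. C-lipschitz_on K b"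
    and space: "filtered_prob_space M F"
    and bm: "brownian_motion M F W" "brownian_motion M F B" "independent_processes M W B"
    and X: "\<And>x. x \<in> K \<Longrightarrow>
          sde_solution M F W B \<sigma> (\<lambda>_. 0) (\<lambda>_. 0) (X x) \<and> stays_in M K (X x) \<and>
          (AE \<omega> in M. X x 0 \<omega> = x)"
    and stays: "\<And>\<gamma> x. \<gamma> > 0 \<Longrightarrow> x \<in> K \<Longrightarrow>
          \<exists>Z. sde_solution M F W B (\<lambda>y. sqrt \<gamma> *\<^sub>R \<sigma> y) b \<sigma>\<^sub>0 Z \<and> stays_in M K Z \<and>
            (AE \<omega> in M. Z 0 \<omega> = x)"
    and finite: "finite K\<^sub>0"
    and card: "card K\<^sub>0 = CARD('n) + 1"
    and affine: "\<not> affine_dependent K\<^sub>0"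
    and f: "\<exists>C. C-lipschitz_on K f"
    and mu: "prob_space \<mu>" "sets \<mu> = sets borel" "measure \<mu> K = 1"
    and X\<gamma>: "\<And>\<gamma>. \<gamma> > 0 \<Longrightarrow>
          sde_solution M F W B (\<lambda>y. sqrt \<gamma> *\<^sub>R \<sigma> y) b \<sigma>\<^sub>0 (X\<gamma> \<gamma>) \<and> stays_in M K (X\<gamma> \<gamma>) \<and>
          distr M borel (X\<gamma> \<gamma> 0) = \<mu>"
    and t: "t > 0"
  shows "generator_matrix K\<^sub>0 (averaged_generator K b H) \<and>
    probability_vector K\<^sub>0 (averaged_initial K \<mu> H) \<and>
    (\<forall>(N::'b measure) Y.
       markov_jump_process N K\<^sub>0 (averaged_generator K b H) (averaged_initial K \<mu> H) Y \<longrightarrow>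
       ((\<lambda>\<gamma>. prob_space.expectation M (\<lambda>\<omega>. f (X\<gamma> \<gamma> t \<omega>)))
          \<longlongrightarrow> prob_space.expectation N (\<lambda>\<omega>. f (Y t \<omega>))) at_top)"
proof -
  interpret prob_space M using space unfolding filtered_prob_space_def by blast
  interpret sde_space M F W B
    by unfold_locales (fact space bm)+
  have K: "convex K" "compact K"
    using simplex unfolding simplex_def
    by (auto simp: convex_convex_hull finite_imp_compact_convex_hull aff_independent_finite)
  have K0: "K\<^sub>0 = {x\<in>K. \<sigma> x = 0}" by (simp add: K\<^sub>0_def zero_set_def)
  then have K0K: "K\<^sub>0 \<subseteq> K" by blast
  obtain L\<^sub>b L\<^sub>f where Lb: "L\<^sub>b-lipschitz_on K b" and Lf: "L\<^sub>f-lipschitz_on K f" using lipschitz(3) f by blast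
  have cont: "continuous_on K \<sigma>" "continuous_on K b" "continuous_on K \<sigma>\<^sub>0"
    using lipschitz lipschitz_on_continuous_on by blast+

  \<comment> \<open>the limit law of \<open>X x\<close> is a probability on \<open>K\<^sub>0\<close> with mean \<open>x\<close>\<close>
  have H: "(\<Sum>z\<in>K\<^sub>0. H z x) = 1" "(\<Sum>z\<in>K\<^sub>0. H z x *\<^sub>R z) = x" if x: "x \<in> K" for x
  proof -
    interpret driftless_solution M F W B \<sigma> "X x" K
      by unfold_locales (use X[OF x] K cont in auto)
    show "(\<Sum>z\<in>K\<^sub>0. H z x) = 1" "(\<Sum>z\<in>K\<^sub>0. H z x *\<^sub>R z) = x"
      using limit_distribution[OF K0 finite, of x] X[OF x] by (auto simp: H_def limit_prob_def)
  qed
  have H_nonneg: "0 \<le> H z x" for z x by (simp add: H_def limit_prob_def)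

  have "\<forall>z\<in>K\<^sub>0. \<exists>gc. \<forall>y\<in>K\<^sub>0. fst gc \<bullet> y + snd gc = (if y = z then 1 else 0)"
    using affine_coordinate_exists[OF affine] by simp
  from bchoice[OF this] obtain gc where
    gc: "\<forall>z\<in>K\<^sub>0. \<forall>y\<in>K\<^sub>0. fst (gc z) \<bullet> y + snd (gc z) = (if y = z then 1 else 0)" by blast
  define g where "g z = fst (gc z)" for z
  define c where "c z = snd (gc z)" for z
  have coord: "g z \<bullet> y + c z = (if y = z then 1 else 0)" if "z \<in> K\<^sub>0" "y \<in> K\<^sub>0" for z y
    using gc that by (simp add: g_def c_def)
  \<comment> \<open>a probability on \<open>K\<^sub>0\<close> with mean \<open>x\<close> is determined by \<open>x\<close>\<close>
  have H_eq: "H z x = g z \<bullet> x + c z" if x: "x \<in> K" and z: "z \<in> K\<^sub>0" for x z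
  proof -
    have "g z \<bullet> x + c z = g z \<bullet> (\<Sum>y\<in>K\<^sub>0. H y x *\<^sub>R y) + c z * (\<Sum>y\<in>K\<^sub>0. H y x)"
      using H[OF x] by simp
    also have "\<dots> = (\<Sum>y\<in>K\<^sub>0. H y x * (g z \<bullet> y + c z))"
      by (simp add: inner_sum_right sum_distrib_left sum.distrib[symmetric] algebra_simps)
    also have "\<dots> = (\<Sum>y\<in>K\<^sub>0. if y = z then H y x else 0)"
      by (rule sum.cong) (auto simp: coord z)
    also have "\<dots> = H z x" using finite z by simp
    finally show ?thesis by simp
  qed
  interpret bary: barycentric K\<^sub>0 K g c
  proof
    show "g z \<bullet> y + c z = (if y = z then 1 else 0)" if "y \<in> K\<^sub>0" "z \<in> K\<^sub>0" for y z
      using coord that by blast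
    show "0 \<le> g z \<bullet> x + c z" if "x \<in> K" "z \<in> K\<^sub>0" for x z
      using H_nonneg[of z x] H_eq[OF that] by simp
    show "(\<Sum>z\<in>K\<^sub>0. g z \<bullet> x + c z) = 1" "(\<Sum>z\<in>K\<^sub>0. (g z \<bullet> x + c z) *\<^sub>R z) = x" if "x \<in> K" for x
      using H[OF that] by (simp_all add: H_eq[OF that, symmetric])
  qed (fact finite K0K)+

  let ?A = "averaged_generator K b H"
  let ?\<nu> = "averaged_initial K \<mu> H"
  have A: "?A x z = b x \<bullet> g z" if "x \<in> K\<^sub>0" "z \<in> K\<^sub>0" for x z
    unfolding averaged_generator_def
    using gradient_within_affine[OF K(1) K0K _ affine card H_eq] that K0K by auto

  have solution: "solution_in_simplex M F W B (\<lambda>y. sqrt \<gamma> *\<^sub>R \<sigma> y) \<sigma>\<^sub>0 b Z K K\<^sub>0 g c"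
    if "sde_solution M F W B (\<lambda>y. sqrt \<gamma> *\<^sub>R \<sigma> y) b \<sigma>\<^sub>0 Z" "stays_in M K Z" for \<gamma> Z
    by unfold_locales (use that K cont in \<open>auto intro!: continuous_intros\<close>)

  have generator: "generator_matrix K\<^sub>0 ?A"
    unfolding generator_matrix_def
  proof (intro conjI ballI impI)
    fix x z assume xz: "x \<in> K\<^sub>0" "z \<in> K\<^sub>0" "x \<noteq> z"
    then have xK: "x \<in> K" using K0K by blast
    \<comment> \<open>the coordinate \<open>z\<close> of a solution that starts at the other vertex \<open>x\<close> starts at 0 and stays nonnegative\<close>
    obtain Z where Z: "sde_solution M F W B (\<lambda>y. sqrt 1 *\<^sub>R \<sigma> y) b \<sigma>\<^sub>0 Z" "stays_in M K Z"
      "AE \<omega> in M. Z 0 \<omega> = x"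
      using stays[of 1 x] xK by auto
    interpret solution_in_simplex M F W B "\<lambda>y. sqrt 1 *\<^sub>R \<sigma> y" \<sigma>\<^sub>0 b Z K K\<^sub>0 g c
      by (rule solution) (fact Z)+
    have "0 \<le> b x \<bullet> g z"
      by (rule rate_nonneg_at_face[OF xK Z(3) xz(2)]) (use xz in \<open>simp add: bary.coordinates\<close>)
    then show "0 \<le> ?A x z" using A xz by simp
  next
    fix x assume x: "x \<in> K\<^sub>0"
    have "(\<Sum>z\<in>K\<^sub>0. g z) = 0"
    proof (rule inner_const_on_affine_basis[OF affine])
      show "card K\<^sub>0 = Suc DIM(real^'n)" using card by simp
      show "(\<Sum>z\<in>K\<^sub>0. g z) \<bullet> y = 1 - (\<Sum>z\<in>K\<^sub>0. c z)" if "y \<in> K\<^sub>0" for y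
        using bary.coordinate_sum[of y] that K0K by (auto simp: sum.distrib inner_sum_left)
    qed
    then show "(\<Sum>z\<in>K\<^sub>0. ?A x z) = 0"
      using x by (simp add: A inner_sum_right[symmetric])
  qed

  \<comment> \<open>the initial mean coordinates are the same for all \<open>\<gamma>\<close>\<close>
  have initial: "?\<nu> z = expectation (\<lambda>\<omega>. bary.coordinate z (X\<gamma> \<gamma> 0 \<omega>))" if "0 < \<gamma>" "z \<in> K\<^sub>0" for \<gamma> z
  proof -
    interpret solution_in_simplex M F W B "\<lambda>y. sqrt \<gamma> *\<^sub>R \<sigma> y" \<sigma>\<^sub>0 b "X\<gamma> \<gamma>" K K\<^sub>0 g c
      by (rule solution) (use X\<gamma>[OF that(1)] in auto)
    interpret \<mu>: prob_space \<mu> by (rule mu(1))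
    have cm: "bary.coordinate z \<in> borel_measurable borel"
      by (rule borel_measurable_continuous_onI[OF bary.continuous_coordinate])
    have Kb: "K \<in> sets \<mu>" using mu(2) state_space_borel by simp
    have AEK: "AE x in \<mu>. x \<in> K" using \<mu>.AE_prob_1[OF mu(3)] .
    have "?\<nu> z = (LINT x|\<mu>. indicat_real K x *\<^sub>R bary.coordinate z x)"
      unfolding averaged_initial_def set_lebesgue_integral_def
      by (intro Bochner_Integration.integral_cong)
         (auto simp: H_eq[OF _ that(2)] bary.coordinate_def indicator_def)
    also have "\<dots> = (LINT x|\<mu>. bary.coordinate z x)"
    proof (rule integral_cong_AE)
      show "AE x in \<mu>. indicat_real K x *\<^sub>R bary.coordinate z x = bary.coordinate z x"
        using AEK by eventually_elim simp
    qed (use cm Kb mu(2) in \<open>auto simp: measurable_cong_sets[OF mu(2) refl] intro!: borel_measurable_times borel_measurable_indicator\<close>)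
    also have "\<dots> = (LINT x|distr M borel (X\<gamma> \<gamma> 0). bary.coordinate z x)"
      using X\<gamma>[OF that(1)] by simp
    also have "\<dots> = expectation (\<lambda>\<omega>. bary.coordinate z (X\<gamma> \<gamma> 0 \<omega>))"
      by (rule integral_distr[OF process_measurable[OF order_refl] cm])
    finally show ?thesis .
  qed

  have initial_prob: "probability_vector K\<^sub>0 ?\<nu>"
  proof -
    interpret solution_in_simplex M F W B "\<lambda>y. sqrt 1 *\<^sub>R \<sigma> y" \<sigma>\<^sub>0 b "X\<gamma> 1" K K\<^sub>0 g c
      by (rule solution) (use X\<gamma>[of 1] in auto)
    have \<nu>: "?\<nu> z = mean_coordinate z 0" if "z \<in> K\<^sub>0" for z
      using initial[of 1 z] that by (simp add: mean_coordinate_def)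
    have "(\<Sum>z\<in>K\<^sub>0. mean_coordinate z 0) = expectation (\<lambda>\<omega>. \<Sum>z\<in>K\<^sub>0. bary.coordinate z (X\<gamma> 1 0 \<omega>))"
      unfolding mean_coordinate_def
      by (rule Bochner_Integration.integral_sum[symmetric]) (rule integrable_coordinate[OF order_refl])
    also have "\<dots> = expectation (\<lambda>\<omega>. 1::real)"
      using stays_in by (intro Bochner_Integration.integral_cong) (auto simp: bary.coordinates stays_in_def)
    finally show ?thesis
      unfolding probability_vector_def using mean_coordinate_nonneg[OF order_refl] \<nu> by (simp add: prob_space)
  qed

  have convergence: "((\<lambda>\<gamma>. expectation (\<lambda>\<omega>. f (X\<gamma> \<gamma> t \<omega>))) \<longlongrightarrow> prob_space.expectation N (\<lambda>\<omega>. f (Y t \<omega>))) at_top"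
    if Y: "markov_jump_process N K\<^sub>0 ?A ?\<nu> Y" for N :: "'b measure" and Y
  proof -
    obtain P where P: "markov_semigroup K\<^sub>0 ?A P" and
      EY: "prob_space.expectation N (\<lambda>\<omega>. f (Y t \<omega>)) = (\<Sum>z\<in>K\<^sub>0. ?\<nu> z * (\<Sum>y\<in>K\<^sub>0. P t z y * f y))"
      using markov_jump_process_expectation[OF Y finite, of t f] t by (auto intro: less_imp_le)
    define err where "err \<gamma> = expectation (\<lambda>\<omega>. f (X\<gamma> \<gamma> t \<omega>)) - prob_space.expectation N (\<lambda>\<omega>. f (Y t \<omega>))" for \<gamma>
    define D where "D \<gamma> s = expectation (\<lambda>\<omega>. bary.spread (X\<gamma> \<gamma> s \<omega>))" for \<gamma> s
    obtain R where R: "\<And>x. x \<in> K \<Longrightarrow> norm x \<le> R" using compact_imp_bounded[OF K(2)] by (auto simp: bounded_iff)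
    obtain C\<^sub>b where Cb: "\<And>x. x \<in> K \<Longrightarrow> norm (b x) \<le> C\<^sub>b"
      using compact_imp_bounded[OF compact_continuous_image[OF cont(2) K(2)]] by (auto simp: bounded_iff)
    obtain C\<^sub>0 where C0: "\<And>x. x \<in> K \<Longrightarrow> norm (\<sigma>\<^sub>0 x) \<le> C\<^sub>0"
      using compact_imp_bounded[OF compact_continuous_image[OF cont(3) K(2)]] by (auto simp: bounded_iff)
    obtain C\<^sub>f where Cf: "\<And>x. x \<in> K \<Longrightarrow> \<bar>f x\<bar> \<le> C\<^sub>f"
      using compact_imp_bounded[OF compact_continuous_image[OF lipschitz_on_continuous_on[OF Lf] K(2)]]
      by (auto simp: bounded_iff)
    have "K\<^sub>0 \<noteq> {}" using card by auto
    then obtain x\<^sub>0 where "x\<^sub>0 \<in> K" using K0K by blast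
    then have nonneg: "0 \<le> R" "0 \<le> C\<^sub>b" "0 \<le> C\<^sub>f" "0 \<le> L\<^sub>b" "0 \<le> L\<^sub>f"
      using R Cb Cf Lb Lf lipschitz_on_nonneg by (meson norm_ge_zero abs_ge_zero order_trans)+
    define E where "E = 8 * (2 * R + C\<^sub>b * t)\<^sup>2 + 32 * C\<^sub>0\<^sup>2 * t"
    define C\<^sub>1 where "C\<^sub>1 = ((\<Sum>z\<in>K\<^sub>0. (norm z)\<^sup>2 * norm (g z)) + 2 * R) * C\<^sub>b"
    define C\<^sub>2 where "C\<^sub>2 = C\<^sub>f * L\<^sub>b * (\<Sum>z\<in>K\<^sub>0. norm (g z))"
    have C1: "0 \<le> C\<^sub>1" unfolding C\<^sub>1_def using nonneg by (intro mult_nonneg_nonneg add_nonneg_nonneg sum_nonneg) auto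
    have C2: "0 \<le> C\<^sub>2" unfolding C\<^sub>2_def using nonneg by (intro mult_nonneg_nonneg sum_nonneg) auto

    \<comment> \<open>the constants in these estimates do not depend on \<open>\<gamma>\<close>\<close>
    have estimates:
      "0 \<le> D \<gamma> t" "0 \<le> integral {0..t} (D \<gamma>)"
      "\<And>\<delta> C. 0 \<le> C \<Longrightarrow> (\<And>x. x \<in> K \<Longrightarrow> bary.spread x \<le> \<delta> + C * (norm (\<sigma> x))\<^sup>2) \<Longrightarrow>
        integral {0..t} (D \<gamma>) \<le> \<delta> * t + C * E / \<gamma>"
      "\<And>h. 0 < h \<Longrightarrow> h \<le> t \<Longrightarrow> D \<gamma> t \<le> C\<^sub>1 * h + integral {0..t} (D \<gamma>) / h"
      "\<And>\<epsilon>. 0 < \<epsilon> \<Longrightarrow> \<bar>err \<gamma>\<bar>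
        \<le> L\<^sub>f * (\<epsilon> + D \<gamma> t / \<epsilon>) + C\<^sub>2 * (\<epsilon> * t + integral {0..t} (D \<gamma>) / \<epsilon>)"
      if \<gamma>: "0 < \<gamma>" for \<gamma>
    proof -
      interpret solution_in_simplex M F W B "\<lambda>y. sqrt \<gamma> *\<^sub>R \<sigma> y" \<sigma>\<^sub>0 b "X\<gamma> \<gamma>" K K\<^sub>0 g c
        by (rule solution) (use X\<gamma>[OF \<gamma>] in auto)
      have D: "D \<gamma> = mean_spread" by (simp add: fun_eq_iff D_def mean_spread_def)
      have t0: "0 \<le> t" using t by simp
      show "0 \<le> D \<gamma> t" unfolding D by (rule mean_spread_nonneg[OF t0])
      show "0 \<le> integral {0..t} (D \<gamma>)" unfolding D
        by (intro Henstock_Kurzweil_Integration.integral_nonneg integrable_continuous_real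
            continuous_on_subset[OF continuous_mean_spread]) (auto intro: mean_spread_nonneg)
      have energy: "integral {0..t} (\<lambda>s. expectation (\<lambda>\<omega>. (norm (sqrt \<gamma> *\<^sub>R \<sigma> (X\<gamma> \<gamma> s \<omega>)))\<^sup>2)) \<le> E"
        unfolding E_def by (rule diffusion_energy[OF t0 R Cb C0])
      show "integral {0..t} (D \<gamma>) \<le> \<delta> * t + C * E / \<gamma>"
        if "0 \<le> C" "\<And>x. x \<in> K \<Longrightarrow> bary.spread x \<le> \<delta> + C * (norm (\<sigma> x))\<^sup>2" for \<delta> C
        unfolding D by (rule integral_mean_spread_le[OF \<gamma> refl cont(1) that(2,1) t0 energy])
      show "D \<gamma> t \<le> C\<^sub>1 * h + integral {0..t} (D \<gamma>) / h" if "0 < h" "h \<le> t" for h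
        unfolding D
      proof (rule mean_spread_le_average[OF that _ C1])
        show "mean_spread t \<le> mean_spread s + C\<^sub>1 * (t - s)" if "0 \<le> s" "s \<le> t" for s
          unfolding C\<^sub>1_def by (rule mean_spread_increment[OF that R Cb])
      qed
      fix \<epsilon> :: real assume \<epsilon>: "0 < \<epsilon>"
      have EY': "prob_space.expectation N (\<lambda>\<omega>. f (Y t \<omega>))
          = (\<Sum>z\<in>K\<^sub>0. mean_coordinate z 0 * (\<Sum>y\<in>K\<^sub>0. P t z y * f y))"
        unfolding EY by (intro sum.cong refl) (simp add: initial[OF \<gamma>] mean_coordinate_def)
      have 1: "\<bar>expectation (\<lambda>\<omega>. f (X\<gamma> \<gamma> t \<omega>)) - (\<Sum>z\<in>K\<^sub>0. mean_coordinate z t * f z)\<bar> \<le> L\<^sub>f * (\<epsilon> + mean_spread t / \<epsilon>)"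
        by (rule mean_interpolation_error[OF Lf t0 \<epsilon>])
      have 2: "\<bar>(\<Sum>z\<in>K\<^sub>0. mean_coordinate z t * f z) - (\<Sum>z\<in>K\<^sub>0. mean_coordinate z 0 * (\<Sum>y\<in>K\<^sub>0. P t z y * f y))\<bar>
          \<le> C\<^sub>2 * (\<epsilon> * t + integral {0..t} mean_spread / \<epsilon>)"
        unfolding C\<^sub>2_def
        by (rule averaged_semigroup_error[OF P A Lb _ t0 \<epsilon>]) (use Cf K0K in auto)
      show "\<bar>err \<gamma>\<bar>
        \<le> L\<^sub>f * (\<epsilon> + D \<gamma> t / \<epsilon>) + C\<^sub>2 * (\<epsilon> * t + integral {0..t} (D \<gamma>) / \<epsilon>)"
        unfolding D err_def EY' using 1 2 by linarith
    qed

    have I: "((\<lambda>\<gamma>. integral {0..t} (D \<gamma>)) \<longlongrightarrow> 0) at_top"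
    proof (rule tendsto_zero_of_small_bounds[OF t less_imp_le[OF t]])
      fix \<delta> :: real assume "0 < \<delta>"
      obtain C where C: "0 \<le> C" "\<And>x. x \<in> K \<Longrightarrow> bary.spread x \<le> \<delta> + C * (norm (\<sigma> x))\<^sup>2"
        using bary.spread_le_of_zero_set[OF K(2) cont(1) _ \<open>0 < \<delta>\<close>] K0 by blast
      have "((\<lambda>\<gamma>. C * E / \<gamma>) \<longlongrightarrow> 0) at_top"
        by (intro tendsto_divide_0[OF tendsto_const] filterlim_at_top_imp_at_infinity filterlim_ident)
      moreover have "\<bar>integral {0..t} (D \<gamma>)\<bar> \<le> t * \<delta> + C * E / \<gamma>" if "0 < \<gamma>" for \<gamma>
        using estimates(2,3)[OF that] C by (simp add: mult.commute)
      ultimately show "\<exists>r. (r \<longlongrightarrow> 0) at_top \<and> (\<forall>\<gamma>>0. \<bar>integral {0..t} (D \<gamma>)\<bar> \<le> t * \<delta> + r \<gamma>)" by blast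
    qed
    have Dt: "((\<lambda>\<gamma>. D \<gamma> t) \<longlongrightarrow> 0) at_top"
    proof (rule tendsto_zero_of_small_bounds[OF t C1])
      fix h :: real assume h: "0 < h" "h \<le> t"
      have "((\<lambda>\<gamma>. integral {0..t} (D \<gamma>) / h) \<longlongrightarrow> 0 / h) at_top" by (intro tendsto_intros I) (use h in auto)
      moreover have "\<bar>D \<gamma> t\<bar> \<le> C\<^sub>1 * h + integral {0..t} (D \<gamma>) / h" if "0 < \<gamma>" for \<gamma>
        using estimates(1,4)[OF that] h by simp
      ultimately show "\<exists>r. (r \<longlongrightarrow> 0) at_top \<and> (\<forall>\<gamma>>0. \<bar>D \<gamma> t\<bar> \<le> C\<^sub>1 * h + r \<gamma>)" by auto
    qed
    have "(err \<longlongrightarrow> 0) at_top"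
    proof (rule tendsto_zero_of_small_bounds[OF t, of "L\<^sub>f + C\<^sub>2 * t"])
      show "0 \<le> L\<^sub>f + C\<^sub>2 * t" using nonneg C2 t by simp
      fix \<epsilon> :: real assume \<epsilon>: "0 < \<epsilon>"
      let ?r = "\<lambda>\<gamma>. L\<^sub>f * (D \<gamma> t / \<epsilon>) + C\<^sub>2 * (integral {0..t} (D \<gamma>) / \<epsilon>)"
      have "(?r \<longlongrightarrow> L\<^sub>f * (0 / \<epsilon>) + C\<^sub>2 * (0 / \<epsilon>)) at_top" by (intro tendsto_intros I Dt) (use \<epsilon> in auto)
      moreover have "\<bar>err \<gamma>\<bar>
          \<le> (L\<^sub>f + C\<^sub>2 * t) * \<epsilon> + ?r \<gamma>" if "0 < \<gamma>" for \<gamma>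
        using estimates(5)[OF that \<epsilon>] by (simp add: algebra_simps)
      ultimately show "\<exists>r. (r \<longlongrightarrow> 0) at_top \<and> (\<forall>\<gamma>>0. \<bar>err \<gamma>\<bar> \<le> (L\<^sub>f + C\<^sub>2 * t) * \<epsilon> + r \<gamma>)"
        by (intro exI[of _ ?r]) auto
    qed
    then show ?thesis by (simp add: err_def[abs_def] Lim_null[symmetric])
  qed
  show ?thesis using generator initial_prob convergence by blast
qed

end
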